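(* Let $(\mathfrak W,\mathfrak V)$ be an AVWC. 1. If $\mathfrak W$ is symmetrizable, then $C_{\mathrm S}(\mathfrak W,\mathfrak V)=0$. 2. If $\mathfrak W$ is non-symmetrizable, then $C_{\mathrm S}(\mathfrak W,\mathfrak V)=C^{\mathrm{mean}}_{\mathrm{S,ran}}(\mathfrak W,\mathfrak V)$.
   Context: All alphabets are finite; logs base 2; $C(\mathcal A,\mathcal B)$ denotes channels from $\mathcal A$ to $\mathcal B$. An AVWC $(\mathfrak W,\mathfrak V)$: alphabets $\mathcal X$ (input), $\mathcal Y$ (Bob), $\mathcal Z$ (Eve), finite state set $\mathcal S$, channels $W_s\in C(\mathcal X,\mathcal Y)$, $V_s\in C(\mathcal X,\mathcal Z)$; $W_{s^n}=W_{s_1}\otimes\cdots\otimes W_{s_n}$, $V_{s^n}$ likewise. $\mathfrak W=(W_s)_s$ is symmetrizable if there is $U\in C(\mathcal X,\mathcal S)$ with $\sum_su(s|x)w_s(y|x')=\sum_su(s|x')w_s(y|x)$ for all $x,x'\in\mathcal X$, $y\in\mathcal Y$. A common randomness assisted code of blocklength $n$: $K,\Gamma\in\mathbb N$, stochastic encoders $e^\gamma\in C([K],\mathcal X^n)$, sets $D^\gamma_k\subset\mathcal Y^n$ disjoint in $k$ for each $\gamma$; average error $1-\min_{s^n}\frac1{K\Gamma}\sum_{k,\gamma}\sum_{x^n}e^\gamma(x^n|k)w_{s^n}(D^\gamma_k|x^n)$. Random variables: message $\mathfrak K$ uniform on $[K]$, independent $\mathfrak\Gamma$ uniform on $[\Gamma]$,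 input $x^n\sim e^\gamma(\cdot|k)$, Eve's output $\mathfrak Z_{s^n}\sim V_{s^n}(\cdot|x^n)$. $C_{\mathrm S}(\mathfrak W,\mathfrak V)$ (uncorrelated coding secrecy capacity) is the supremum of $R$ such that there are such codes with $\Gamma_n=1$, error $\to0$, $\liminf\frac1n\log K_n=R$ and $\limsup_n\max_{s^n}I(\mathfrak K_n;\mathfrak Z_{s^n})=0$. $C^{\mathrm{mean}}_{\mathrm{S,ran}}(\mathfrak W,\mathfrak V)$ (correlated random coding mean secrecy capacity) is the supremum of $R$ such that there are such codes (arbitrary $\Gamma_n$) with error $\to0$, $\liminf\frac1n\log K_n=R$ and $\limsup_n\max_{s^n}I(\mathfrak K_n;\mathfrak Z_{s^n}|\mathfrak\Gamma_n)=0$. *)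

theory Defs
  imports "HOL-Analysis.Analysis"
begin

text \<open>Finite alphabets are modelled by finite types. A channel from 'a to 'b is a
  function giving transition probabilities \<open>W a b = w(b|a)\<close>.\<close>

definition channel :: "('a::finite \<Rightarrow> 'b::finite \<Rightarrow> real) \<Rightarrow> bool" where
  "channel W \<longleftrightarrow> (\<forall>a b. 0 \<le> W a b) \<and> (\<forall>a. (\<Sum>b\<in>UNIV. W a b) = 1)"

definition seqs :: "nat \<Rightarrow> 'a list set" where
  "seqs n = {xs. length xs = n}"

definition prodch :: "('s \<Rightarrow> 'x \<Rightarrow> 'y \<Rightarrow> real) \<Rightarrow> 's list \<Rightarrow> 'x list \<Rightarrow> 'y list \<Rightarrow> real" where
  "prodch W sn xn yn = (\<Prod>i<length sn. W (sn ! i) (xn ! i) (yn ! i))"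

definition symmetrizable :: "('s::finite \<Rightarrow> 'x::finite \<Rightarrow> 'y::finite \<Rightarrow> real) \<Rightarrow> bool" where
  "symmetrizable W \<longleftrightarrow> (\<exists>U :: 'x \<Rightarrow> 's \<Rightarrow> real. channel U \<and>
     (\<forall>x x' y. (\<Sum>s\<in>UNIV. U x s * W s x' y) = (\<Sum>s\<in>UNIV. U x' s * W s x y)))"

text \<open>Common randomness assisted code of blocklength n: messages \<open>{..<K}\<close>,
  randomness values \<open>{..<\<Gamma>}\<close>, encoders \<open>e \<gamma> k\<close> (distributions on words of length n),
  decoding sets \<open>D \<gamma> k\<close>, disjoint in k.\<close>
definition is_code :: "nat \<Rightarrow> nat \<Rightarrow> nat \<Rightarrow> (nat \<Rightarrow> nat \<Rightarrow> 'x list \<Rightarrow> real)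
    \<Rightarrow> (nat \<Rightarrow> nat \<Rightarrow> 'y list set) \<Rightarrow> bool" where
  "is_code n K \<Gamma> e D \<longleftrightarrow> 1 \<le> K \<and> 1 \<le> \<Gamma> \<and>
     (\<forall>\<gamma><\<Gamma>. \<forall>k<K. (\<forall>xn. 0 \<le> e \<gamma> k xn) \<and> (\<forall>xn. xn \<notin> seqs n \<longrightarrow> e \<gamma> k xn = 0)
        \<and> (\<Sum>xn\<in>seqs n. e \<gamma> k xn) = 1 \<and> D \<gamma> k \<subseteq> seqs n) \<and>
     (\<forall>\<gamma><\<Gamma>. \<forall>k<K. \<forall>k'<K. k \<noteq> k' \<longrightarrow> D \<gamma> k \<inter> D \<gamma> k' = {})"

definition code_success :: "('s \<Rightarrow> 'x \<Rightarrow> 'y \<Rightarrow> real) \<Rightarrow> nat \<Rightarrow> nat \<Rightarrow> nat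
    \<Rightarrow> (nat \<Rightarrow> nat \<Rightarrow> 'x list \<Rightarrow> real) \<Rightarrow> (nat \<Rightarrow> nat \<Rightarrow> 'y list set) \<Rightarrow> 's list \<Rightarrow> real" where
  "code_success W n K \<Gamma> e D sn = (1 / (real K * real \<Gamma>)) *
     (\<Sum>\<gamma><\<Gamma>. \<Sum>k<K. \<Sum>xn\<in>seqs n. e \<gamma> k xn * (\<Sum>yn\<in>D \<gamma> k. prodch W sn xn yn))"

definition code_error :: "('s::finite \<Rightarrow> 'x \<Rightarrow> 'y \<Rightarrow> real) \<Rightarrow> nat \<Rightarrow> nat \<Rightarrow> nat
    \<Rightarrow> (nat \<Rightarrow> nat \<Rightarrow> 'x list \<Rightarrow> real) \<Rightarrow> (nat \<Rightarrow> nat \<Rightarrow> 'y list set) \<Rightarrow> real" where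
  "code_error W n K \<Gamma> e D = 1 - Min ((code_success W n K \<Gamma> e D) ` seqs n)"

definition mutual_info :: "('a \<Rightarrow> 'b \<Rightarrow> real) \<Rightarrow> 'a set \<Rightarrow> 'b set \<Rightarrow> real" where
  "mutual_info p A B = (\<Sum>a\<in>A. \<Sum>b\<in>B. if p a b = 0 then 0 else
      p a b * log 2 (p a b / ((\<Sum>b'\<in>B. p a b') * (\<Sum>a'\<in>A. p a' b))))"

definition cond_mutual_info :: "('c \<Rightarrow> 'a \<Rightarrow> 'b \<Rightarrow> real) \<Rightarrow> 'c set \<Rightarrow> 'a set \<Rightarrow> 'b set \<Rightarrow> real" where
  "cond_mutual_info p C A B = (\<Sum>c\<in>C. let pc = (\<Sum>a\<in>A. \<Sum>b\<in>B. p c a b) in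
      if pc = 0 then 0 else pc * mutual_info (\<lambda>a b. p c a b / pc) A B)"

definition code_joint :: "('s \<Rightarrow> 'x \<Rightarrow> 'z \<Rightarrow> real) \<Rightarrow> nat \<Rightarrow> nat \<Rightarrow> nat
    \<Rightarrow> (nat \<Rightarrow> nat \<Rightarrow> 'x list \<Rightarrow> real) \<Rightarrow> 's list \<Rightarrow> nat \<Rightarrow> nat \<Rightarrow> 'z list \<Rightarrow> real" where
  "code_joint V n K \<Gamma> e sn \<gamma> k zn = (1 / (real \<Gamma> * real K)) *
     (\<Sum>xn\<in>seqs n. e \<gamma> k xn * prodch V sn xn zn)"

definition code_leak :: "('s::finite \<Rightarrow> 'x \<Rightarrow> 'z::finite \<Rightarrow> real) \<Rightarrow> nat \<Rightarrow> nat \<Rightarrow> nat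
    \<Rightarrow> (nat \<Rightarrow> nat \<Rightarrow> 'x list \<Rightarrow> real) \<Rightarrow> real" where
  "code_leak V n K \<Gamma> e = Max ((\<lambda>sn. cond_mutual_info (code_joint V n K \<Gamma> e sn)
       {..<\<Gamma>} {..<K} (seqs n)) ` seqs n)"

definition achievable_mean_ran ::
    "('s::finite \<Rightarrow> 'x::finite \<Rightarrow> 'y::finite \<Rightarrow> real) \<Rightarrow> ('s \<Rightarrow> 'x \<Rightarrow> 'z::finite \<Rightarrow> real)
     \<Rightarrow> bool \<Rightarrow> real \<Rightarrow> bool" where
  "achievable_mean_ran W V uncorr R \<longleftrightarrow>
     (\<exists>(K :: nat \<Rightarrow> nat) (\<Gamma> :: nat \<Rightarrow> nat) (e :: nat \<Rightarrow> nat \<Rightarrow> nat \<Rightarrow> 'x list \<Rightarrow> real)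
        (D :: nat \<Rightarrow> nat \<Rightarrow> nat \<Rightarrow> 'y list set).
        (\<forall>n. is_code n (K n) (\<Gamma> n) (e n) (D n)) \<and>
        (uncorr \<longrightarrow> (\<forall>n. \<Gamma> n = 1)) \<and>
        (\<lambda>n. code_error W n (K n) (\<Gamma> n) (e n) (D n)) \<longlonglongrightarrow> 0 \<and>
        liminf (\<lambda>n. ereal (log 2 (real (K n)) / real n)) = ereal R \<and>
        limsup (\<lambda>n. ereal (code_leak V n (K n) (\<Gamma> n) (e n))) = 0)"

definition C_S :: "('s::finite \<Rightarrow> 'x::finite \<Rightarrow> 'y::finite \<Rightarrow> real) \<Rightarrow> ('s \<Rightarrow> 'x \<Rightarrow> 'z::finite \<Rightarrow> real) \<Rightarrow> real" where
  "C_S W V = Sup {R. achievable_mean_ran W V True R}"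

definition C_S_ran_mean :: "('s::finite \<Rightarrow> 'x::finite \<Rightarrow> 'y::finite \<Rightarrow> real) \<Rightarrow> ('s \<Rightarrow> 'x \<Rightarrow> 'z::finite \<Rightarrow> real) \<Rightarrow> real" where
  "C_S_ran_mean W V = Sup {R. achievable_mean_ran W V False R}"

end

theory Submission
  imports Defs
begin

text \<open>
  If \<open>U\<close> symmetrizes \<open>W\<close>, a jammer who feeds a codeword of a random message through \<open>U\<close> makes
  it indistinguishable from the codeword sent, so two or more messages suffer error at least 1/4.

  If \<open>W\<close> is not symmetrizable, a code with common randomness is derandomized. Of the values of
  the common randomness, polynomially many suffice for every state sequence at once, and the
  encoder draws one of them itself and announces it in a prefix of length \<open>o(n)\<close>. The prefix may
  become known to the eavesdropper, but mean secrecy conditions on the common randomness anyway.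

  The prefix code uses \<open>N\<close> codewords of length \<open>q ^ N\<close> (\<open>q\<close> the input alphabet size), the
  \<open>i\<close>-th one listing the \<open>i\<close>-th letters of all input words of length \<open>N\<close>. They are exactly
  4-wise independent, so by Bessel's inequality a state sequence is correlated with only boundedly
  many codewords and pairs of codewords. The decoder accepts \<open>i\<close> if some state sequence
  uncorrelated with \<open>i\<close> explains the output jointly with every other codeword; were two
  messages accepted, the two explanations would nearly symmetrize \<open>W\<close>, which compactness of the
  set of channels excludes. The error is \<open>O(1/N)\<close>, and with \<open>N\<close> of order \<open>log n\<close> a concatenation
  of \<open>O(log n / log log n)\<close> blocks announces polynomially many values with vanishing error.
\<close>

section \<open>Words and product channels\<close>

text \<open>Randomly chosen codewords would have to be controlled uniformly over exponentially many
  state sequences. Exact orthogonality avoids this: the indicator of a state is a vector indexed by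
  time, and Bessel bounds all its squared correlations together by a constant independent of
  \<open>N\<close>. So for each state sequence only boundedly many codewords are spoilt, which an
  average error tolerates at cost O(1/N). Pairs of codewords enter because disjointness of the
  decoding sets rests on joint frequencies of two codewords with the output. The price is a tiny
  rate, \<open>N\<close> messages in length \<open>q ^ N\<close>; it is affordable because only
  polynomially many values are announced. The polynomial is \<open>n ^ 6\<close> for this reason:
  the leakage of one value of the common randomness can be of order n, so sampled averages must be
  accurate to o(1/n), here \<open>1 / n ^ 2\<close>. With \<open>L\<close> samples the failure
  exponent is of order \<open>L / (4 * n ^ 4)\<close> and must exceed the logarithm of the number of
  constraints, which is linear in n; \<open>L \<ge> n ^ 6\<close> yields
  \<open>n ^ 2 / 4\<close>.\<close>

lemma finite_seqs [simp]: "finite (seqs n :: 'a::finite list set)"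
  using finite_lists_length_eq[of "UNIV :: 'a set" n] by (simp add: seqs_def)

lemma seqs_nonempty [simp]: "(seqs n :: 'a list set) \<noteq> {}"
  by (auto simp: seqs_def intro!: exI[of _ "replicate n undefined"])

lemma card_seqs: "card (seqs n :: 'a::finite list set) = CARD('a) ^ n"
  using card_lists_length_eq[of "UNIV :: 'a set" n] by (simp add: seqs_def)

lemma length_seqs: "x \<in> seqs n \<Longrightarrow> length x = n"
  by (simp add: seqs_def)

lemma seqs_0 [simp]: "seqs 0 = {[]}"
  by (auto simp: seqs_def)

lemma append_in_seqs: "x \<in> seqs m \<Longrightarrow> y \<in> seqs n \<Longrightarrow> x @ y \<in> seqs (m + n)"
  by (simp add: seqs_def)

lemma seqs_append_cases:
  assumes "x \<in> seqs (m + n)"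
  obtains x1 x2 where "x = x1 @ x2" "x1 \<in> seqs m" "x2 \<in> seqs n"
  using assms that[of "take m x" "drop m x"] by (simp add: seqs_def)

lemma sum_seqs_append:
  fixes g :: "'a::finite list \<Rightarrow> 'c::comm_monoid_add"
  shows "(\<Sum>x\<in>seqs (m + n). g x) = (\<Sum>x\<in>seqs m. \<Sum>y\<in>seqs n. g (x @ y))"
proof -
  have "(\<Sum>x\<in>seqs (m + n). g x) = (\<Sum>(x, y)\<in>seqs m \<times> seqs n. g (x @ y))"
    by (rule sum.reindex_bij_witness[of _ "\<lambda>(x, y). x @ y" "\<lambda>x. (take m x, drop m x)"])
       (auto simp: seqs_def)
  then show ?thesis
    by (simp add: sum.cartesian_product)
qed

lemma sum_seqs_Suc:
  fixes g :: "'a::finite list \<Rightarrow> 'c::comm_monoid_add"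
  shows "(\<Sum>x\<in>seqs (Suc n). g x) = (\<Sum>a\<in>UNIV. \<Sum>x\<in>seqs n. g (a # x))"
proof -
  have "(\<Sum>x\<in>seqs (Suc n). g x) = (\<Sum>(a, x)\<in>UNIV \<times> seqs n. g (a # x))"
    by (rule sum.reindex_bij_witness[of _ "\<lambda>(a, x). a # x" "\<lambda>x. (hd x, tl x)"])
       (auto simp: seqs_def length_Suc_conv)
  then show ?thesis
    by (simp add: sum.cartesian_product)
qed

lemma sum_seqs_prod:
  fixes f :: "nat \<Rightarrow> 'a::finite \<Rightarrow> real"
  shows "(\<Sum>x\<in>seqs n. \<Prod>i<n. f i (x ! i)) = (\<Prod>i<n. \<Sum>a\<in>UNIV. f i a)"
proof (induction n arbitrary: f)
  case (Suc n)
  show ?case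
    unfolding sum_seqs_Suc prod.lessThan_Suc_shift
    by (simp add: Suc.IH[of "\<lambda>i. f (Suc i)"] flip: sum_distrib_left sum_distrib_right)
qed simp

text \<open>Cross terms of independent centred variables vanish, so variances add. Both moments go
  through one induction because the cross term of the second contains the first moment of the
  tail.\<close>

lemma second_moment_seqs:
  fixes p h :: "nat \<Rightarrow> 'a::finite \<Rightarrow> real"
  assumes "\<And>i. (\<Sum>a\<in>UNIV. p i a) = 1" "\<And>i. (\<Sum>a\<in>UNIV. p i a * h i a) = 0"
  shows "(\<Sum>x\<in>seqs n. (\<Prod>i<n. p i (x ! i)) * (\<Sum>i<n. h i (x ! i))) = 0"
    and "(\<Sum>x\<in>seqs n. (\<Prod>i<n. p i (x ! i)) * (\<Sum>i<n. h i (x ! i))\<^sup>2)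
           = (\<Sum>i<n. \<Sum>a\<in>UNIV. p i a * (h i a)\<^sup>2)"
proof -
  have "(\<Sum>x\<in>seqs n. (\<Prod>i<n. p i (x ! i)) * (\<Sum>i<n. h i (x ! i))) = 0 \<and>
        (\<Sum>x\<in>seqs n. (\<Prod>i<n. p i (x ! i)) * (\<Sum>i<n. h i (x ! i))\<^sup>2)
           = (\<Sum>i<n. \<Sum>a\<in>UNIV. p i a * (h i a)\<^sup>2)"
    using assms
  proof (induction n arbitrary: p h)
    case (Suc n)
    define P where "P = (\<lambda>x. \<Prod>i<n. p (Suc i) (x ! i))"
    define H where "H = (\<lambda>x. \<Sum>i<n. h (Suc i) (x ! i))"
    have IH: "(\<Sum>x\<in>seqs n. P x * H x) = 0"
      "(\<Sum>x\<in>seqs n. P x * (H x)\<^sup>2) = (\<Sum>i<n. \<Sum>a\<in>UNIV. p (Suc i) a * (h (Suc i) a)\<^sup>2)"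
      using Suc.IH[of "\<lambda>i. p (Suc i)" "\<lambda>i. h (Suc i)"] Suc.prems by (auto simp: P_def H_def)
    have P1: "(\<Sum>x\<in>seqs n. P x) = 1"
      using sum_seqs_prod[of "\<lambda>i. p (Suc i)" n] Suc.prems by (simp add: P_def)
    have "(\<Sum>x\<in>seqs (Suc n). (\<Prod>i<Suc n. p i (x ! i)) * (\<Sum>i<Suc n. h i (x ! i)))
       = (\<Sum>a\<in>UNIV. \<Sum>x\<in>seqs n. (p 0 a * h 0 a) * P x + p 0 a * (P x * H x))"
      unfolding sum_seqs_Suc prod.lessThan_Suc_shift sum.lessThan_Suc_shift P_def H_def
      by (intro sum.cong refl) (simp add: algebra_simps)
    also have "\<dots> = 0"
      using Suc.prems by (simp add: sum.distrib IH P1 flip: sum_distrib_left)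
    finally have 1: "(\<Sum>x\<in>seqs (Suc n). (\<Prod>i<Suc n. p i (x ! i)) * (\<Sum>i<Suc n. h i (x ! i))) = 0" .
    have "(\<Sum>x\<in>seqs (Suc n). (\<Prod>i<Suc n. p i (x ! i)) * (\<Sum>i<Suc n. h i (x ! i))\<^sup>2)
       = (\<Sum>a\<in>UNIV. \<Sum>x\<in>seqs n. (p 0 a * (h 0 a)\<^sup>2) * P x + (2 * (p 0 a * h 0 a)) * (P x * H x)
             + p 0 a * (P x * (H x)\<^sup>2))"
      unfolding sum_seqs_Suc prod.lessThan_Suc_shift sum.lessThan_Suc_shift P_def H_def
      by (intro sum.cong refl) (simp add: algebra_simps power2_eq_square)
    also have "\<dots> = (\<Sum>a\<in>UNIV. p 0 a * (h 0 a)\<^sup>2) + (\<Sum>x\<in>seqs n. P x * (H x)\<^sup>2)"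
      using Suc.prems(1)[of 0]
      by (simp add: sum.distrib IH(1) P1 flip: sum_distrib_left sum_distrib_right)
    also have "\<dots> = (\<Sum>i<Suc n. \<Sum>a\<in>UNIV. p i a * (h i a)\<^sup>2)"
      unfolding IH(2) by (simp only: sum.lessThan_Suc_shift)
    finally show ?case using 1 by blast
  qed simp
  then show "(\<Sum>x\<in>seqs n. (\<Prod>i<n. p i (x ! i)) * (\<Sum>i<n. h i (x ! i))) = 0"
    and "(\<Sum>x\<in>seqs n. (\<Prod>i<n. p i (x ! i)) * (\<Sum>i<n. h i (x ! i))\<^sup>2)
           = (\<Sum>i<n. \<Sum>a\<in>UNIV. p i a * (h i a)\<^sup>2)" by blast+
qed

lemma channel_nonneg: "channel W \<Longrightarrow> 0 \<le> W a b"
  by (simp add: channel_def)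

lemma channel_sum: "channel W \<Longrightarrow> (\<Sum>b\<in>UNIV. W a b) = 1"
  by (simp add: channel_def)

lemma channel_le_1: "channel W \<Longrightarrow> W a b \<le> 1"
  unfolding channel_def
  by (metis finite UNIV_I member_le_sum)

lemma prodch_nonneg: "\<forall>s. channel (W s) \<Longrightarrow> 0 \<le> prodch W sn xn yn"
  unfolding prodch_def by (intro prod_nonneg) (simp add: channel_nonneg)

lemma sum_prodch:
  fixes W :: "'s \<Rightarrow> 'x::finite \<Rightarrow> 'y::finite \<Rightarrow> real"
  assumes "\<forall>s. channel (W s)" "length sn = n"
  shows "(\<Sum>yn\<in>seqs n. prodch W sn xn yn) = 1"
  using sum_seqs_prod[of "\<lambda>i. W (sn ! i) (xn ! i)" n] assms
  by (simp add: prodch_def channel_sum)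

lemma sum_prodch_subset_le:
  fixes W :: "'s \<Rightarrow> 'x::finite \<Rightarrow> 'y::finite \<Rightarrow> real"
  assumes "\<forall>s. channel (W s)" "length sn = n" "D \<subseteq> seqs n"
  shows "0 \<le> (\<Sum>yn\<in>D. prodch W sn xn yn)" "(\<Sum>yn\<in>D. prodch W sn xn yn) \<le> 1"
proof -
  show "0 \<le> (\<Sum>yn\<in>D. prodch W sn xn yn)"
    by (intro sum_nonneg prodch_nonneg assms)
  have "(\<Sum>yn\<in>D. prodch W sn xn yn) \<le> (\<Sum>yn\<in>seqs n. prodch W sn xn yn)"
    by (intro sum_mono2 assms prodch_nonneg) auto
  then show "(\<Sum>yn\<in>D. prodch W sn xn yn) \<le> 1"
    using sum_prodch[OF assms(1,2)] by simp
qed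

lemma prodch_le_1:
  fixes W :: "'s \<Rightarrow> 'x::finite \<Rightarrow> 'y::finite \<Rightarrow> real"
  assumes "\<forall>s. channel (W s)"
  shows "prodch W sn xn yn \<le> 1"
  unfolding prodch_def by (intro prod_le_1) (use assms in \<open>auto simp: channel_nonneg channel_le_1\<close>)

lemma prodch_append:
  assumes "length s1 = length x1" "length s1 = length y1"
  shows "prodch W (s1 @ s2) (x1 @ x2) (y1 @ y2) = prodch W s1 x1 y1 * prodch W s2 x2 y2"
proof -
  have split: "{..<length s1 + length s2} = {..<length s1} \<union> (\<lambda>i. length s1 + i) ` {..<length s2}"
  proof (intro equalityI subsetI)
    fix i assume "i \<in> {..<length s1 + length s2}"
    then show "i \<in> {..<length s1} \<union> (\<lambda>i. length s1 + i) ` {..<length s2}"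
      by (cases "i < length s1") (auto intro!: image_eqI[of _ _ "i - length s1"])
  qed auto
  have disj: "{..<length s1} \<inter> (\<lambda>i. length s1 + i) ` {..<length s2} = {}" by auto
  show ?thesis
    unfolding prodch_def length_append split
    by (subst prod.union_disjoint)
       (use assms disj in \<open>auto simp: prod.reindex nth_append intro!: arg_cong2[of _ _ _ _ "(*)"] prod.cong\<close>)
qed

section \<open>The symmetrizability gap, Bessel and Chebyshev inequalities\<close>

lemma compact_channels:
  "compact {u :: real^'s::finite^'x::finite. (\<forall>x s. 0 \<le> u $ x $ s) \<and> (\<forall>x. (\<Sum>s\<in>UNIV. u $ x $ s) = 1)}"
    (is "compact ?K")
proof -
  have "closed ?K"
    by (intro closed_Collect_conj closed_Collect_all closed_Collect_le closed_Collect_eq continuous_intros)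
  moreover have "norm u \<le> real CARD('x)" if "u \<in> ?K" for u
  proof -
    have "norm u \<le> (\<Sum>x\<in>UNIV. norm (u $ x))"
      unfolding norm_vec_def by (rule L2_set_le_sum) simp
    also have "\<dots> \<le> (\<Sum>x\<in>UNIV. \<Sum>s\<in>UNIV. \<bar>u $ x $ s\<bar>)"
      by (intro sum_mono norm_le_l1_cart)
    also have "\<dots> = real CARD('x)"
      using that by simp
    finally show ?thesis .
  qed
  then have "bounded ?K"
    unfolding bounded_iff by blast
  ultimately show ?thesis
    by (simp add: compact_eq_bounded_closed)
qed

text \<open>The decoder will supply two channels, one per explanation, whereas
  \<open>symmetrizable\<close> speaks of one; hence the gap is stated for pairs. The total defect
  \<open>F\<close> attains its minimum on the compact set of channels, and a zero of
  \<open>F\<close> would be a symmetrizing channel.\<close>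

lemma not_symmetrizable_gap:
  fixes W :: "'s::finite \<Rightarrow> 'x::finite \<Rightarrow> 'y::finite \<Rightarrow> real"
  assumes "\<not> symmetrizable W"
  obtains \<zeta> where "\<zeta> > 0" "\<And>U U'. channel U \<Longrightarrow> channel U' \<Longrightarrow>
    \<exists>a b c. \<bar>(\<Sum>s\<in>UNIV. U b s * W s a c) - (\<Sum>s\<in>UNIV. U' a s * W s b c)\<bar> \<ge> \<zeta>"
proof -
  define K where "K = {u :: real^'s^'x. (\<forall>x s. 0 \<le> u $ x $ s) \<and> (\<forall>x. (\<Sum>s\<in>UNIV. u $ x $ s) = 1)}"
  define F where "F = (\<lambda>u :: real^'s^'x. \<Sum>a\<in>UNIV. \<Sum>b\<in>UNIV. \<Sum>c\<in>UNIV.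
    \<bar>(\<Sum>s\<in>UNIV. u $ b $ s * W s a c) - (\<Sum>s\<in>UNIV. u $ a $ s * W s b c)\<bar>)"
  have "(\<chi> x s. 1 / real CARD('s)) \<in> K"
    by (simp add: K_def)
  moreover have "continuous_on K F"
    unfolding F_def by (intro continuous_intros)
  moreover have "compact K"
    unfolding K_def by (rule compact_channels)
  ultimately obtain u where u: "u \<in> K" "\<And>v. v \<in> K \<Longrightarrow> F u \<le> F v"
    using continuous_attains_inf[of K F] by blast
  have "F u > 0"
  proof (rule ccontr)
    assume "\<not> F u > 0"
    then have "F u = 0"
      unfolding F_def by (meson abs_ge_zero linorder_not_less order_antisym sum_nonneg)
    then have "\<forall>a b c. (\<Sum>s\<in>UNIV. u $ b $ s * W s a c) = (\<Sum>s\<in>UNIV. u $ a $ s * W s b c)"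
      by (simp add: F_def sum_nonneg_eq_0_iff sum_nonneg)
    moreover have "channel (\<lambda>x s. u $ x $ s)"
      using u(1) by (auto simp: channel_def K_def)
    ultimately have "symmetrizable W"
      unfolding symmetrizable_def by (intro exI[of _ "\<lambda>x s. u $ x $ s"]) auto
    with assms show False by contradiction
  qed
  \<comment> \<open>\<open>M\<close> counts the summands of \<open>F\<close>. If every defect were
    below \<open>F u / (2 * M)\<close>, the averaged channel \<open>v\<close> would satisfy
    \<open>F v \<le> F u / 2\<close>, against the minimality of \<open>u\<close>.\<close>
  define M where "M = real (CARD('x) * CARD('x) * CARD('y))"
  have M: "M > 0" by (simp add: M_def)
  show thesis
  proof (rule that[of "F u / (2 * M)"])
    show "F u / (2 * M) > 0" using \<open>F u > 0\<close> M by simp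
  next
    fix U U' :: "'x \<Rightarrow> 's \<Rightarrow> real"
    assume ch: "channel U" "channel U'"
    define D where "D = (\<lambda>a b c. (\<Sum>s\<in>UNIV. U b s * W s a c) - (\<Sum>s\<in>UNIV. U' a s * W s b c))"
    show "\<exists>a b c. \<bar>D a b c\<bar> \<ge> F u / (2 * M)"
    proof (rule ccontr)
      assume "\<not> (\<exists>a b c. \<bar>D a b c\<bar> \<ge> F u / (2 * M))"
      then have small: "\<bar>D a b c\<bar> < F u / (2 * M)" for a b c
        by (meson not_le)
      \<comment> \<open>If \<open>U\<close> and \<open>U'\<close> nearly symmetrize each other, their average nearly symmetrizes \<open>W\<close>.\<close>
      define v :: "real^'s^'x" where "v = (\<chi> x s. (U x s + U' x s) / 2)"
      have "v \<in> K"
        using ch by (auto simp: K_def v_def channel_def sum.distrib simp flip: sum_divide_distrib)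
      \<comment> \<open>Exchanging \<open>a\<close> and \<open>b\<close> in \<open>D\<close>
        exchanges the roles of \<open>U\<close> and \<open>U'\<close>, so the antisymmetric part of
        \<open>D\<close> is the defect of their average.\<close>
      have eq: "(\<Sum>s\<in>UNIV. v $ b $ s * W s a c) - (\<Sum>s\<in>UNIV. v $ a $ s * W s b c)
          = (D a b c - D b a c) / 2" for a b c
        unfolding D_def v_def
        by (simp add: sum.distrib algebra_simps add_divide_distrib flip: sum_divide_distrib)
      have "F v = (\<Sum>a\<in>(UNIV::'x set). \<Sum>b\<in>(UNIV::'x set). \<Sum>c\<in>(UNIV::'y set). \<bar>(D a b c - D b a c) / 2\<bar>)"
        unfolding F_def eq ..
      also have "\<dots> \<le> (\<Sum>a\<in>(UNIV::'x set). \<Sum>b\<in>(UNIV::'x set). \<Sum>c\<in>(UNIV::'y set). F u / (2 * M))"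
      proof (intro sum_mono)
        have *: "\<bar>(x - y) / 2\<bar> \<le> e" if "\<bar>x\<bar> < e" "\<bar>y\<bar> < e" for x y e :: real
          using that by (auto simp: abs_le_iff abs_less_iff)
        fix a b c show "\<bar>(D a b c - D b a c) / 2\<bar> \<le> F u / (2 * M)"
          by (intro * small)
      qed
      also have "\<dots> = F u / 2"
        using M by (simp add: M_def)
      finally have "F v < F u" using \<open>F u > 0\<close> by linarith
      with u(2)[OF \<open>v \<in> K\<close>] show False by linarith
    qed
  qed
qed

text \<open>Expand the nonnegative square norm of \<open>M * g - h\<close>, where \<open>h\<close>
  combines the \<open>f i\<close> with their coefficients as weights. The \<open>f i\<close> are
  bounded rather than normalized; for entries of absolute value at most 1, \<open>M\<close> will be
  the number of time instants.\<close>

lemma bessel_sum: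
  fixes f :: "'i \<Rightarrow> 'r \<Rightarrow> real"
  assumes "finite I" "finite R" "M > 0"
    and orth: "\<And>i k. i \<in> I \<Longrightarrow> k \<in> I \<Longrightarrow> i \<noteq> k \<Longrightarrow> (\<Sum>r\<in>R. f i r * f k r) = 0"
    and f: "\<And>i. i \<in> I \<Longrightarrow> (\<Sum>r\<in>R. (f i r)\<^sup>2) \<le> M"
    and g: "(\<Sum>r\<in>R. (g r)\<^sup>2) \<le> M"
  shows "(\<Sum>i\<in>I. (\<Sum>r\<in>R. f i r * g r)\<^sup>2) \<le> M\<^sup>2"
proof -
  define c where "c = (\<lambda>i. \<Sum>r\<in>R. f i r * g r)"
  define h where "h = (\<lambda>r. \<Sum>i\<in>I. c i * f i r)"
  have gh: "(\<Sum>r\<in>R. g r * h r) = (\<Sum>i\<in>I. (c i)\<^sup>2)"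
  proof -
    have "(\<Sum>r\<in>R. g r * h r) = (\<Sum>i\<in>I. \<Sum>r\<in>R. c i * (f i r * g r))"
      unfolding h_def sum_distrib_left by (subst sum.swap) (simp add: algebra_simps)
    then show ?thesis by (simp add: c_def power2_eq_square sum_distrib_left)
  qed
  have fh: "(\<Sum>r\<in>R. f i r * h r) = c i * (\<Sum>r\<in>R. (f i r)\<^sup>2)" if "i \<in> I" for i
  proof -
    have "(\<Sum>r\<in>R. f i r * h r) = (\<Sum>k\<in>I. c k * (\<Sum>r\<in>R. f i r * f k r))"
      unfolding h_def sum_distrib_left by (subst sum.swap) (simp add: algebra_simps)
    also have "\<dots> = (\<Sum>k\<in>I. if k = i then c i * (\<Sum>r\<in>R. (f i r)\<^sup>2) else 0)"
      using orth that by (intro sum.cong) (auto simp: power2_eq_square)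
    finally show ?thesis using that \<open>finite I\<close> by simp
  qed
  have "(\<Sum>r\<in>R. (h r)\<^sup>2) = (\<Sum>i\<in>I. c i * (\<Sum>r\<in>R. f i r * h r))"
  proof -
    have "(\<Sum>r\<in>R. (h r)\<^sup>2) = (\<Sum>r\<in>R. \<Sum>i\<in>I. c i * (f i r * h r))"
      by (simp add: power2_eq_square h_def sum_distrib_right mult.assoc)
    then show ?thesis by (subst (asm) sum.swap) (simp add: sum_distrib_left)
  qed
  also have "\<dots> = (\<Sum>i\<in>I. (c i)\<^sup>2 * (\<Sum>r\<in>R. (f i r)\<^sup>2))"
    by (intro sum.cong) (simp_all add: fh power2_eq_square)
  also have "\<dots> \<le> (\<Sum>i\<in>I. (c i)\<^sup>2 * M)"
    by (intro sum_mono mult_left_mono f) auto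
  finally have hh: "(\<Sum>r\<in>R. (h r)\<^sup>2) \<le> M * (\<Sum>i\<in>I. (c i)\<^sup>2)"
    by (simp add: sum_distrib_left mult.commute)
  have "0 \<le> (\<Sum>r\<in>R. (M * g r - h r)\<^sup>2)"
    by (intro sum_nonneg) simp
  also have "\<dots> = M\<^sup>2 * (\<Sum>r\<in>R. (g r)\<^sup>2) - 2 * M * (\<Sum>r\<in>R. g r * h r) + (\<Sum>r\<in>R. (h r)\<^sup>2)"
    by (simp add: power2_diff sum.distrib sum_subtractf sum_distrib_left power_mult_distrib algebra_simps)
  also have "\<dots> \<le> M\<^sup>2 * M - M * (\<Sum>i\<in>I. (c i)\<^sup>2)"
    using mult_left_mono[OF g, of "M\<^sup>2"] hh by (simp add: gh)
  finally have "M * (\<Sum>i\<in>I. (c i)\<^sup>2) \<le> M * M\<^sup>2"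
    by (simp add: power2_eq_square)
  then show ?thesis
    using \<open>M > 0\<close> by (simp add: c_def)
qed

lemma chebyshev_seqs:
  fixes p h :: "nat \<Rightarrow> 'a::finite \<Rightarrow> real" and \<eta> :: real
  assumes p: "\<And>i a. 0 \<le> p i a" "\<And>i. (\<Sum>a\<in>UNIV. p i a) = 1"
    and h: "\<And>i. (\<Sum>a\<in>UNIV. p i a * h i a) = 0" "\<And>i a. \<bar>h i a\<bar> \<le> 1"
    and "\<eta> > 0" "n > 0"
  shows "(\<Sum>x\<in>seqs n. (\<Prod>i<n. p i (x ! i)) * of_bool (\<bar>(\<Sum>i<n. h i (x ! i)) / n\<bar> > \<eta>)) \<le> 1 / (n * \<eta>\<^sup>2)"
proof -
  have markov: "of_bool (\<bar>z\<bar> > \<eta>) \<le> z\<^sup>2 / \<eta>\<^sup>2" for z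
    using \<open>\<eta> > 0\<close> power_mono[of \<eta> "\<bar>z\<bar>" 2] by (cases "\<bar>z\<bar> > \<eta>") auto
  have "(\<Sum>x\<in>seqs n. (\<Prod>i<n. p i (x ! i)) * of_bool (\<bar>(\<Sum>i<n. h i (x ! i)) / n\<bar> > \<eta>))
      \<le> (\<Sum>x\<in>seqs n. (\<Prod>i<n. p i (x ! i)) * (((\<Sum>i<n. h i (x ! i)) / n)\<^sup>2 / \<eta>\<^sup>2))"
    by (intro sum_mono mult_left_mono prod_nonneg markov) (use p in auto)
  also have "\<dots> = (\<Sum>x\<in>seqs n. (\<Prod>i<n. p i (x ! i)) * (\<Sum>i<n. h i (x ! i))\<^sup>2) / (n\<^sup>2 * \<eta>\<^sup>2)"
    unfolding power_divide by (simp flip: sum_divide_distrib)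
  also have "\<dots> = (\<Sum>i<n. \<Sum>a\<in>UNIV. p i a * (h i a)\<^sup>2) / (n\<^sup>2 * \<eta>\<^sup>2)"
    by (subst second_moment_seqs(2)[OF p(2) h(1)]) simp
  also have "\<dots> \<le> (\<Sum>i<n. \<Sum>a\<in>UNIV. p i a * 1) / (n\<^sup>2 * \<eta>\<^sup>2)"
    using h(2) p by (intro divide_right_mono sum_mono mult_left_mono) (auto simp: abs_square_le_1)
  also have "\<dots> = 1 / (n * \<eta>\<^sup>2)"
    using \<open>n > 0\<close> p(2) by (simp add: power2_eq_square)
  finally show ?thesis .
qed

text \<open>Coordinate \<open>i\<close> occurs only once, so its own sum factors out and is zero.
  The indices \<open>j\<close>, \<open>k\<close>, \<open>l\<close> may coincide, which covers
  correlations of two codewords as well as those of two pairs.\<close>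

lemma sum_seqs_coord_zero:
  fixes f1 f2 f3 f4 :: "'a::finite \<Rightarrow> real"
  assumes "(\<Sum>a\<in>UNIV. f1 a) = 0" "i < N" "j < N" "k < N" "l < N" "i \<noteq> j" "i \<noteq> k" "i \<noteq> l"
  shows "(\<Sum>t\<in>seqs N. f1 (t ! i) * f2 (t ! j) * f3 (t ! k) * f4 (t ! l)) = 0"
proof -
  \<comment> \<open>The four evaluations become one product over all coordinates, with factors 1
    elsewhere, so that \<open>sum_seqs_prod\<close> applies even when indices coincide.\<close>
  define F where "F = (\<lambda>u a. (if u = i then f1 a else 1) * (if u = j then f2 a else 1) *
    (if u = k then f3 a else 1) * (if u = l then f4 a else 1))"
  have "(\<Prod>u<N. F u (t ! u)) = f1 (t ! i) * f2 (t ! j) * f3 (t ! k) * f4 (t ! l)" for t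
    unfolding F_def prod.distrib using assms by simp
  then have "(\<Sum>t\<in>seqs N. f1 (t ! i) * f2 (t ! j) * f3 (t ! k) * f4 (t ! l))
      = (\<Prod>u<N. \<Sum>a\<in>UNIV. F u a)"
    using sum_seqs_prod[of F N] by simp
  also have "\<dots> = 0"
    using assms by (intro prod_zero) (auto simp: F_def intro!: bexI[of _ i])
  finally show ?thesis .
qed

section \<open>The coordinate code\<close>

text \<open>A uniformly chosen time \<open>r\<close> picks a uniform word \<open>ts ! r\<close>, so
  time averages are expectations over independent uniform letters. The exact identities below all
  come from this; the enumeration \<open>ts\<close> only fixes the order of time.\<close>

locale coordinate_code =
  fixes N :: nat and ts :: "'x::finite list list" and q :: real
  assumes ts: "distinct ts" "set ts = seqs N"
  defines "q \<equiv> real CARD('x)"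
begin

abbreviation "m \<equiv> length ts"
abbreviation x :: "nat \<Rightarrow> nat \<Rightarrow> 'x" where "x i r \<equiv> ts ! r ! i"

definition dev :: "'x \<Rightarrow> 'x \<Rightarrow> real" where
  "dev a u = of_bool (u = a) - 1 / q"

lemma m_eq: "m = CARD('x) ^ N"
  using ts by (metis distinct_card card_seqs)

lemma m_pos: "0 < m"
  by (simp add: m_eq)

lemma q_ge_1: "1 \<le> q"
  by (simp add: q_def Suc_le_eq)

lemma sum_time: "(\<Sum>r<m. F (ts ! r)) = (\<Sum>t\<in>seqs N. F t)" for F :: "'x list \<Rightarrow> real"
  using sum.reindex_bij_betw[OF bij_betw_nth[OF ts(1) refl ts(2)[symmetric]], of F]
  by simp

lemma sum_dev: "(\<Sum>u\<in>UNIV. dev a u) = 0"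
  by (simp add: dev_def q_def sum_subtractf of_bool_def)

lemma abs_dev_le_1: "\<bar>dev a u\<bar> \<le> 1"
  using q_ge_1 by (auto simp: dev_def of_bool_def divide_simps)

lemma dev_orth:
  assumes "i < N" "k < N" "i \<noteq> k"
  shows "(\<Sum>r<m. dev a (x i r) * dev b (x k r)) = 0"
  using sum_seqs_coord_zero[OF sum_dev, of i N k k k a "dev b" "\<lambda>_. 1" "\<lambda>_. 1"] assms
  by (simp add: sum_time[of "\<lambda>t. dev a (t ! i) * dev b (t ! k)"])

text \<open>The last hypothesis says that some index occurs exactly once among the four, and its
  centred factor averages to zero. Transposed pairs \<open>(i, j)\<close> and \<open>(j, i)\<close>
  violate it.\<close>

lemma dev2_orth:
  assumes "i < N" "j < N" "k < N" "l < N" "i \<noteq> j" "k \<noteq> l" "(i \<noteq> k \<and> i \<noteq> l) \<or> (j \<noteq> k \<and> j \<noteq> l)"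
  shows "(\<Sum>r<m. (dev a (x i r) * dev b (x j r)) * (dev a (x k r) * dev b (x l r))) = 0"
proof -
  have "(\<Sum>t\<in>seqs N. (dev a (t ! i) * dev b (t ! j)) * (dev a (t ! k) * dev b (t ! l))) = 0"
    using assms(7)
  proof
    assume "i \<noteq> k \<and> i \<noteq> l"
    then show ?thesis
      using sum_seqs_coord_zero[OF sum_dev, of i N j k l a "dev b" "dev a" "dev b"] assms
      by (simp add: mult_ac)
  next
    assume "j \<noteq> k \<and> j \<noteq> l"
    then show ?thesis
      using sum_seqs_coord_zero[OF sum_dev, of j N i k l b "dev a" "dev a" "dev b"] assms
      by (simp add: mult_ac)
  qed
  then show ?thesis
    using sum_time[of "\<lambda>t. (dev a (t ! i) * dev b (t ! j)) * (dev a (t ! k) * dev b (t ! l))"] by simp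
qed

text \<open>Codewords are exactly uniform. This makes the conditional state frequencies in
  \<open>accept_freq\<close> a channel without any normalization error.\<close>

lemma sum_indicator:
  assumes "j < N"
  shows "(\<Sum>r<m. of_bool (x j r = b)) = m / q"
proof -
  have "(\<Sum>r<m. dev b (x j r)) = 0"
  proof -
    have "(\<Sum>t\<in>seqs N. \<Prod>u<N. (if u = j then dev b (t ! u) else 1)) = 0"
      using assms sum_dev[of b]
      by (subst sum_seqs_prod[of "\<lambda>u a. if u = j then dev b a else 1"])
         (auto intro!: prod_zero bexI[of _ j])
    then show ?thesis
      using assms by (simp add: sum_time[of "\<lambda>t. dev b (t ! j)"])
  qed
  then show ?thesis
    by (simp add: dev_def sum_subtractf)
qed

section \<open>Correlation of a state sequence with the codewords\<close>

definition corr1 :: "nat \<Rightarrow> 'x \<Rightarrow> 's \<Rightarrow> 's list \<Rightarrow> real" where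
  "corr1 i a \<sigma> s = (\<Sum>r<m. dev a (x i r) * of_bool (s ! r = \<sigma>)) / m"

definition corr2 :: "nat \<Rightarrow> nat \<Rightarrow> 'x \<Rightarrow> 'x \<Rightarrow> 's \<Rightarrow> 's list \<Rightarrow> real" where
  "corr2 i j a b \<sigma> s = (\<Sum>r<m. (dev a (x i r) * dev b (x j r)) * of_bool (s ! r = \<sigma>)) / m"

text \<open>Pairs are included because the decoder compares \<open>i\<close> with each rival
  \<open>j\<close>, and only \<open>corr2\<close> controls how letter \<open>i\<close> depends on
  letter \<open>j\<close> and the state jointly. Squares are taken because Bessel bounds their sum
  over all \<open>i\<close>.\<close>

definition energy :: "nat \<Rightarrow> 's::finite list \<Rightarrow> real" where
  "energy i s = (\<Sum>a\<in>UNIV. \<Sum>\<sigma>\<in>UNIV. (corr1 i a \<sigma> s)\<^sup>2) +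
     (\<Sum>j\<in>{..<N} - {i}. \<Sum>a\<in>UNIV. \<Sum>b\<in>UNIV. \<Sum>\<sigma>\<in>UNIV. (corr2 i j a b \<sigma> s)\<^sup>2)"

lemma sum_sq_le_m:
  fixes f :: "nat \<Rightarrow> real"
  assumes "\<And>r. \<bar>f r\<bar> \<le> 1"
  shows "(\<Sum>r<m. (f r)\<^sup>2) \<le> m"
  using sum_bounded_above[of "{..<m}" "\<lambda>r. (f r)\<^sup>2" 1] assms by (simp add: abs_square_le_1)

lemma sum_corr1_le: "(\<Sum>i<N. (corr1 i a \<sigma> s)\<^sup>2) \<le> 1"
proof -
  have "(\<Sum>i<N. (\<Sum>r<m. dev a (x i r) * of_bool (s ! r = \<sigma>))\<^sup>2) \<le> (real m)\<^sup>2"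
    using m_pos by (intro bessel_sum sum_sq_le_m abs_dev_le_1 dev_orth) auto
  then show ?thesis
    using m_pos by (simp add: corr1_def power_divide flip: sum_divide_distrib)
qed

text \<open>Bessel for products of two centred indicators. Transposed pairs are not orthogonal in
  general, so each orientation is treated as a system of its own.\<close>

lemma sum_corr2_le:
  assumes "I = {(i, j). i < j \<and> j < N} \<or> I = {(i, j). j < i \<and> i < N}"
  shows "(\<Sum>(i, j)\<in>I. (corr2 i j a b \<sigma> s)\<^sup>2) \<le> 1"
proof -
  have I: "I \<subseteq> {..<N} \<times> {..<N}" using assms by auto
  then have "finite I" by (rule finite_subset) simp
  have "(\<Sum>p\<in>I. (\<Sum>r<m. (dev a (x (fst p) r) * dev b (x (snd p) r)) * of_bool (s ! r = \<sigma>))\<^sup>2) \<le> (real m)\<^sup>2"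
  proof (intro bessel_sum sum_sq_le_m)
    fix p p' assume "p \<in> I" "p' \<in> I" "p \<noteq> p'"
    with assms show "(\<Sum>r<m. (dev a (x (fst p) r) * dev b (x (snd p) r)) *
        (dev a (x (fst p') r) * dev b (x (snd p') r))) = 0"
      by (intro dev2_orth) auto
  next
    fix p r
    show "\<bar>dev a (x (fst p) r) * dev b (x (snd p) r)\<bar> \<le> 1"
      using abs_dev_le_1 by (simp add: abs_mult mult_le_one)
  qed (use m_pos \<open>finite I\<close> in auto)
  then show ?thesis
    using m_pos by (simp add: corr2_def power_divide case_prod_beta flip: sum_divide_distrib)
qed

text \<open>The bound is free of \<open>N\<close>: each \<open>(a, \<sigma>)\<close> contributes at
  most 1 through \<open>corr1\<close>, each \<open>(a, b, \<sigma>)\<close> at most 1 per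
  orientation through \<open>corr2\<close>. Hence only boundedly many codewords exceed a fixed
  energy, whatever the state sequence.\<close>

lemma sum_energy_le:
  "(\<Sum>i<N. energy i (s :: 's::finite list)) \<le> q * CARD('s) + 2 * q\<^sup>2 * CARD('s)"
proof -
  let ?I = "{(i, j). i < j \<and> j < N}" and ?J = "{(i, j). j < i \<and> i < N}"
  have fin: "finite ?I" "finite ?J"
    by (rule finite_subset[of _ "{..<N} \<times> {..<N}"]; auto)+
  have split: "Sigma {..<N} (\<lambda>i. {..<N} - {i}) = ?I \<union> ?J"
    by auto
  have 1: "(\<Sum>i<N. \<Sum>a\<in>UNIV. \<Sum>\<sigma>\<in>UNIV. (corr1 i a \<sigma> s)\<^sup>2) \<le> q * CARD('s)"
  proof -
    have "(\<Sum>i<N. \<Sum>a\<in>UNIV. \<Sum>\<sigma>\<in>UNIV. (corr1 i a \<sigma> s)\<^sup>2)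
        = (\<Sum>a\<in>UNIV. \<Sum>\<sigma>\<in>UNIV. \<Sum>i<N. (corr1 i a \<sigma> s)\<^sup>2)"
      by (subst sum.swap) (intro sum.cong refl sum.swap)
    also have "\<dots> \<le> (\<Sum>a\<in>(UNIV::'x set). \<Sum>\<sigma>\<in>(UNIV::'s set). 1)"
      by (intro sum_mono sum_corr1_le)
    finally show ?thesis by (simp add: q_def)
  qed
  have pair: "(\<Sum>i<N. \<Sum>j\<in>{..<N} - {i}. (corr2 i j a b \<sigma> s)\<^sup>2) \<le> 2" for a b \<sigma>
  proof -
    have "(\<Sum>i<N. \<Sum>j\<in>{..<N} - {i}. (corr2 i j a b \<sigma> s)\<^sup>2)
        = (\<Sum>(i, j)\<in>?I \<union> ?J. (corr2 i j a b \<sigma> s)\<^sup>2)"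
      by (subst sum.Sigma) (simp_all add: split)
    also have "\<dots> = (\<Sum>(i, j)\<in>?I. (corr2 i j a b \<sigma> s)\<^sup>2) + (\<Sum>(i, j)\<in>?J. (corr2 i j a b \<sigma> s)\<^sup>2)"
      by (intro sum.union_disjoint fin) auto
    also have "\<dots> \<le> 1 + 1"
      by (intro add_mono sum_corr2_le) auto
    finally show ?thesis by simp
  qed
  have 2: "(\<Sum>i<N. \<Sum>j\<in>{..<N} - {i}. \<Sum>a\<in>UNIV. \<Sum>b\<in>UNIV. \<Sum>\<sigma>\<in>UNIV. (corr2 i j a b \<sigma> s)\<^sup>2)
      \<le> 2 * q\<^sup>2 * CARD('s)"
  proof -
    let ?S = "Sigma {..<N} (\<lambda>i. {..<N} - {i})"
    have "(\<Sum>i<N. \<Sum>j\<in>{..<N} - {i}. \<Sum>a\<in>UNIV. \<Sum>b\<in>UNIV. \<Sum>\<sigma>\<in>UNIV. (corr2 i j a b \<sigma> s)\<^sup>2)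
        = (\<Sum>p\<in>?S. \<Sum>a\<in>UNIV. \<Sum>b\<in>UNIV. \<Sum>\<sigma>\<in>UNIV. (corr2 (fst p) (snd p) a b \<sigma> s)\<^sup>2)"
      by (subst sum.Sigma) (simp_all add: case_prod_beta)
    also have "\<dots> = (\<Sum>a\<in>UNIV. \<Sum>p\<in>?S. \<Sum>b\<in>UNIV. \<Sum>\<sigma>\<in>UNIV. (corr2 (fst p) (snd p) a b \<sigma> s)\<^sup>2)"
      by (rule sum.swap)
    also have "\<dots> = (\<Sum>a\<in>UNIV. \<Sum>b\<in>UNIV. \<Sum>p\<in>?S. \<Sum>\<sigma>\<in>UNIV. (corr2 (fst p) (snd p) a b \<sigma> s)\<^sup>2)"
      by (intro sum.cong refl sum.swap)
    also have "\<dots> = (\<Sum>a\<in>UNIV. \<Sum>b\<in>UNIV. \<Sum>\<sigma>\<in>UNIV. \<Sum>p\<in>?S. (corr2 (fst p) (snd p) a b \<sigma> s)\<^sup>2)"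
      by (intro sum.cong refl sum.swap)
    also have "\<dots> = (\<Sum>a\<in>UNIV. \<Sum>b\<in>UNIV. \<Sum>\<sigma>\<in>UNIV. \<Sum>i<N. \<Sum>j\<in>{..<N} - {i}. (corr2 i j a b \<sigma> s)\<^sup>2)"
      by (subst (2) sum.Sigma) (simp_all add: case_prod_beta)
    also have "\<dots> \<le> (\<Sum>a\<in>(UNIV::'x set). \<Sum>b\<in>(UNIV::'x set). \<Sum>\<sigma>\<in>(UNIV::'s set). 2)"
      by (intro sum_mono pair)
    finally show ?thesis by (simp add: q_def power2_eq_square)
  qed
  show ?thesis
    unfolding energy_def sum.distrib using 1 2 by linarith
qed

lemma energy_nonneg: "0 \<le> energy i s"
  unfolding energy_def by (intro add_nonneg_nonneg sum_nonneg) auto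

lemma joint_freq_near_product:
  fixes s :: "'s::finite list" and \<eta> :: real
  assumes "energy i s \<le> \<eta>\<^sup>2 / 2" "\<eta> > 0" "j < N" "j \<noteq> i"
  shows "\<bar>(\<Sum>r<m. of_bool (x i r = a) * of_bool (x j r = b) * of_bool (s ! r = \<sigma>)) / m
      - (\<Sum>r<m. of_bool (x j r = b) * of_bool (s ! r = \<sigma>)) / m / q\<bar> \<le> \<eta>" (is "\<bar>?d\<bar> \<le> _")
proof -
  \<comment> \<open>The indicator of letter \<open>b\<close> is \<open>dev b\<close> plus
    \<open>1 / q\<close>, which splits the difference into a pair correlation and a single
    correlation.\<close>
  have d: "?d = corr2 i j a b \<sigma> s + corr1 i a \<sigma> s / q"
    unfolding corr1_def corr2_def dev_def
    by (simp add: algebra_simps sum.distrib sum_subtractf add_divide_distrib diff_divide_distrib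
        flip: sum_divide_distrib)
  have "(corr1 i a \<sigma> s)\<^sup>2 \<le> (\<Sum>a\<in>UNIV. \<Sum>\<sigma>\<in>UNIV. (corr1 i a \<sigma> s)\<^sup>2)"
  proof -
    have "(corr1 i a \<sigma> s)\<^sup>2 \<le> (\<Sum>\<sigma>\<in>UNIV. (corr1 i a \<sigma> s)\<^sup>2)"
      by (rule member_le_sum) auto
    also have "\<dots> \<le> (\<Sum>a\<in>UNIV. \<Sum>\<sigma>\<in>UNIV. (corr1 i a \<sigma> s)\<^sup>2)"
      by (rule member_le_sum[of a UNIV "\<lambda>a. \<Sum>\<sigma>\<in>UNIV. (corr1 i a \<sigma> s)\<^sup>2"]) (auto intro: sum_nonneg)
    finally show ?thesis .
  qed
  moreover have "(corr2 i j a b \<sigma> s)\<^sup>2 \<le> (\<Sum>j\<in>{..<N} - {i}. \<Sum>a\<in>UNIV. \<Sum>b\<in>UNIV. \<Sum>\<sigma>\<in>UNIV. (corr2 i j a b \<sigma> s)\<^sup>2)"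
  proof -
    have "(corr2 i j a b \<sigma> s)\<^sup>2 \<le> (\<Sum>\<sigma>\<in>UNIV. (corr2 i j a b \<sigma> s)\<^sup>2)"
      by (rule member_le_sum) auto
    also have "\<dots> \<le> (\<Sum>b\<in>UNIV. \<Sum>\<sigma>\<in>UNIV. (corr2 i j a b \<sigma> s)\<^sup>2)"
      by (rule member_le_sum[of b UNIV "\<lambda>b. \<Sum>\<sigma>\<in>UNIV. (corr2 i j a b \<sigma> s)\<^sup>2"]) (auto intro: sum_nonneg)
    also have "\<dots> \<le> (\<Sum>a\<in>UNIV. \<Sum>b\<in>UNIV. \<Sum>\<sigma>\<in>UNIV. (corr2 i j a b \<sigma> s)\<^sup>2)"
      by (rule member_le_sum[of a UNIV "\<lambda>a. \<Sum>b\<in>UNIV. \<Sum>\<sigma>\<in>UNIV. (corr2 i j a b \<sigma> s)\<^sup>2"]) (auto intro!: sum_nonneg)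
    also have "\<dots> \<le> (\<Sum>j\<in>{..<N} - {i}. \<Sum>a\<in>UNIV. \<Sum>b\<in>UNIV. \<Sum>\<sigma>\<in>UNIV. (corr2 i j a b \<sigma> s)\<^sup>2)"
      using assms by (intro member_le_sum[of j "{..<N} - {i}" "\<lambda>j. \<Sum>a\<in>UNIV. \<Sum>b\<in>UNIV. \<Sum>\<sigma>\<in>UNIV. (corr2 i j a b \<sigma> s)\<^sup>2"])
        (auto intro!: sum_nonneg)
    finally show ?thesis .
  qed
  ultimately have e: "(corr1 i a \<sigma> s)\<^sup>2 + (corr2 i j a b \<sigma> s)\<^sup>2 \<le> \<eta>\<^sup>2 / 2"
    using assms(1) unfolding energy_def by linarith
  \<comment> \<open>The factor 2 lost in squaring a sum of two terms is the reason for the threshold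
    \<open>\<eta>\<^sup>2 / 2\<close>.\<close>
  have "?d\<^sup>2 \<le> 2 * ((corr1 i a \<sigma> s)\<^sup>2 + (corr2 i j a b \<sigma> s)\<^sup>2)"
  proof -
    have "(u + v)\<^sup>2 \<le> 2 * (v\<^sup>2 + u\<^sup>2)" for u v :: real
      using zero_le_power2[of "u - v"] by (simp add: power2_eq_square algebra_simps)
    then have "?d\<^sup>2 \<le> 2 * ((corr1 i a \<sigma> s / q)\<^sup>2 + (corr2 i j a b \<sigma> s)\<^sup>2)"
      unfolding d .
    also have "\<dots> \<le> 2 * ((corr1 i a \<sigma> s)\<^sup>2 + (corr2 i j a b \<sigma> s)\<^sup>2)"
      using q_ge_1 by (simp add: power_divide divide_le_eq mult_le_cancel_left1)
    finally show ?thesis .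
  qed
  also have "\<dots> \<le> \<eta>\<^sup>2" using e by simp
  finally have "?d\<^sup>2 \<le> \<eta>\<^sup>2" .
  then show ?thesis
    using \<open>\<eta> > 0\<close> abs_le_square_iff[of ?d \<eta>] by simp
qed

section \<open>The decoder and its success probability\<close>

definition codeword :: "nat \<Rightarrow> 'x list" where
  "codeword i = map (\<lambda>t. t ! i) ts"

lemma codeword_seqs: "codeword i \<in> seqs m"
  by (simp add: codeword_def seqs_def)

text \<open>One summand of the discrepancy between the observed joint frequency of two codewords
  with the output and its prediction from \<open>s\<close>. It is centred when \<open>y\<close> has
  law \<open>W (s ! r) (x i r)\<close> and bounded by 1, as \<open>chebyshev_seqs\<close>
  requires.\<close>

definition stat :: "('s \<Rightarrow> 'x \<Rightarrow> 'y \<Rightarrow> real) \<Rightarrow> 's list \<Rightarrow> nat \<Rightarrow> nat \<Rightarrow> 'x \<Rightarrow> 'x \<Rightarrow> 'y \<Rightarrow> nat \<Rightarrow> 'y \<Rightarrow> real" where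
  "stat W s i j a b c r y = of_bool (x i r = a) * of_bool (x j r = b) * (of_bool (y = c) - W (s ! r) (x i r) c)"

text \<open>The decoder does not know the state sequence, hence the existential quantifier; in the
  error analysis the true sequence is the witness. The negated strict inequality is the complement
  of the event in \<open>chebyshev_seqs\<close>.\<close>

definition accept :: "('s::finite \<Rightarrow> 'x \<Rightarrow> 'y::finite \<Rightarrow> real) \<Rightarrow> real \<Rightarrow> nat \<Rightarrow> 'y list set" where
  "accept W \<eta> i = {y \<in> seqs m. \<exists>s\<in>seqs m. energy i s \<le> \<eta>\<^sup>2 / 2 \<and>
     (\<forall>j\<in>{..<N} - {i}. \<forall>a b c. \<not> \<bar>(\<Sum>r<m. stat W s i j a b c r (y ! r)) / m\<bar> > \<eta>)}"

text \<open>Acceptance of \<open>i\<close> means that the output looks as if the state were drawn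
  from the letter of the rival \<open>j\<close> through \<open>U\<close>, independently of the
  letter of \<open>i\<close>. The error is \<eta> from the acceptance test plus \<eta> per state
  from \<open>joint_freq_near_product\<close>.\<close>

lemma accept_freq:
  fixes W :: "'s::finite \<Rightarrow> 'x \<Rightarrow> 'y::finite \<Rightarrow> real" and \<eta> :: real
  assumes W: "\<forall>s. channel (W s)" and "\<eta> > 0" and y: "y \<in> accept W \<eta> i" and j: "j < N" "j \<noteq> i"
  obtains U where "channel U"
    "\<And>a b c. \<bar>(\<Sum>r<m. of_bool (x i r = a) * of_bool (x j r = b) * of_bool (y ! r = c)) / m
       - (\<Sum>\<sigma>\<in>UNIV. U b \<sigma> * W \<sigma> a c) / q\<^sup>2\<bar> \<le> (real CARD('s) + 1) * \<eta>"
proof -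
  obtain s where s: "energy i s \<le> \<eta>\<^sup>2 / 2"
      "\<And>a b c. \<bar>(\<Sum>r<m. stat W s i j a b c r (y ! r)) / m\<bar> \<le> \<eta>"
    using y j unfolding accept_def by (force simp: not_less)
  \<comment> \<open>Conditional frequency of the state given the letter of codeword
    \<open>j\<close>; the factor \<open>q\<close> inverts the exact letter frequency
    \<open>1 / q\<close>.\<close>
  define U where "U = (\<lambda>b \<sigma>. q * ((\<Sum>r<m. of_bool (x j r = b) * of_bool (s ! r = \<sigma>)) / m))"
  have "channel U"
    unfolding channel_def
  proof (intro conjI allI)
    show "0 \<le> U b \<sigma>" for b \<sigma>
      using q_ge_1 unfolding U_def by (intro mult_nonneg_nonneg divide_nonneg_nonneg sum_nonneg) auto
    show "(\<Sum>\<sigma>\<in>UNIV. U b \<sigma>) = 1" for b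
    proof -
      have "(\<Sum>\<sigma>\<in>UNIV. \<Sum>r<m. of_bool (x j r = b) * of_bool (s ! r = \<sigma>)) = (\<Sum>r<m. of_bool (x j r = b) :: real)"
        by (subst sum.swap) (simp flip: sum_distrib_left add: of_bool_def)
      also have "\<dots> = m / q" by (rule sum_indicator[OF j(1)])
      finally show ?thesis
        using q_ge_1 m_pos unfolding U_def by (simp flip: sum_distrib_left sum_divide_distrib)
    qed
  qed
  moreover have "\<bar>(\<Sum>r<m. of_bool (x i r = a) * of_bool (x j r = b) * of_bool (y ! r = c)) / m
       - (\<Sum>\<sigma>\<in>UNIV. U b \<sigma> * W \<sigma> a c) / q\<^sup>2\<bar> \<le> (real CARD('s) + 1) * \<eta>" for a b c
  proof -
    define P where "P = (\<lambda>\<sigma>. (\<Sum>r<m. of_bool (x i r = a) * of_bool (x j r = b) * of_bool (s ! r = \<sigma>)) / m)"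
    \<comment> \<open>Intermediate quantity: the frequency predicted by the explaining sequence
      itself, before the joint frequencies \<open>P\<close> are replaced by products.\<close>
    define T where "T = (\<Sum>r<m. of_bool (x i r = a) * of_bool (x j r = b) * W (s ! r) a c) / m"
    have "(\<Sum>r<m. stat W s i j a b c r (y ! r)) / m
        = (\<Sum>r<m. of_bool (x i r = a) * of_bool (x j r = b) * of_bool (y ! r = c)
             - of_bool (x i r = a) * of_bool (x j r = b) * W (s ! r) a c) / m"
      by (intro arg_cong2[of _ _ _ _ "(/)"] sum.cong refl) (auto simp: stat_def of_bool_def)
    then have 1: "\<bar>(\<Sum>r<m. of_bool (x i r = a) * of_bool (x j r = b) * of_bool (y ! r = c)) / m - T\<bar> \<le> \<eta>"
      using s(2)[of a b c] by (simp add: T_def sum_subtractf diff_divide_distrib)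
    have by_state: "(\<Sum>r<m. w r * W (s ! r) a c) = (\<Sum>\<sigma>\<in>UNIV. (\<Sum>r<m. w r * of_bool (s ! r = \<sigma>)) * W \<sigma> a c)"
      for w :: "nat \<Rightarrow> real"
    proof -
      have "(\<Sum>\<sigma>\<in>UNIV. (\<Sum>r<m. w r * of_bool (s ! r = \<sigma>)) * W \<sigma> a c)
          = (\<Sum>r<m. \<Sum>\<sigma>\<in>UNIV. if s ! r = \<sigma> then w r * W \<sigma> a c else 0)"
        unfolding sum_distrib_right by (subst sum.swap) (auto intro!: sum.cong)
      then show ?thesis by simp
    qed
    have "T = (\<Sum>\<sigma>\<in>UNIV. P \<sigma> * W \<sigma> a c)"
      unfolding T_def P_def by_state by (subst sum_divide_distrib) (simp only: times_divide_eq_left)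
    moreover have "(\<Sum>\<sigma>\<in>UNIV. U b \<sigma> * W \<sigma> a c) / q\<^sup>2 = (\<Sum>\<sigma>\<in>UNIV. U b \<sigma> / q / q * W \<sigma> a c)"
      by (simp add: sum_divide_distrib power2_eq_square)
    ultimately have "\<bar>T - (\<Sum>\<sigma>\<in>UNIV. U b \<sigma> * W \<sigma> a c) / q\<^sup>2\<bar> = \<bar>\<Sum>\<sigma>\<in>UNIV. (P \<sigma> - U b \<sigma> / q / q) * W \<sigma> a c\<bar>"
      by (simp add: sum_subtractf algebra_simps)
    also have "\<dots> \<le> (\<Sum>\<sigma>\<in>UNIV. \<bar>(P \<sigma> - U b \<sigma> / q / q) * W \<sigma> a c\<bar>)"
      by (rule sum_abs)
    also have "\<dots> \<le> (\<Sum>\<sigma>\<in>(UNIV :: 's set). \<eta> * 1)"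
    proof (intro sum_mono)
      fix \<sigma>
      have "\<bar>P \<sigma> - U b \<sigma> / q / q\<bar> \<le> \<eta>"
        using joint_freq_near_product[OF s(1) \<open>\<eta> > 0\<close> j, of a b \<sigma>] q_ge_1
        by (simp add: P_def U_def)
      then show "\<bar>(P \<sigma> - U b \<sigma> / q / q) * W \<sigma> a c\<bar> \<le> \<eta> * 1"
        unfolding abs_mult using W \<open>\<eta> > 0\<close>
        by (intro mult_mono) (auto simp: channel_nonneg channel_le_1)
    qed
    finally have "\<bar>T - (\<Sum>\<sigma>\<in>UNIV. U b \<sigma> * W \<sigma> a c) / q\<^sup>2\<bar> \<le> real CARD('s) * \<eta>" by simp
    with 1 show ?thesis by (simp add: algebra_simps)
  qed
  ultimately show thesis by (rule that)
qed

text \<open>A common output has one joint frequency but two predictions, one with \<open>U\<close>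
  driven by codeword \<open>j\<close>, one with \<open>U'\<close> driven by codeword
  \<open>i\<close>. They differ by at most twice the error in \<open>accept_freq\<close>;
  multiplying by \<open>q\<^sup>2\<close>, the inverse weight of a letter pair, contradicts the
  gap.\<close>

lemma accept_disjoint:
  fixes W :: "'s::finite \<Rightarrow> 'x \<Rightarrow> 'y::finite \<Rightarrow> real" and \<eta> :: real
  assumes W: "\<forall>s. channel (W s)" and "\<eta> > 0"
    and gap: "\<And>U U'. channel U \<Longrightarrow> channel U' \<Longrightarrow>
      \<exists>a b c. \<bar>(\<Sum>s\<in>UNIV. U b s * W s a c) - (\<Sum>s\<in>UNIV. U' a s * W s b c)\<bar> \<ge> \<zeta>"
    and \<eta>: "2 * q\<^sup>2 * ((real CARD('s) + 1) * \<eta>) < \<zeta>"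
    and ij: "i < N" "j < N" "i \<noteq> j"
  shows "accept W \<eta> i \<inter> accept W \<eta> j = {}"
proof (rule ccontr)
  assume "accept W \<eta> i \<inter> accept W \<eta> j \<noteq> {}"
  then obtain y where y: "y \<in> accept W \<eta> i" "y \<in> accept W \<eta> j" by blast
  let ?e = "\<lambda>a b c. (\<Sum>r<m. of_bool (x i r = a) * of_bool (x j r = b) * of_bool (y ! r = c)) / m"
  let ?k = "(real CARD('s) + 1) * \<eta>"
  obtain U where U: "channel U" "\<And>a b c. \<bar>?e a b c - (\<Sum>\<sigma>\<in>UNIV. U b \<sigma> * W \<sigma> a c) / q\<^sup>2\<bar> \<le> ?k"
    by (rule accept_freq[OF W \<open>\<eta> > 0\<close> y(1) ij(2) ij(3)[symmetric]]) blast
  obtain U' where U': "channel U'" "\<And>b a c. \<bar>(\<Sum>r<m. of_bool (x j r = b) * of_bool (x i r = a) * of_bool (y ! r = c)) / m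
      - (\<Sum>\<sigma>\<in>UNIV. U' a \<sigma> * W \<sigma> b c) / q\<^sup>2\<bar> \<le> ?k"
    by (rule accept_freq[OF W \<open>\<eta> > 0\<close> y(2) ij(1) ij(3)]) blast
  have U'2: "\<bar>?e a b c - (\<Sum>\<sigma>\<in>UNIV. U' a \<sigma> * W \<sigma> b c) / q\<^sup>2\<bar> \<le> ?k" for a b c
    using U'(2)[of b a c] by (simp add: mult.commute[of "of_bool (x j _ = b)"])
  obtain a b c where abc: "\<bar>(\<Sum>s\<in>UNIV. U b s * W s a c) - (\<Sum>s\<in>UNIV. U' a s * W s b c)\<bar> \<ge> \<zeta>"
    using gap[OF U(1) U'(1)] by blast
  let ?u = "\<Sum>s\<in>UNIV. U b s * W s a c" and ?v = "\<Sum>s\<in>UNIV. U' a s * W s b c"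
  have "\<bar>?u / q\<^sup>2 - ?v / q\<^sup>2\<bar> \<le> 2 * ?k"
    using U(2)[of a b c] U'2[of a b c] by (smt (verit))
  then have "\<bar>?u - ?v\<bar> / q\<^sup>2 \<le> 2 * ?k"
    by (simp add: diff_divide_distrib[symmetric])
  then have "\<bar>?u - ?v\<bar> \<le> 2 * q\<^sup>2 * ?k"
    using q_ge_1 by (simp add: divide_le_eq algebra_simps)
  with abc \<eta> show False by linarith
qed

text \<open>The true state sequence is an admissible explanation, so rejection requires one of at
  most \<open>N * q\<^sup>2 * CARD('y)\<close> empirical averages to deviate. This is Chebyshev with
  a union bound.\<close>

lemma accept_prob:
  fixes W :: "'s::finite \<Rightarrow> 'x \<Rightarrow> 'y::finite \<Rightarrow> real" and \<eta> :: real
  assumes W: "\<forall>s. channel (W s)" and "\<eta> > 0" and s: "s \<in> seqs m" "energy i s \<le> \<eta>\<^sup>2 / 2"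
  shows "(\<Sum>y\<in>accept W \<eta> i. prodch W s (codeword i) y) \<ge> 1 - N * q\<^sup>2 * CARD('y) / (m * \<eta>\<^sup>2)"
proof -
  have len: "length s = m" using s(1) by (simp add: seqs_def)
  define bad where "bad = (\<lambda>j a b c y. of_bool (\<bar>(\<Sum>r<m. stat W s i j a b c r (y ! r)) / m\<bar> > \<eta>) :: real)"
  have bad: "(\<Sum>y\<in>seqs m. prodch W s (codeword i) y * bad j a b c y) \<le> 1 / (m * \<eta>\<^sup>2)" for j a b c
  proof -
    \<comment> \<open>The hypotheses of \<open>chebyshev_seqs\<close> range over all indices,
      including \<open>r \<ge> m\<close>; the second branch makes \<open>px\<close> hold there
      too.\<close>
    define p where "p = (\<lambda>r. W (s ! r) (if r < m then codeword i ! r else x i r))"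
    have px: "p r = W (s ! r) (x i r)" for r
      by (simp add: p_def codeword_def)
    have "prodch W s (codeword i) y = (\<Prod>r<m. p r (y ! r))" for y
      unfolding prodch_def len by (intro prod.cong) (auto simp: p_def)
    moreover have "(\<Sum>y\<in>seqs m. (\<Prod>r<m. p r (y ! r)) *
        of_bool (\<bar>(\<Sum>r<m. stat W s i j a b c r (y ! r)) / m\<bar> > \<eta>)) \<le> 1 / (m * \<eta>\<^sup>2)"
    proof (rule chebyshev_seqs)
      show "(\<Sum>y\<in>UNIV. p r y) = 1" for r
        using W by (simp add: px channel_sum)
      then show "(\<Sum>y\<in>UNIV. p r y * stat W s i j a b c r y) = 0" for r
      proof -
        have "(\<Sum>y\<in>UNIV. p r y * stat W s i j a b c r y) = of_bool (x i r = a) * of_bool (x j r = b) *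
            ((\<Sum>y\<in>UNIV. p r y * of_bool (y = c)) - (\<Sum>y\<in>UNIV. p r y) * W (s ! r) (x i r) c)"
          unfolding stat_def sum_distrib_left sum_distrib_right sum_subtractf[symmetric]
          by (intro sum.cong) (auto simp: algebra_simps)
        also have "\<dots> = 0"
          using \<open>(\<Sum>y\<in>UNIV. p r y) = 1\<close> by (simp add: px of_bool_def if_distrib[of "\<lambda>u. _ * u"] cong: if_cong)
        finally show ?thesis .
      qed
      show "\<bar>stat W s i j a b c r y\<bar> \<le> 1" for r y
        using W channel_nonneg[of "W (s ! r)" "x i r" c] channel_le_1[of "W (s ! r)" "x i r" c]
        by (auto simp: stat_def of_bool_def abs_le_iff)
    qed (use W m_pos \<open>\<eta> > 0\<close> in \<open>auto simp: p_def channel_nonneg\<close>)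
    ultimately show ?thesis by (simp add: bad_def)
  qed
  have "1 = (\<Sum>y\<in>seqs m. prodch W s (codeword i) y)"
    by (rule sum_prodch[OF W len, symmetric])
  also have "\<dots> \<le> (\<Sum>y\<in>seqs m. prodch W s (codeword i) y *
      (of_bool (y \<in> accept W \<eta> i) + (\<Sum>j<N. \<Sum>a\<in>UNIV. \<Sum>b\<in>UNIV. \<Sum>c\<in>UNIV. bad j a b c y)))"
  proof (intro sum_mono)
    fix y :: "'y list" assume y: "y \<in> seqs m"
    have bad0: "0 \<le> bad j a b c y" for j a b c by (simp add: bad_def)
    have "1 \<le> of_bool (y \<in> accept W \<eta> i) + (\<Sum>j<N. \<Sum>a\<in>UNIV. \<Sum>b\<in>UNIV. \<Sum>c\<in>UNIV. bad j a b c y)"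
    proof (cases "y \<in> accept W \<eta> i")
      case True then show ?thesis by (simp add: sum_nonneg bad0)
    next
      case False
      then have "\<not> (\<forall>j\<in>{..<N} - {i}. \<forall>a b c. \<not> \<bar>(\<Sum>r<m. stat W s i j a b c r (y ! r)) / m\<bar> > \<eta>)"
        using y s unfolding accept_def by blast
      then obtain j a b c where "j < N" "\<bar>(\<Sum>r<m. stat W s i j a b c r (y ! r)) / m\<bar> > \<eta>"
        by blast
      then have j: "j < N" "bad j a b c y = 1"
        unfolding bad_def by simp_all
      have "bad j a b c y \<le> (\<Sum>c\<in>UNIV. bad j a b c y)"
        by (rule member_le_sum) (auto simp: bad0)
      also have "\<dots> \<le> (\<Sum>b\<in>UNIV. \<Sum>c\<in>UNIV. bad j a b c y)"
        by (rule member_le_sum[of b UNIV "\<lambda>b. \<Sum>c\<in>UNIV. bad j a b c y"]) (auto intro!: sum_nonneg bad0)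
      also have "\<dots> \<le> (\<Sum>a\<in>UNIV. \<Sum>b\<in>UNIV. \<Sum>c\<in>UNIV. bad j a b c y)"
        by (rule member_le_sum[of a UNIV "\<lambda>a. \<Sum>b\<in>UNIV. \<Sum>c\<in>UNIV. bad j a b c y"]) (auto intro!: sum_nonneg bad0)
      also have "\<dots> \<le> (\<Sum>j<N. \<Sum>a\<in>UNIV. \<Sum>b\<in>UNIV. \<Sum>c\<in>UNIV. bad j a b c y)"
        using j by (intro member_le_sum[of j "{..<N}" "\<lambda>j. \<Sum>a\<in>UNIV. \<Sum>b\<in>UNIV. \<Sum>c\<in>UNIV. bad j a b c y"])
          (auto intro!: sum_nonneg bad0)
      finally show ?thesis using j False by simp
    qed
    then show "prodch W s (codeword i) y \<le> prodch W s (codeword i) y *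
      (of_bool (y \<in> accept W \<eta> i) + (\<Sum>j<N. \<Sum>a\<in>UNIV. \<Sum>b\<in>UNIV. \<Sum>c\<in>UNIV. bad j a b c y))"
      using mult_left_mono[of 1 _ "prodch W s (codeword i) y"] prodch_nonneg[OF W] by simp
  qed
  also have "\<dots> = (\<Sum>y\<in>seqs m. prodch W s (codeword i) y * of_bool (y \<in> accept W \<eta> i)) +
      (\<Sum>j<N. \<Sum>a\<in>UNIV. \<Sum>b\<in>UNIV. \<Sum>c\<in>UNIV. \<Sum>y\<in>seqs m. prodch W s (codeword i) y * bad j a b c y)"
    unfolding distrib_left sum.distrib sum_distrib_left
    by (simp only: sum.swap[where A = "seqs m"])
  also have "\<dots> \<le> (\<Sum>y\<in>seqs m. prodch W s (codeword i) y * of_bool (y \<in> accept W \<eta> i)) +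
      (\<Sum>j<N. \<Sum>a\<in>(UNIV::'x set). \<Sum>b\<in>(UNIV::'x set). \<Sum>c\<in>(UNIV::'y set). 1 / (m * \<eta>\<^sup>2))"
    by (intro add_left_mono sum_mono bad)
  also have "\<dots> = (\<Sum>y\<in>accept W \<eta> i. prodch W s (codeword i) y) + N * q\<^sup>2 * CARD('y) / (m * \<eta>\<^sup>2)"
  proof -
    have "accept W \<eta> i \<subseteq> seqs m" by (auto simp: accept_def)
    then have "(\<Sum>y\<in>seqs m. prodch W s (codeword i) y * of_bool (y \<in> accept W \<eta> i))
      = (\<Sum>y\<in>accept W \<eta> i. prodch W s (codeword i) y)"
      by (intro sum.mono_neutral_cong_right) auto
    then show ?thesis by (simp add: q_def power2_eq_square)
  qed
  finally show ?thesis by linarith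
qed

end

text \<open>Success is averaged over the messages because, for a given state sequence, the few
  codewords of high energy may fail completely. A total decoder with values below \<open>L\<close>
  forces \<open>L > 0\<close>.\<close>

definition det_code :: "('s \<Rightarrow> 'x \<Rightarrow> 'y \<Rightarrow> real) \<Rightarrow> nat \<Rightarrow> nat \<Rightarrow> (nat \<Rightarrow> 'x list) \<Rightarrow> ('y list \<Rightarrow> nat) \<Rightarrow> real \<Rightarrow> bool" where
  "det_code W l L c dec \<epsilon> \<longleftrightarrow> (\<forall>i<L. c i \<in> seqs l) \<and> (\<forall>y. dec y < L) \<and>
     (\<forall>s\<in>seqs l. L * (1 - \<epsilon>) \<le> (\<Sum>i<L. \<Sum>y\<in>{y \<in> seqs l. dec y = i}. prodch W s (c i) y))"

lemma square_le_exponential: "n ^ 2 \<le> 4 * 2 ^ n" for n :: nat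
proof (induction n)
  case (Suc n)
  show ?case
  proof (cases "n \<le> 2")
    case True
    then have "n = 0 \<or> n = 1 \<or> n = 2" by linarith
    then show ?thesis by (auto simp: power2_eq_square)
  next
    case False
    then have "3 * n \<le> n * n" by (intro mult_le_mono1) simp
    then have "(Suc n) ^ 2 \<le> 2 * n ^ 2"
      unfolding power2_eq_square mult_Suc mult_Suc_right using False by linarith
    with Suc show ?thesis by simp
  qed
qed simp

text \<open>With a single input letter every channel symmetrizes. The bound makes the block length
  \<open>q ^ N\<close> exponential in \<open>N\<close> and admits logarithms to base
  \<open>q\<close>.\<close>

lemma card_input_ge_2:
  fixes W :: "'s::finite \<Rightarrow> 'x::finite \<Rightarrow> 'y::finite \<Rightarrow> real"
  assumes nonsym: "\<not> symmetrizable W"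
  shows "2 \<le> CARD('x)"
proof -
  have "CARD('x) \<noteq> 1"
  proof
    assume "CARD('x) = 1"
    then obtain z where z: "(UNIV :: 'x set) = {z}"
      using card_1_singletonE by blast
    have *: "a = b" for a b :: 'x
      using UNIV_I[of a] UNIV_I[of b] unfolding z by simp
    have "symmetrizable W"
      unfolding symmetrizable_def
    proof (intro exI[of _ "\<lambda>_ _. 1 / real CARD('s)"] conjI allI)
      show "(\<Sum>s\<in>UNIV. 1 / real CARD('s) * W s x' y) = (\<Sum>s\<in>UNIV. 1 / real CARD('s) * W s x y)" for x x' y
        using *[of x x'] by simp
    qed (simp add: channel_def)
    with nonsym show False by contradiction
  qed
  then show ?thesis
    using zero_less_card_finite[where 'a = 'x] by linarith
qed

lemma ex_det_code:
  fixes W :: "'s::finite \<Rightarrow> 'x::finite \<Rightarrow> 'y::finite \<Rightarrow> real"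
  assumes W: "\<forall>s. channel (W s)" and nonsym: "\<not> symmetrizable W"
  obtains C where "C \<ge> 0" "\<And>N. N \<ge> 1 \<Longrightarrow> \<exists>c dec. det_code W (CARD('x) ^ N) N c dec (C / N)"
proof -
  obtain \<zeta> where \<zeta>: "\<zeta> > 0" "\<And>U U'. channel U \<Longrightarrow> channel U' \<Longrightarrow>
      \<exists>a b c. \<bar>(\<Sum>s\<in>UNIV. U b s * W s a c) - (\<Sum>s\<in>UNIV. U' a s * W s b c)\<bar> \<ge> \<zeta>"
    using not_symmetrizable_gap[OF nonsym] by blast
  define q where "q = real CARD('x)"
  have q2: "2 \<le> CARD('x)" by (rule card_input_ge_2[OF nonsym])
  then have "q \<ge> 2" by (simp add: q_def)
  \<comment> \<open>Half of what disjointness allows: the left side of the condition in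
    \<open>accept_disjoint\<close> becomes \<open>\<zeta> / 2\<close>.\<close>
  define \<eta> where "\<eta> = \<zeta> / (4 * q\<^sup>2 * (real CARD('s) + 1))"
  have "\<eta> > 0" using \<zeta>(1) \<open>q \<ge> 2\<close> by (simp add: \<eta>_def)
  have "2 * q\<^sup>2 * ((real CARD('s) + 1) * \<eta>) = \<zeta> / 2"
  proof -
    have "q\<^sup>2 \<noteq> 0" "real CARD('s) + 1 \<noteq> 0"
      using \<open>q \<ge> 2\<close> by auto
    then show ?thesis by (simp add: \<eta>_def)
  qed
  then have \<eta>: "2 * q\<^sup>2 * ((real CARD('s) + 1) * \<eta>) < \<zeta>"
    using \<zeta>(1) by simp
  define E where "E = q * CARD('s) + 2 * q\<^sup>2 * CARD('s)"
  \<comment> \<open>The first summand bounds \<open>N * \<kappa>\<close>, the deviations of the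
    empirical averages; the second is the total energy divided by the threshold
    \<open>\<eta>\<^sup>2 / 2\<close>.\<close>
  define C where "C = 4 * q\<^sup>2 * CARD('y) / \<eta>\<^sup>2 + 2 * E / \<eta>\<^sup>2"
  show thesis
  proof (rule that[of C])
    show "C \<ge> 0" using \<open>q \<ge> 2\<close> by (simp add: C_def E_def)
    fix N :: nat assume "N \<ge> 1"
    obtain ts :: "'x list list" where ts: "set ts = seqs N" "distinct ts"
      using finite_distinct_list[OF finite_seqs] by blast
    interpret coordinate_code N ts q
      unfolding q_def by unfold_locales (use ts in auto)
    let ?A = "accept W \<eta>"
    have disj: "?A i \<inter> ?A j = {}" if "i < N" "j < N" "i \<noteq> j" for i j
      by (rule accept_disjoint[OF W \<open>\<eta> > 0\<close> \<zeta>(2) _ that]) (use \<eta> in \<open>auto simp: q_def\<close>)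
    define dec where "dec = (\<lambda>y. if \<exists>i<N. y \<in> ?A i then THE i. i < N \<and> y \<in> ?A i else 0)"
    have dec: "dec y = i" if "i < N" "y \<in> ?A i" for i y
      using that disj unfolding dec_def by (auto intro!: the_equality)
    have dec_less: "dec y < N" for y
    proof (cases "\<exists>i<N. y \<in> ?A i")
      case True then show ?thesis using dec by auto
    next
      case False then show ?thesis
        unfolding dec_def if_not_P[OF False] using \<open>N \<ge> 1\<close> by simp
    qed
    define \<kappa> where "\<kappa> = N * q\<^sup>2 * CARD('y) / (m * \<eta>\<^sup>2)"
    have "\<kappa> \<ge> 0" by (simp add: \<kappa>_def)
    have succ: "N * (1 - C / N) \<le> (\<Sum>i<N. \<Sum>y\<in>{y \<in> seqs m. dec y = i}. prodch W s (codeword i) y)"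
      if s: "s \<in> seqs m" for s
    proof -
      have len: "length s = m" using s by (simp add: seqs_def)
      \<comment> \<open>Below the threshold \<open>accept_prob\<close> applies; above it the left
        side is nonpositive. A bound linear in the energy can then be summed with
        \<open>sum_energy_le\<close>.\<close>
      have "(\<Sum>i<N. 1 - \<kappa> - 2 / \<eta>\<^sup>2 * energy i s)
          \<le> (\<Sum>i<N. \<Sum>y\<in>{y \<in> seqs m. dec y = i}. prodch W s (codeword i) y)"
      proof (intro sum_mono)
        fix i assume "i \<in> {..<N}"
        then have i: "i < N" by simp
        have le: "(\<Sum>y\<in>?A i. prodch W s (codeword i) y)
            \<le> (\<Sum>y\<in>{y \<in> seqs m. dec y = i}. prodch W s (codeword i) y)"
          using dec[OF i] by (intro sum_mono2 prodch_nonneg W) (auto simp: accept_def)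
        show "1 - \<kappa> - 2 / \<eta>\<^sup>2 * energy i s \<le> (\<Sum>y\<in>{y \<in> seqs m. dec y = i}. prodch W s (codeword i) y)"
        proof (cases "energy i s \<le> \<eta>\<^sup>2 / 2")
          case True
          have "0 \<le> 2 / \<eta>\<^sup>2 * energy i s" by (simp add: energy_nonneg)
          with accept_prob[OF W \<open>\<eta> > 0\<close> s True] le show ?thesis
            unfolding \<kappa>_def by linarith
        next
          case False
          then have "2 / \<eta>\<^sup>2 * energy i s \<ge> 1"
            using \<open>\<eta> > 0\<close> by (simp add: field_simps)
          moreover have "0 \<le> (\<Sum>y\<in>{y \<in> seqs m. dec y = i}. prodch W s (codeword i) y)"
            by (intro sum_nonneg prodch_nonneg W)
          ultimately show ?thesis using \<open>\<kappa> \<ge> 0\<close> by linarith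
        qed
      qed
      moreover have "(\<Sum>i<N. 1 - \<kappa> - 2 / \<eta>\<^sup>2 * energy i s) = N * (1 - \<kappa>) - 2 / \<eta>\<^sup>2 * (\<Sum>i<N. energy i s)"
        by (simp add: sum_subtractf sum_distrib_left)
      moreover have "2 / \<eta>\<^sup>2 * (\<Sum>i<N. energy i s) \<le> 2 / \<eta>\<^sup>2 * E"
        using sum_energy_le[of s] unfolding E_def q_def by (intro mult_left_mono) auto
      \<comment> \<open>\<open>m\<close> is at least \<open>2 ^ N\<close>, so even after summation
        over \<open>N\<close> messages with \<open>N\<close> rivals each the deviations cost only a
        constant.\<close>
      moreover have "N * \<kappa> \<le> 4 * q\<^sup>2 * CARD('y) / \<eta>\<^sup>2"
      proof -
        have "real N ^ 2 \<le> 4 * 2 ^ N"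
          using of_nat_mono[OF square_le_exponential[of N], where 'a = real] by simp
        also have "\<dots> \<le> 4 * real m"
          unfolding m_eq using q2 by (simp add: power_mono)
        finally have *: "real N ^ 2 / m \<le> 4"
          using m_pos by (simp add: divide_le_eq)
        have "N * \<kappa> = (real N ^ 2 / m) * (q\<^sup>2 * CARD('y) / \<eta>\<^sup>2)"
          by (simp add: \<kappa>_def power2_eq_square)
        also have "\<dots> \<le> 4 * (q\<^sup>2 * CARD('y) / \<eta>\<^sup>2)"
          using * by (intro mult_right_mono) auto
        finally show ?thesis by simp
      qed
      moreover have "N * (1 - C / N) = N - C"
        using \<open>N \<ge> 1\<close> by (simp add: field_simps)
      moreover have "N * (1 - \<kappa>) = N - N * \<kappa>"
        by (simp add: algebra_simps)
      moreover have "C = 4 * q\<^sup>2 * CARD('y) / \<eta>\<^sup>2 + 2 / \<eta>\<^sup>2 * E"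
        by (simp add: C_def)
      ultimately show ?thesis by linarith
    qed
    have "det_code W m N codeword dec (C / N)"
      unfolding det_code_def using codeword_seqs dec_less succ by blast
    then show "\<exists>c dec. det_code W (CARD('x) ^ N) N c dec (C / N)"
      unfolding m_eq by blast
  qed
qed

section \<open>Concatenation and sampling\<close>

lemma sum_lessThan_mult:
  fixes F :: "nat \<Rightarrow> nat \<Rightarrow> 'a::comm_monoid_add"
  shows "(\<Sum>i<a * b. F (i div b) (i mod b)) = (\<Sum>i<a. \<Sum>j<b. F i j)"
proof (cases "b = 0")
  case False
  have less: "i * b + j < a * b" if "i < a" "j < b" for i j
  proof -
    have "i * b + j < Suc i * b" using that by simp
    also have "\<dots> \<le> a * b" using that by (intro mult_le_mono1) simp
    finally show ?thesis .
  qed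
  have "(\<Sum>i<a * b. F (i div b) (i mod b)) = (\<Sum>(i, j)\<in>{..<a} \<times> {..<b}. F i j)"
    by (rule sum.reindex_bij_witness[of _ "\<lambda>(i, j). i * b + j" "\<lambda>i. (i div b, i mod b)"])
       (use False less in \<open>auto simp: less_mult_imp_div_less\<close>)
  then show ?thesis by (simp add: sum.cartesian_product)
qed simp

text \<open>The channel is memoryless and the index pairs fill a rectangle, so the average success
  is the product of the two averages.\<close>

lemma det_code_append:
  fixes W :: "'s::finite \<Rightarrow> 'x::finite \<Rightarrow> 'y::finite \<Rightarrow> real"
  assumes W: "\<forall>s. channel (W s)"
    and 1: "det_code W l1 L1 c1 dec1 \<epsilon>1" and 2: "det_code W l2 L2 c2 dec2 \<epsilon>2"
  shows "det_code W (l1 + l2) (L1 * L2) (\<lambda>i. c1 (i div L2) @ c2 (i mod L2))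
    (\<lambda>y. dec1 (take l1 y) * L2 + dec2 (drop l1 y)) (\<epsilon>1 + \<epsilon>2)"
  unfolding det_code_def
proof (intro conjI allI impI ballI)
  have c: "c1 i \<in> seqs l1" if "i < L1" for i using 1 that by (simp add: det_code_def)
  have c': "c2 i \<in> seqs l2" if "i < L2" for i using 2 that by (simp add: det_code_def)
  have d: "dec1 y < L1" "dec2 y < L2" for y using 1 2 by (auto simp: det_code_def)
  {
    fix i assume "i < L1 * L2"
    moreover from this have "L2 > 0" by (metis gr0I mult_0_right not_less0)
    ultimately show "c1 (i div L2) @ c2 (i mod L2) \<in> seqs (l1 + l2)"
      by (intro append_in_seqs c c') (auto simp: less_mult_imp_div_less)
  }
  {
    fix y
    have "dec1 (take l1 y) * L2 + dec2 (drop l1 y) < Suc (dec1 (take l1 y)) * L2" using d by simp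
    also have "\<dots> \<le> L1 * L2" using d by (intro mult_le_mono1) (simp add: Suc_le_eq)
    finally show "dec1 (take l1 y) * L2 + dec2 (drop l1 y) < L1 * L2" .
  }
  fix s :: "'s list" assume "s \<in> seqs (l1 + l2)"
  then obtain s1 s2 where s: "s = s1 @ s2" "s1 \<in> seqs l1" "s2 \<in> seqs l2"
    by (rule seqs_append_cases)
  define p1 where "p1 = (\<lambda>i. \<Sum>y\<in>{y \<in> seqs l1. dec1 y = i}. prodch W s1 (c1 i) y)"
  define p2 where "p2 = (\<lambda>i. \<Sum>y\<in>{y \<in> seqs l2. dec2 y = i}. prodch W s2 (c2 i) y)"
  let ?p = "\<lambda>i. \<Sum>y\<in>{y \<in> seqs (l1 + l2). dec1 (take l1 y) * L2 + dec2 (drop l1 y) = i}.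
      prodch W s (c1 (i div L2) @ c2 (i mod L2)) y"
  have "?p i = p1 (i div L2) * p2 (i mod L2)" if i: "i < L1 * L2" for i
  proof -
    have L2: "L2 > 0" using i by (metis gr0I mult_0_right not_less0)
    have iff: "u * L2 + v = i \<longleftrightarrow> u = i div L2 \<and> v = i mod L2" if "v < L2" for u v
      using that by (auto simp: mult.commute)
    have "?p i = (\<Sum>y\<in>seqs (l1 + l2). if dec1 (take l1 y) * L2 + dec2 (drop l1 y) = i
        then prodch W s (c1 (i div L2) @ c2 (i mod L2)) y else 0)"
      by (rule sum.inter_filter) simp
    also have "\<dots> = (\<Sum>y1\<in>seqs l1. \<Sum>y2\<in>seqs l2.
       (if dec1 y1 = i div L2 then prodch W s1 (c1 (i div L2)) y1 else 0) *
       (if dec2 y2 = i mod L2 then prodch W s2 (c2 (i mod L2)) y2 else 0))"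
      unfolding sum_seqs_append
    proof (intro sum.cong refl)
      fix y1 :: "'y list" and y2 :: "'y list" assume y: "y1 \<in> seqs l1" "y2 \<in> seqs l2"
      have "prodch W s (c1 (i div L2) @ c2 (i mod L2)) (y1 @ y2)
          = prodch W s1 (c1 (i div L2)) y1 * prodch W s2 (c2 (i mod L2)) y2"
        unfolding s(1) using s(2) c[of "i div L2"] y i
        by (intro prodch_append) (auto simp: seqs_def less_mult_imp_div_less)
      then show "(if dec1 (take l1 (y1 @ y2)) * L2 + dec2 (drop l1 (y1 @ y2)) = i
          then prodch W s (c1 (i div L2) @ c2 (i mod L2)) (y1 @ y2) else 0)
        = (if dec1 y1 = i div L2 then prodch W s1 (c1 (i div L2)) y1 else 0) *
          (if dec2 y2 = i mod L2 then prodch W s2 (c2 (i mod L2)) y2 else 0)"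
        using y by (simp add: seqs_def iff d)
    qed
    also have "\<dots> = p1 (i div L2) * p2 (i mod L2)"
      unfolding p1_def p2_def by (simp add: sum_product sum.inter_filter)
    finally show ?thesis .
  qed
  then have "(\<Sum>i<L1 * L2. ?p i) = (\<Sum>i<L1 * L2. p1 (i div L2) * p2 (i mod L2))"
    by (intro sum.cong) auto
  also have "\<dots> = (\<Sum>i<L1. p1 i) * (\<Sum>j<L2. p2 j)"
    by (simp add: sum_lessThan_mult[of "\<lambda>i j. p1 i * p2 j"] sum_product)
  finally have prod: "(\<Sum>i<L1 * L2. ?p i) = (\<Sum>i<L1. p1 i) * (\<Sum>j<L2. p2 j)" .
  have "p1 i \<le> 1" "p2 i \<le> 1" for i
    unfolding p1_def p2_def using s W by (intro sum_prodch_subset_le(2); auto simp: seqs_def)+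
  then have le: "(\<Sum>i<L1. p1 i) \<le> L1" "(\<Sum>i<L2. p2 i) \<le> L2"
    using sum_bounded_above[of "{..<L1}" p1 1] sum_bounded_above[of "{..<L2}" p2 1] by auto
  have ge: "L1 * (1 - \<epsilon>1) \<le> (\<Sum>i<L1. p1 i)" "L2 * (1 - \<epsilon>2) \<le> (\<Sum>i<L2. p2 i)"
    using 1 2 s unfolding det_code_def p1_def p2_def by blast+
  \<comment> \<open>Multiplying the two lower bounds would require nonnegative factors
    \<open>1 - \<epsilon>1\<close> and \<open>1 - \<epsilon>2\<close>; expanding this product of
    nonnegative deficits does not.\<close>
  have "0 \<le> (L1 - (\<Sum>i<L1. p1 i)) * (L2 - (\<Sum>j<L2. p2 j))"
    using le by simp
  moreover have "L2 * (L1 * (1 - \<epsilon>1)) \<le> L2 * (\<Sum>i<L1. p1 i)" "L1 * (L2 * (1 - \<epsilon>2)) \<le> L1 * (\<Sum>i<L2. p2 i)"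
    using ge by (auto intro!: mult_left_mono)
  ultimately show "real (L1 * L2) * (1 - (\<epsilon>1 + \<epsilon>2)) \<le> (\<Sum>i<L1 * L2. ?p i)"
    unfolding prod by (simp add: algebra_simps)
qed

lemma det_code_power:
  fixes W :: "'s::finite \<Rightarrow> 'x::finite \<Rightarrow> 'y::finite \<Rightarrow> real"
  assumes W: "\<forall>s. channel (W s)" and "det_code W l L c dec \<epsilon>"
  shows "\<exists>c' dec'. det_code W (b * l) (L ^ b) c' dec' (b * \<epsilon>)"
proof (induction b)
  case 0
  have "det_code W 0 1 (\<lambda>_. []) (\<lambda>_. 0) 0"
    by (simp add: det_code_def prodch_def)
  then show ?case by (auto intro!: exI)
next
  case (Suc b)
  then obtain c' dec' where "det_code W (b * l) (L ^ b) c' dec' (b * \<epsilon>)" by blast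
  from det_code_append[OF W assms(2) this] show ?case
    by (auto simp: algebra_simps intro!: exI)
qed

section \<open>Sampling by an exponential potential\<close>

lemma exp_le_quadratic:
  fixes u :: real
  assumes "\<bar>u\<bar> \<le> 1"
  shows "exp u \<le> 1 + u + u\<^sup>2"
proof (cases "u \<ge> 0")
  case True then show ?thesis using exp_bound[of u] assms by simp
next
  case False
  \<comment> \<open>\<open>exp u = 1 / exp (- u) \<le> 1 / (1 - u)\<close>, and \<open>(1 - u) (1 + u + u\<^sup>2) = 1 - u\<^sup>3 \<ge> 1\<close>.\<close>
  have "1 - u \<le> exp (- u)" using exp_ge_add_one_self[of "- u"] by simp
  then have "(1 - u) * exp u \<le> 1"
    using mult_right_mono[of "1 - u" "exp (- u)" "exp u"] by (simp add: exp_minus)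
  also have "1 \<le> (1 - u) * (1 + u + u\<^sup>2)"
    using False mult_nonpos_nonneg[of u "u * u"] by (simp add: algebra_simps power2_eq_square)
  finally show ?thesis using False by simp
qed

text \<open>Instead of drawing the samples at random, each one is chosen so that an exponential
  potential grows by at most its average factor.\<close>

lemma sample_average:
  fixes g :: "'f \<Rightarrow> nat \<Rightarrow> real" and \<Gamma> L :: nat and \<delta> :: real
  assumes F: "finite F" and "\<Gamma> \<ge> 1" and g: "\<And>f \<gamma>. f \<in> F \<Longrightarrow> \<gamma> < \<Gamma> \<Longrightarrow> 0 \<le> g f \<gamma> \<and> g f \<gamma> \<le> 1"
    and \<delta>: "0 < \<delta>" "\<delta> \<le> 1" and L: "card F * exp (- (L * \<delta>\<^sup>2 / 4)) < 1"
  obtains \<omega> where "\<And>l. \<omega> l < \<Gamma>"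
    "\<And>f. f \<in> F \<Longrightarrow> (\<Sum>l<L. g f (\<omega> l)) \<le> L * ((\<Sum>\<gamma><\<Gamma>. g f \<gamma>) / \<Gamma> + \<delta>)"
proof -
  define \<mu> where "\<mu> = (\<lambda>f. (\<Sum>\<gamma><\<Gamma>. g f \<gamma>) / \<Gamma>)"
  \<comment> \<open>Maximizes \<open>t * \<delta> - t\<^sup>2\<close>; the value
    \<open>\<delta>\<^sup>2 / 4\<close> is the exponent in the assumption on
    \<open>L\<close>.\<close>
  define t where "t = \<delta> / 2"
  have \<mu>: "0 \<le> \<mu> f" "\<mu> f \<le> 1" if "f \<in> F" for f
    using sum_bounded_above[of "{..<\<Gamma>}" "g f" 1] sum_nonneg[of "{..<\<Gamma>}" "g f"] g[OF that] \<open>\<Gamma> \<ge> 1\<close>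
    by (auto simp: \<mu>_def divide_le_eq)
  have mgf: "(\<Sum>\<gamma><\<Gamma>. exp (t * (g f \<gamma> - \<mu> f))) \<le> \<Gamma> * exp (t\<^sup>2)" if f: "f \<in> F" for f
  proof -
    have "(\<Sum>\<gamma><\<Gamma>. exp (t * (g f \<gamma> - \<mu> f))) \<le> (\<Sum>\<gamma><\<Gamma>. 1 + t * (g f \<gamma> - \<mu> f) + t\<^sup>2)"
    proof (intro sum_mono)
      fix \<gamma> assume "\<gamma> \<in> {..<\<Gamma>}"
      then have abs: "\<bar>g f \<gamma> - \<mu> f\<bar> \<le> 1" using g[OF f, of \<gamma>] \<mu>[OF f] by auto
      then have "\<bar>t * (g f \<gamma> - \<mu> f)\<bar> \<le> 1"
        using \<delta> mult_mono[of \<delta> 1 "\<bar>g f \<gamma> - \<mu> f\<bar>" 1] by (simp add: abs_mult t_def)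
      then have "exp (t * (g f \<gamma> - \<mu> f)) \<le> 1 + t * (g f \<gamma> - \<mu> f) + (t * (g f \<gamma> - \<mu> f))\<^sup>2"
        by (rule exp_le_quadratic)
      also have "(t * (g f \<gamma> - \<mu> f))\<^sup>2 \<le> t\<^sup>2 * 1"
        unfolding power_mult_distrib using abs by (intro mult_left_mono) (auto simp: abs_square_le_1)
      finally show "exp (t * (g f \<gamma> - \<mu> f)) \<le> 1 + t * (g f \<gamma> - \<mu> f) + t\<^sup>2" by simp
    qed
    also have "\<dots> = \<Gamma> * (1 + t\<^sup>2) + t * ((\<Sum>\<gamma><\<Gamma>. g f \<gamma>) - \<Gamma> * \<mu> f)"
      by (simp add: sum.distrib sum_subtractf algebra_simps sum_distrib_left)
    also have "\<dots> = \<Gamma> * (1 + t\<^sup>2)"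
      using \<open>\<Gamma> \<ge> 1\<close> by (simp add: \<mu>_def)
    also have "\<dots> \<le> \<Gamma> * exp (t\<^sup>2)"
      by (intro mult_left_mono) auto
    finally show ?thesis .
  qed
  have "\<exists>\<omega>. (\<forall>l. \<omega> l < \<Gamma>) \<and> (\<Sum>f\<in>F. exp (t * (\<Sum>l<L. g f (\<omega> l) - \<mu> f))) \<le> card F * exp (t\<^sup>2) ^ L" for L
  proof (induction L)
    case 0 then show ?case using \<open>\<Gamma> \<ge> 1\<close> by (auto intro!: exI[of _ "\<lambda>_. 0"])
  next
    case (Suc L)
    then obtain \<omega> where \<omega>: "\<And>l. \<omega> l < \<Gamma>"
        "(\<Sum>f\<in>F. exp (t * (\<Sum>l<L. g f (\<omega> l) - \<mu> f))) \<le> card F * exp (t\<^sup>2) ^ L" by blast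
    define \<Phi> where "\<Phi> = (\<lambda>f. exp (t * (\<Sum>l<L. g f (\<omega> l) - \<mu> f)))"
    define G where "G = (\<lambda>\<gamma>. \<Sum>f\<in>F. \<Phi> f * exp (t * (g f \<gamma> - \<mu> f)))"
    have "(\<Sum>\<gamma><\<Gamma>. G \<gamma>) = (\<Sum>f\<in>F. \<Phi> f * (\<Sum>\<gamma><\<Gamma>. exp (t * (g f \<gamma> - \<mu> f))))"
      unfolding G_def by (subst sum.swap) (simp add: sum_distrib_left)
    also have "\<dots> \<le> (\<Sum>f\<in>F. \<Phi> f * (\<Gamma> * exp (t\<^sup>2)))"
      by (intro sum_mono mult_left_mono mgf) (auto simp: \<Phi>_def)
    also have "\<dots> = \<Gamma> * (exp (t\<^sup>2) * (\<Sum>f\<in>F. \<Phi> f))"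
      by (simp add: sum_distrib_left sum_distrib_right mult_ac)
    also have "\<dots> \<le> \<Gamma> * (exp (t\<^sup>2) * (card F * exp (t\<^sup>2) ^ L))"
      using \<omega>(2) by (intro mult_left_mono) (auto simp: \<Phi>_def)
    finally have sumG: "(\<Sum>\<gamma><\<Gamma>. G \<gamma>) \<le> \<Gamma> * (card F * exp (t\<^sup>2) ^ Suc L)" by (simp add: mult_ac)
    have "\<exists>\<gamma><\<Gamma>. G \<gamma> \<le> card F * exp (t\<^sup>2) ^ Suc L"
    proof (rule ccontr)
      assume "\<not> ?thesis"
      then have "(\<Sum>\<gamma><\<Gamma>. card F * exp (t\<^sup>2) ^ Suc L) < (\<Sum>\<gamma><\<Gamma>. G \<gamma>)"
        using \<open>\<Gamma> \<ge> 1\<close> by (intro sum_strict_mono) (auto simp: not_le lessThan_empty_iff)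
      with sumG show False by simp
    qed
    then obtain \<gamma> where \<gamma>: "\<gamma> < \<Gamma>" "G \<gamma> \<le> card F * exp (t\<^sup>2) ^ Suc L" by blast
    have "(\<Sum>f\<in>F. exp (t * (\<Sum>l<Suc L. g f (fun_upd \<omega> L \<gamma> l) - \<mu> f))) = G \<gamma>"
      unfolding G_def \<Phi>_def by (intro sum.cong) (auto simp: distrib_left exp_add)
    then show ?case
      using \<gamma> \<omega>(1) by (intro exI[of _ "fun_upd \<omega> L \<gamma>"]) auto
  qed
  then obtain \<omega> where \<omega>: "\<And>l. \<omega> l < \<Gamma>"
      "(\<Sum>f\<in>F. exp (t * (\<Sum>l<L. g f (\<omega> l) - \<mu> f))) \<le> card F * exp (t\<^sup>2) ^ L" by blast
  show thesis
  proof (rule that[of \<omega>])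
    fix f assume f: "f \<in> F"
    show "(\<Sum>l<L. g f (\<omega> l)) \<le> L * ((\<Sum>\<gamma><\<Gamma>. g f \<gamma>) / \<Gamma> + \<delta>)"
    proof (rule ccontr)
      assume "\<not> ?thesis"
      \<comment> \<open>A single violating \<open>f\<close> would contribute at least
        \<open>exp (t * (L * \<delta>))\<close>, more than the bound on the whole potential
        allows.\<close>
      then have "L * \<delta> \<le> (\<Sum>l<L. g f (\<omega> l) - \<mu> f)"
        by (simp add: sum_subtractf \<mu>_def algebra_simps)
      then have "exp (t * (L * \<delta>)) \<le> exp (t * (\<Sum>l<L. g f (\<omega> l) - \<mu> f))"
        using \<delta> by (auto simp: t_def intro: mult_left_mono)
      also have "\<dots> \<le> (\<Sum>f\<in>F. exp (t * (\<Sum>l<L. g f (\<omega> l) - \<mu> f)))"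
        using f F by (intro member_le_sum[of f F "\<lambda>f. exp (t * (\<Sum>l<L. g f (\<omega> l) - \<mu> f))"]) auto
      also have "\<dots> \<le> card F * exp (L * t\<^sup>2)"
        using \<omega>(2) by (simp add: exp_of_nat_mult)
      finally have "exp (t * (L * \<delta>)) * exp (- (L * t\<^sup>2)) \<le> card F"
        by (simp add: exp_minus divide_simps)
      moreover have "exp (t * (L * \<delta>)) * exp (- (L * t\<^sup>2)) = exp (L * \<delta>\<^sup>2 / 4)"
        unfolding exp_add[symmetric] by (simp add: t_def power2_eq_square field_simps)
      ultimately have "1 \<le> card F * exp (- (L * \<delta>\<^sup>2 / 4))"
        by (simp add: exp_minus divide_simps)
      with L show False by simp
    qed
  qed (use \<omega> in auto)
qed

section \<open>Mutual information and codes\<close>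

text \<open>This is \<open>ln u \<le> u - 1\<close> at \<open>u = b * r / a\<close>. The free ratio
  \<open>r\<close> serves two purposes: the ratio of totals gives the log-sum inequality, and
  \<open>r = 1\<close> gives nonnegativity of mutual information.\<close>

lemma log_ratio_tangent:
  fixes a b r :: real
  assumes "0 \<le> a" "0 \<le> b" "b = 0 \<Longrightarrow> a = 0" "0 < r"
  shows "a * log 2 r + (a - b * r) / ln 2 \<le> a * log 2 (a / b)"
proof (cases "a = 0")
  case True
  then show ?thesis using assms by (simp add: divide_le_0_iff)
next
  case False
  then have pos: "a > 0" "b > 0" using assms by (auto simp: order_less_le)
  have "ln (b * r / a) \<le> b * r / a - 1"
    using pos assms by (intro ln_le_minus_one) auto
  then have "a * ln (b * r / a) \<le> b * r - a"
    using pos by (simp add: field_simps)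
  moreover have "ln (b * r / a) = ln r - ln (a / b)"
    using pos assms by (simp add: ln_mult ln_div)
  ultimately have "a * ln r + (a - b * r) \<le> a * ln (a / b)"
    by (simp add: algebra_simps)
  then have "(a * ln r + (a - b * r)) / ln 2 \<le> a * ln (a / b) / ln 2"
    by (intro divide_right_mono) auto
  then show ?thesis
    by (simp add: log_def add_divide_distrib)
qed

lemma log_sum_inequality:
  fixes a b :: "'i \<Rightarrow> real"
  assumes "finite I" and nn: "\<And>i. i \<in> I \<Longrightarrow> 0 \<le> a i" "\<And>i. i \<in> I \<Longrightarrow> 0 \<le> b i"
    and ac: "\<And>i. i \<in> I \<Longrightarrow> b i = 0 \<Longrightarrow> a i = 0"
  shows "(\<Sum>i\<in>I. a i) * log 2 ((\<Sum>i\<in>I. a i) / (\<Sum>i\<in>I. b i)) \<le> (\<Sum>i\<in>I. a i * log 2 (a i / b i))"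
proof (cases "(\<Sum>i\<in>I. a i) = 0")
  case True
  then have "\<forall>i\<in>I. a i = 0" using nn(1) \<open>finite I\<close> by (simp add: sum_nonneg_eq_0_iff)
  then show ?thesis using True by simp
next
  case False
  let ?A = "\<Sum>i\<in>I. a i" and ?B = "\<Sum>i\<in>I. b i"
  have A: "?A > 0" using False sum_nonneg[of I a] nn by force
  have "?B \<noteq> 0"
  proof
    assume "?B = 0"
    then have "\<forall>i\<in>I. b i = 0" using nn(2) \<open>finite I\<close> by (simp add: sum_nonneg_eq_0_iff)
    then have "?A = 0" using ac by simp
    with False show False by contradiction
  qed
  then have B: "?B > 0" using sum_nonneg[of I b] nn by force
  have "(\<Sum>i\<in>I. a i * log 2 (?A / ?B) + (a i - b i * (?A / ?B)) / ln 2) \<le> (\<Sum>i\<in>I. a i * log 2 (a i / b i))"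
    using nn ac A B by (intro sum_mono log_ratio_tangent) auto
  also have "(\<Sum>i\<in>I. a i * log 2 (?A / ?B) + (a i - b i * (?A / ?B)) / ln 2)
      = ?A * log 2 (?A / ?B) + (?A - ?B * (?A / ?B)) / ln 2"
    by (simp only: sum.distrib sum_subtractf flip: sum_distrib_right sum_divide_distrib)
  also have "\<dots> = ?A * log 2 (?A / ?B)"
    using B by simp
  finally show ?thesis .
qed

lemma mutual_info_eq:
  "mutual_info p A B = (\<Sum>a\<in>A. \<Sum>b\<in>B. p a b * log 2 (p a b / ((\<Sum>b'\<in>B. p a b') * (\<Sum>a'\<in>A. p a' b))))"
  unfolding mutual_info_def by (intro sum.cong) auto

lemma mutual_info_nonneg:
  fixes p :: "'a \<Rightarrow> 'b \<Rightarrow> real"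
  assumes fin: "finite A" "finite B" and nn: "\<And>a b. a \<in> A \<Longrightarrow> b \<in> B \<Longrightarrow> 0 \<le> p a b"
    and one: "(\<Sum>a\<in>A. \<Sum>b\<in>B. p a b) = 1"
  shows "0 \<le> mutual_info p A B"
proof -
  let ?r = "\<lambda>a. \<Sum>b'\<in>B. p a b'" and ?c = "\<lambda>b. \<Sum>a'\<in>A. p a' b"
  have "p a b * log 2 1 + (p a b - ?r a * ?c b * 1) / ln 2 \<le> p a b * log 2 (p a b / (?r a * ?c b))"
    if ab: "a \<in> A" "b \<in> B" for a b
  proof (rule log_ratio_tangent)
    have "p a b \<le> ?r a" "p a b \<le> ?c b"
      using ab fin nn member_le_sum[of b B "p a"] member_le_sum[of a A "\<lambda>a. p a b"] by auto
    then show "p a b = 0" if "?r a * ?c b = 0"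
      using that nn[OF ab] by auto
  qed (use ab nn in \<open>auto intro!: mult_nonneg_nonneg sum_nonneg\<close>)
  then have "(\<Sum>a\<in>A. \<Sum>b\<in>B. (p a b - ?r a * ?c b) / ln 2) \<le> mutual_info p A B"
    unfolding mutual_info_eq by (intro sum_mono) auto
  moreover have "(\<Sum>a\<in>A. \<Sum>b\<in>B. (p a b - ?r a * ?c b) / ln 2)
      = ((\<Sum>a\<in>A. \<Sum>b\<in>B. p a b) - (\<Sum>a\<in>A. ?r a) * (\<Sum>b\<in>B. ?c b)) / ln 2"
    by (simp only: sum_subtractf sum_product flip: sum_divide_distrib)
  moreover have "(\<Sum>b\<in>B. ?c b) = 1"
    using one by (subst sum.swap)
  ultimately show ?thesis using one by simp
qed

text \<open>The marginal of \<open>b\<close> dominates each \<open>p a b\<close>, so with rows of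
  mass \<open>1 / K\<close> every density ratio is at most \<open>K\<close>.\<close>

lemma mutual_info_le_log_card:
  fixes p :: "'a \<Rightarrow> 'b \<Rightarrow> real"
  assumes fin: "finite A" "finite B" and nn: "\<And>a b. a \<in> A \<Longrightarrow> b \<in> B \<Longrightarrow> 0 \<le> p a b"
    and unif: "\<And>a. a \<in> A \<Longrightarrow> (\<Sum>b\<in>B. p a b) = 1 / K" and one: "(\<Sum>a\<in>A. \<Sum>b\<in>B. p a b) = 1" and "K > 0"
  shows "mutual_info p A B \<le> log 2 K"
proof -
  have "p a b * log 2 (p a b / ((\<Sum>b'\<in>B. p a b') * (\<Sum>a'\<in>A. p a' b))) \<le> p a b * log 2 K"
    if ab: "a \<in> A" "b \<in> B" for a b
  proof (cases "p a b = 0")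
    case False
    then have pos: "p a b > 0" using nn[OF ab] by simp
    have le: "p a b \<le> (\<Sum>a'\<in>A. p a' b)"
      using ab fin nn member_le_sum[of a A "\<lambda>a. p a b"] by auto
    have "p a b / ((\<Sum>b'\<in>B. p a b') * (\<Sum>a'\<in>A. p a' b)) = K * (p a b / (\<Sum>a'\<in>A. p a' b))"
      using unif[OF ab(1)] by simp
    also have "\<dots> \<le> K * 1"
      using le pos \<open>K > 0\<close> by (intro mult_left_mono) (auto simp: divide_le_eq)
    finally have "p a b / ((\<Sum>b'\<in>B. p a b') * (\<Sum>a'\<in>A. p a' b)) \<le> K" by simp
    moreover have "0 < p a b / ((\<Sum>b'\<in>B. p a b') * (\<Sum>a'\<in>A. p a' b))"
      using unif[OF ab(1)] le pos \<open>K > 0\<close> by simp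
    ultimately show ?thesis
      using pos by (intro mult_left_mono) auto
  qed simp
  then have "mutual_info p A B \<le> (\<Sum>a\<in>A. \<Sum>b\<in>B. p a b * log 2 K)"
    unfolding mutual_info_eq by (intro sum_mono) auto
  also have "\<dots> = log 2 K"
    using one by (simp flip: sum_distrib_right)
  finally show ?thesis .
qed

section \<open>Success and leakage for a fixed value of the common randomness\<close>

definition kernel :: "('s \<Rightarrow> 'x \<Rightarrow> 'z \<Rightarrow> real) \<Rightarrow> nat \<Rightarrow> (nat \<Rightarrow> nat \<Rightarrow> 'x list \<Rightarrow> real)
    \<Rightarrow> 's list \<Rightarrow> nat \<Rightarrow> nat \<Rightarrow> 'z list \<Rightarrow> real" where
  "kernel V n e sn \<gamma> k zn = (\<Sum>xn\<in>seqs n. e \<gamma> k xn * prodch V sn xn zn)"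

text \<open>Mutual information given that the common randomness equals \<gamma>. Success and leakage
  of a code become plain averages over \<gamma>, the form on which \<open>sample_average\<close>
  acts.\<close>

definition leak_at :: "('s \<Rightarrow> 'x \<Rightarrow> 'z \<Rightarrow> real) \<Rightarrow> nat \<Rightarrow> nat \<Rightarrow> (nat \<Rightarrow> nat \<Rightarrow> 'x list \<Rightarrow> real)
    \<Rightarrow> 's list \<Rightarrow> nat \<Rightarrow> real" where
  "leak_at V n K e sn \<gamma> = mutual_info (\<lambda>k zn. kernel V n e sn \<gamma> k zn / K) {..<K} (seqs n)"

definition success_at :: "('s \<Rightarrow> 'x \<Rightarrow> 'y \<Rightarrow> real) \<Rightarrow> nat \<Rightarrow> nat \<Rightarrow> (nat \<Rightarrow> nat \<Rightarrow> 'x list \<Rightarrow> real)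
    \<Rightarrow> (nat \<Rightarrow> nat \<Rightarrow> 'y list set) \<Rightarrow> 's list \<Rightarrow> nat \<Rightarrow> real" where
  "success_at W n K e D sn \<gamma> =
     (\<Sum>k<K. \<Sum>xn\<in>seqs n. e \<gamma> k xn * (\<Sum>yn\<in>D \<gamma> k. prodch W sn xn yn)) / K"

lemma code_success_eq: "code_success W n K \<Gamma> e D sn = (\<Sum>\<gamma><\<Gamma>. success_at W n K e D sn \<gamma>) / \<Gamma>"
  by (simp add: code_success_def success_at_def flip: sum_divide_distrib)

lemma is_codeD:
  assumes "is_code n K \<Gamma> e D"
  shows "1 \<le> K" "1 \<le> \<Gamma>" "\<gamma> < \<Gamma> \<Longrightarrow> k < K \<Longrightarrow> 0 \<le> e \<gamma> k x" "\<gamma> < \<Gamma> \<Longrightarrow> k < K \<Longrightarrow> (\<Sum>xn\<in>seqs n. e \<gamma> k xn) = 1"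
    "\<gamma> < \<Gamma> \<Longrightarrow> k < K \<Longrightarrow> D \<gamma> k \<subseteq> seqs n"
    "\<gamma> < \<Gamma> \<Longrightarrow> k < K \<Longrightarrow> k' < K \<Longrightarrow> k \<noteq> k' \<Longrightarrow> D \<gamma> k \<inter> D \<gamma> k' = {}"
  using assms by (auto simp: is_code_def)

context
  fixes n K \<Gamma> :: nat and e :: "nat \<Rightarrow> nat \<Rightarrow> 'x::finite list \<Rightarrow> real" and D :: "nat \<Rightarrow> nat \<Rightarrow> 'y::finite list set"
  assumes code: "is_code n K \<Gamma> e D"
begin

lemma kernel_nonneg:
  assumes "\<forall>s. channel (V s)" "\<gamma> < \<Gamma>" "k < K"
  shows "0 \<le> kernel V n e sn \<gamma> k zn"
  unfolding kernel_def using is_codeD(3)[OF code] assms prodch_nonneg[OF assms(1)] by (intro sum_nonneg mult_nonneg_nonneg) auto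

lemma sum_kernel:
  fixes V :: "'s \<Rightarrow> 'x \<Rightarrow> 'z::finite \<Rightarrow> real"
  assumes "\<forall>s. channel (V s)" "\<gamma> < \<Gamma>" "k < K" "sn \<in> seqs n"
  shows "(\<Sum>zn\<in>seqs n. kernel V n e sn \<gamma> k zn) = 1"
proof -
  have "(\<Sum>zn\<in>seqs n. kernel V n e sn \<gamma> k zn) = (\<Sum>xn\<in>seqs n. e \<gamma> k xn * (\<Sum>zn\<in>seqs n. prodch V sn xn zn))"
    unfolding kernel_def by (subst sum.swap) (simp add: sum_distrib_left)
  then show ?thesis
    using is_codeD(4)[OF code] assms by (simp add: sum_prodch length_seqs)
qed

lemma cond_mutual_info_code:
  fixes V :: "'s \<Rightarrow> 'x \<Rightarrow> 'z::finite \<Rightarrow> real"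
  assumes V: "\<forall>s. channel (V s)" and sn: "sn \<in> seqs n"
  shows "cond_mutual_info (code_joint V n K \<Gamma> e sn) {..<\<Gamma>} {..<K} (seqs n) = (\<Sum>\<gamma><\<Gamma>. leak_at V n K e sn \<gamma>) / \<Gamma>"
proof -
  have pos: "K > 0" "\<Gamma> > 0" using is_codeD(1,2)[OF code] by auto
  have joint: "code_joint V n K \<Gamma> e sn \<gamma> k zn = kernel V n e sn \<gamma> k zn / (real \<Gamma> * K)" for \<gamma> k zn
    by (simp add: code_joint_def kernel_def)
  have "(\<Sum>k<K. \<Sum>zn\<in>seqs n. code_joint V n K \<Gamma> e sn \<gamma> k zn) = 1 / \<Gamma>" if "\<gamma> < \<Gamma>" for \<gamma>
    unfolding joint using pos sum_kernel[OF V that _ sn] by (simp flip: sum_divide_distrib)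
  then show ?thesis
    unfolding cond_mutual_info_def leak_at_def sum_divide_distrib
    using pos by (intro sum.cong) (auto simp: Let_def joint)
qed

lemma leak_at_bounds:
  fixes V :: "'s \<Rightarrow> 'x \<Rightarrow> 'z::finite \<Rightarrow> real"
  assumes V: "\<forall>s. channel (V s)" and sn: "sn \<in> seqs n" and \<gamma>: "\<gamma> < \<Gamma>"
  shows "0 \<le> leak_at V n K e sn \<gamma>" "leak_at V n K e sn \<gamma> \<le> log 2 K"
proof -
  have K: "K > 0" using is_codeD(1)[OF code] by simp
  have unif: "(\<Sum>zn\<in>seqs n. kernel V n e sn \<gamma> k zn / K) = 1 / K" if "k < K" for k
    using sum_kernel[OF V \<gamma> that sn] by (simp flip: sum_divide_distrib)
  then have one: "(\<Sum>k<K. \<Sum>zn\<in>seqs n. kernel V n e sn \<gamma> k zn / K) = 1"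
    using K by simp
  show "0 \<le> leak_at V n K e sn \<gamma>"
    unfolding leak_at_def using one kernel_nonneg[OF V \<gamma>] by (intro mutual_info_nonneg) auto
  show "leak_at V n K e sn \<gamma> \<le> log 2 K"
    unfolding leak_at_def using one kernel_nonneg[OF V \<gamma>] K unif by (intro mutual_info_le_log_card) auto
qed

lemma success_at_bounds:
  fixes W :: "'s \<Rightarrow> 'x \<Rightarrow> 'y \<Rightarrow> real"
  assumes W: "\<forall>s. channel (W s)" and sn: "sn \<in> seqs n" and \<gamma>: "\<gamma> < \<Gamma>"
  shows "0 \<le> success_at W n K e D sn \<gamma>" "success_at W n K e D sn \<gamma> \<le> 1"
proof -
  have K: "K > 0" using is_codeD(1)[OF code] by simp
  have len: "length sn = n" using sn by (simp add: seqs_def)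
  show "0 \<le> success_at W n K e D sn \<gamma>"
    unfolding success_at_def using is_codeD(3)[OF code \<gamma>] prodch_nonneg[OF W]
    by (intro divide_nonneg_nonneg sum_nonneg mult_nonneg_nonneg) auto
  have "(\<Sum>xn\<in>seqs n. e \<gamma> k xn * (\<Sum>yn\<in>D \<gamma> k. prodch W sn xn yn)) \<le> 1" if "k < K" for k
  proof -
    have "(\<Sum>xn\<in>seqs n. e \<gamma> k xn * (\<Sum>yn\<in>D \<gamma> k. prodch W sn xn yn)) \<le> (\<Sum>xn\<in>seqs n. e \<gamma> k xn * 1)"
      using is_codeD(3,5)[OF code \<gamma> that] by (intro sum_mono mult_left_mono sum_prodch_subset_le(2)[OF W len]) auto
    then show ?thesis using is_codeD(4)[OF code \<gamma> that] by simp
  qed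
  then have "(\<Sum>k<K. \<Sum>xn\<in>seqs n. e \<gamma> k xn * (\<Sum>yn\<in>D \<gamma> k. prodch W sn xn yn)) \<le> K"
    using sum_bounded_above[of "{..<K}" _ "1 :: real"] by force
  then show "success_at W n K e D sn \<gamma> \<le> 1"
    unfolding success_at_def using K by simp
qed

text \<open>Each output word lies in at most one decoding set and counts with weight at most 1, so
  the messages share at most \<open>CARD('y) ^ n\<close> units of success.\<close>

lemma success_at_le_card:
  fixes W :: "'s \<Rightarrow> 'x \<Rightarrow> 'y \<Rightarrow> real"
  assumes W: "\<forall>s. channel (W s)" and \<gamma>: "\<gamma> < \<Gamma>"
  shows "success_at W n K e D sn \<gamma> \<le> CARD('y) ^ n / K"
proof -
  have "(\<Sum>k<K. \<Sum>xn\<in>seqs n. e \<gamma> k xn * (\<Sum>yn\<in>D \<gamma> k. prodch W sn xn yn))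
      \<le> (\<Sum>k<K. \<Sum>xn\<in>seqs n. e \<gamma> k xn * card (D \<gamma> k))"
  proof (intro sum_mono mult_left_mono)
    fix k and xn :: "'x list" assume "k \<in> {..<K}"
    then show "0 \<le> e \<gamma> k xn" using is_codeD(3)[OF code \<gamma>] by simp
    show "(\<Sum>yn\<in>D \<gamma> k. prodch W sn xn yn) \<le> card (D \<gamma> k)"
      using sum_bounded_above[of "D \<gamma> k" "prodch W sn xn" 1] prodch_le_1[OF W] by simp
  qed
  also have "\<dots> = (\<Sum>k<K. real (card (D \<gamma> k)))"
    using is_codeD(4)[OF code \<gamma>] by (simp flip: sum_distrib_right)
  also have "\<dots> = real (card (\<Union>k<K. D \<gamma> k))"
  proof -
    have "card (\<Union>k<K. D \<gamma> k) = (\<Sum>k<K. card (D \<gamma> k))"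
      using is_codeD(5,6)[OF code \<gamma>] by (intro card_UN_disjoint) (auto intro: finite_subset[OF _ finite_seqs])
    then show ?thesis by simp
  qed
  also have "\<dots> \<le> real (card (seqs n :: 'y list set))"
    using is_codeD(5)[OF code \<gamma>] by (intro of_nat_mono card_mono) auto
  finally show ?thesis
    unfolding success_at_def card_seqs by (intro divide_right_mono) auto
qed

lemma code_success_le_card:
  fixes W :: "'s \<Rightarrow> 'x \<Rightarrow> 'y \<Rightarrow> real"
  assumes W: "\<forall>s. channel (W s)"
  shows "code_success W n K \<Gamma> e D sn \<le> CARD('y) ^ n / K"
  using sum_bounded_above[of "{..<\<Gamma>}" "success_at W n K e D sn" "CARD('y) ^ n / K"] success_at_le_card[OF W]
    is_codeD(2)[OF code]
  by (simp add: code_success_eq divide_le_eq mult.commute)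

text \<open>A crude converse with two uses: leakage is at most linear in the blocklength, and the
  set of achievable rates is bounded.\<close>

lemma card_messages_le:
  fixes W :: "'s::finite \<Rightarrow> 'x \<Rightarrow> 'y \<Rightarrow> real"
  assumes W: "\<forall>s. channel (W s)" and err: "code_error W n K \<Gamma> e D \<le> 1 / 2"
  shows "log 2 K \<le> 1 + n * log 2 CARD('y)"
proof -
  have "Min (code_success W n K \<Gamma> e D ` seqs n) \<le> CARD('y) ^ n / K"
  proof -
    obtain sn :: "'s list" where "sn \<in> seqs n" using seqs_nonempty by blast
    then have "Min (code_success W n K \<Gamma> e D ` seqs n) \<le> code_success W n K \<Gamma> e D sn" by simp
    with code_success_le_card[OF W, of sn] show ?thesis by linarith
  qed
  with err have "1 / 2 \<le> CARD('y) ^ n / real K" unfolding code_error_def by linarith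
  moreover have K: "K > 0" using is_codeD(1)[OF code] by simp
  ultimately have "real K \<le> 2 * CARD('y) ^ n" by (simp add: field_simps)
  then have "log 2 K \<le> log 2 (2 * CARD('y) ^ n)"
    using K by simp
  also have "\<dots> = 1 + n * log 2 CARD('y)"
    by (simp add: log_mult log_nat_power)
  finally show ?thesis .
qed

lemma code_leak_nonneg:
  fixes V :: "'s::finite \<Rightarrow> 'x \<Rightarrow> 'z::finite \<Rightarrow> real"
  assumes V: "\<forall>s. channel (V s)"
  shows "0 \<le> code_leak V n K \<Gamma> e"
proof -
  obtain sn :: "'s list" where sn: "sn \<in> seqs n" using seqs_nonempty by blast
  have "0 \<le> cond_mutual_info (code_joint V n K \<Gamma> e sn) {..<\<Gamma>} {..<K} (seqs n)"
    unfolding cond_mutual_info_code[OF V sn] using leak_at_bounds(1)[OF V sn]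
    by (intro divide_nonneg_nonneg sum_nonneg) auto
  also have "\<dots> \<le> code_leak V n K \<Gamma> e"
    unfolding code_leak_def using sn by (intro Max_ge) auto
  finally show ?thesis .
qed

lemma code_error_nonneg:
  fixes W :: "'s::finite \<Rightarrow> 'x \<Rightarrow> 'y \<Rightarrow> real"
  assumes W: "\<forall>s. channel (W s)"
  shows "0 \<le> code_error W n K \<Gamma> e D"
proof -
  obtain sn :: "'s list" where sn: "sn \<in> seqs n" using seqs_nonempty by blast
  have "Min (code_success W n K \<Gamma> e D ` seqs n) \<le> code_success W n K \<Gamma> e D sn"
    using sn by simp
  also have "\<dots> \<le> 1"
    using sum_bounded_above[of "{..<\<Gamma>}" "success_at W n K e D sn" 1] success_at_bounds(2)[OF W sn]
      is_codeD(2)[OF code]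
    by (simp add: code_success_eq divide_le_eq)
  finally show ?thesis by (simp add: code_error_def)
qed

end

section \<open>Announcing the common randomness in a prefix\<close>

text \<open>The index \<open>i\<close> is private randomness of the encoder, uniform on
  \<open>{..<L}\<close>. Adding up all \<open>i\<close> with a matching prefix stays correct when
  codewords \<open>c i\<close> coincide. The ignored argument is the trivial common
  randomness.\<close>

definition prefix_enc :: "nat \<Rightarrow> nat \<Rightarrow> nat \<Rightarrow> (nat \<Rightarrow> 'x list) \<Rightarrow> (nat \<Rightarrow> nat)
    \<Rightarrow> (nat \<Rightarrow> nat \<Rightarrow> 'x list \<Rightarrow> real) \<Rightarrow> nat \<Rightarrow> nat \<Rightarrow> 'x list \<Rightarrow> real" where
  "prefix_enc l n L c f e _ k x = (if x \<in> seqs (l + n)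
     then (\<Sum>i<L. if take l x = c i then e (f i) k (drop l x) else 0) / L else 0)"

definition prefix_dec :: "nat \<Rightarrow> nat \<Rightarrow> ('y list \<Rightarrow> nat) \<Rightarrow> (nat \<Rightarrow> nat)
    \<Rightarrow> (nat \<Rightarrow> nat \<Rightarrow> 'y list set) \<Rightarrow> nat \<Rightarrow> nat \<Rightarrow> 'y list set" where
  "prefix_dec l n dec f D _ k = {y \<in> seqs (l + n). drop l y \<in> D (f (dec (take l y))) k}"

context
  fixes W :: "'s::finite \<Rightarrow> 'x::finite \<Rightarrow> 'y::finite \<Rightarrow> real" and V :: "'s \<Rightarrow> 'x \<Rightarrow> 'z::finite \<Rightarrow> real"
    and n K \<Gamma> l L :: nat and e :: "nat \<Rightarrow> nat \<Rightarrow> 'x list \<Rightarrow> real" and D :: "nat \<Rightarrow> nat \<Rightarrow> 'y list set"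
    and c :: "nat \<Rightarrow> 'x list" and dec :: "'y list \<Rightarrow> nat" and \<epsilon> :: real and f :: "nat \<Rightarrow> nat"
  assumes W: "\<forall>s. channel (W s)" and V: "\<forall>s. channel (V s)"
    and code: "is_code n K \<Gamma> e D" and pre: "det_code W l L c dec \<epsilon>" and f: "\<And>i. f i < \<Gamma>"
begin

lemma pre_L: "0 < L"
  using pre unfolding det_code_def by (metis gr_zeroI not_less_zero)

lemma pre_c: "i < L \<Longrightarrow> c i \<in> seqs l"
  using pre by (simp add: det_code_def)

lemma K_pos: "0 < K"
  using is_codeD(1)[OF code] by simp

lemma sum_prefix_enc:
  "(\<Sum>x\<in>seqs (l + n). prefix_enc l n L c f e \<gamma> k x * g x)
     = (\<Sum>i<L. \<Sum>x\<in>seqs n. e (f i) k x * g (c i @ x)) / L" for g :: "'x list \<Rightarrow> real"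
proof -
  have "(\<Sum>x\<in>seqs (l + n). prefix_enc l n L c f e \<gamma> k x * g x)
      = (\<Sum>x1\<in>seqs l. \<Sum>x2\<in>seqs n. \<Sum>i<L. if x1 = c i then e (f i) k x2 * g (c i @ x2) / L else 0)"
    unfolding sum_seqs_append
  proof (intro sum.cong refl)
    fix x1 x2 :: "'x list" assume x: "x1 \<in> seqs l" "x2 \<in> seqs n"
    then have *: "x1 @ x2 \<in> seqs (l + n)" "take l (x1 @ x2) = x1" "drop l (x1 @ x2) = x2"
      by (auto simp: seqs_def)
    have "prefix_enc l n L c f e \<gamma> k (x1 @ x2) = (\<Sum>i<L. if x1 = c i then e (f i) k x2 else 0) / L"
      unfolding prefix_enc_def * if_P[OF *(1)] ..
    then show "prefix_enc l n L c f e \<gamma> k (x1 @ x2) * g (x1 @ x2)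
      = (\<Sum>i<L. if x1 = c i then e (f i) k x2 * g (c i @ x2) / L else 0)"
      by (simp only: sum_divide_distrib sum_distrib_right) (intro sum.cong; simp)
  qed
  also have "\<dots> = (\<Sum>i<L. \<Sum>x1\<in>seqs l. \<Sum>x2\<in>seqs n. if x1 = c i then e (f i) k x2 * g (c i @ x2) / L else 0)"
    by (simp only: sum.swap[where B = "{..<L}"])
  also have "\<dots> = (\<Sum>i<L. \<Sum>x2\<in>seqs n. \<Sum>x1\<in>seqs l. if x1 = c i then e (f i) k x2 * g (c i @ x2) / L else 0)"
    by (intro sum.cong refl sum.swap)
  also have "\<dots> = (\<Sum>i<L. \<Sum>x2\<in>seqs n. e (f i) k x2 * g (c i @ x2) / L)"
    using pre_c by (intro sum.cong refl) (simp add: sum.delta)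
  finally show ?thesis by (simp only: sum_divide_distrib)
qed

lemma is_code_prefix: "is_code (l + n) K 1 (prefix_enc l n L c f e) (prefix_dec l n dec f D)"
  unfolding is_code_def
proof (intro conjI allI impI)
  fix \<gamma> k assume k: "k < K"
  show "0 \<le> prefix_enc l n L c f e \<gamma> k x" for x
    unfolding prefix_enc_def using is_codeD(3)[OF code f k] by (auto intro!: sum_nonneg divide_nonneg_nonneg)
  show "x \<notin> seqs (l + n) \<Longrightarrow> prefix_enc l n L c f e \<gamma> k x = 0" for x
    by (simp add: prefix_enc_def)
  show "(\<Sum>x\<in>seqs (l + n). prefix_enc l n L c f e \<gamma> k x) = 1"
    using sum_prefix_enc[of \<gamma> k "\<lambda>_. 1"] is_codeD(4)[OF code f k] pre_L by simp
  show "prefix_dec l n dec f D \<gamma> k \<subseteq> seqs (l + n)"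
    by (auto simp: prefix_dec_def)
next
  fix \<gamma> k k' assume "k < K" "k' < K" "k \<noteq> k'"
  then show "prefix_dec l n dec f D \<gamma> k \<inter> prefix_dec l n dec f D \<gamma> k' = {}"
    using is_codeD(6)[OF code f] by (fastforce simp: prefix_dec_def)
qed (use K_pos in auto)

text \<open>Only outputs whose prefix is decoded correctly are counted; for these the rest meets the
  decoding sets that belong to its encoder.\<close>

lemma success_prefix:
  assumes s: "s1 \<in> seqs l" "s2 \<in> seqs n"
  shows "(\<Sum>i<L. success_at W n K e D s2 (f i)) / L - \<epsilon>
    \<le> success_at W (l + n) K (prefix_enc l n L c f e) (prefix_dec l n dec f D) (s1 @ s2) \<gamma>"
proof -
  define p where "p = (\<lambda>i. \<Sum>y\<in>{y \<in> seqs l. dec y = i}. prodch W s1 (c i) y)"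
  have p: "0 \<le> p i" "p i \<le> 1" for i
    unfolding p_def using s W by (intro sum_prodch_subset_le; auto simp: seqs_def)+
  have decode: "p i * (\<Sum>y\<in>D (f i) k. prodch W s2 x y) \<le> (\<Sum>y\<in>prefix_dec l n dec f D \<gamma> k. prodch W (s1 @ s2) (c i @ x) y)"
    if i: "i < L" and k: "k < K" for i k x
  proof -
    have Dk: "D (f i) k = {y \<in> seqs n. y \<in> D (f i) k}"
      using is_codeD(5)[OF code f k] by auto
    have "p i * (\<Sum>y\<in>D (f i) k. prodch W s2 x y) = (\<Sum>y1\<in>seqs l. \<Sum>y2\<in>seqs n.
        (if dec y1 = i then prodch W s1 (c i) y1 else 0) * (if y2 \<in> D (f i) k then prodch W s2 x y2 else 0))"
      unfolding p_def by (subst Dk) (simp only: sum.inter_filter finite_seqs sum_product)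
    also have "\<dots> \<le> (\<Sum>y1\<in>seqs l. \<Sum>y2\<in>seqs n. if y2 \<in> D (f (dec y1)) k
         then prodch W (s1 @ s2) (c i @ x) (y1 @ y2) else 0)"
    proof (intro sum_mono)
      fix y1 :: "'y list" and y2 :: "'y list" assume y: "y1 \<in> seqs l" "y2 \<in> seqs n"
      have "prodch W (s1 @ s2) (c i @ x) (y1 @ y2) = prodch W s1 (c i) y1 * prodch W s2 x y2"
        using s y pre_c[OF i] by (intro prodch_append) (auto simp: seqs_def)
      then show "(if dec y1 = i then prodch W s1 (c i) y1 else 0) * (if y2 \<in> D (f i) k then prodch W s2 x y2 else 0)
          \<le> (if y2 \<in> D (f (dec y1)) k then prodch W (s1 @ s2) (c i @ x) (y1 @ y2) else 0)"
        using prodch_nonneg[OF W] by auto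
    qed
    also have "\<dots> = (\<Sum>y\<in>seqs (l + n). if drop l y \<in> D (f (dec (take l y))) k
         then prodch W (s1 @ s2) (c i @ x) y else 0)"
      unfolding sum_seqs_append by (intro sum.cong refl) (auto simp: seqs_def)
    also have "\<dots> = (\<Sum>y\<in>prefix_dec l n dec f D \<gamma> k. prodch W (s1 @ s2) (c i @ x) y)"
      unfolding prefix_dec_def by (simp only: sum.inter_filter finite_seqs)
    finally show ?thesis .
  qed
  have "(\<Sum>i<L. p i * success_at W n K e D s2 (f i)) / L
      = (\<Sum>k<K. (\<Sum>i<L. \<Sum>x\<in>seqs n. e (f i) k x * (p i * (\<Sum>y\<in>D (f i) k. prodch W s2 x y))) / L) / K"
    unfolding success_at_def sum_distrib_left sum_divide_distrib
    by (subst sum.swap) (auto intro!: sum.cong simp: mult_ac)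
  also have "\<dots> \<le> (\<Sum>k<K. (\<Sum>i<L. \<Sum>x\<in>seqs n. e (f i) k x *
        (\<Sum>y\<in>prefix_dec l n dec f D \<gamma> k. prodch W (s1 @ s2) (c i @ x) y)) / L) / K"
    using is_codeD(3)[OF code f] by (intro divide_right_mono sum_mono mult_left_mono decode) auto
  also have "\<dots> = success_at W (l + n) K (prefix_enc l n L c f e) (prefix_dec l n dec f D) (s1 @ s2) \<gamma>"
    unfolding success_at_def sum_prefix_enc ..
  finally have le: "(\<Sum>i<L. p i * success_at W n K e D s2 (f i)) / L
      \<le> success_at W (l + n) K (prefix_enc l n L c f e) (prefix_dec l n dec f D) (s1 @ s2) \<gamma>" .
  have "L * (1 - \<epsilon>) \<le> (\<Sum>i<L. p i)"
    using pre s unfolding det_code_def p_def by blast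
  \<comment> \<open>Both \<open>p i\<close> and the success for \<open>f i\<close> vary with
    \<open>i\<close>, and only their averages are controlled. Nonnegativity of the product of the
    two failure probabilities linearizes the product of the successes, so averages suffice.\<close>
  then have "(\<Sum>i<L. success_at W n K e D s2 (f i)) - L * \<epsilon> \<le> (\<Sum>i<L. p i + success_at W n K e D s2 (f i) - 1)"
    by (simp add: sum.distrib sum_subtractf algebra_simps)
  also have "\<dots> \<le> (\<Sum>i<L. p i * success_at W n K e D s2 (f i))"
  proof (intro sum_mono)
    fix i
    have "0 \<le> (1 - p i) * (1 - success_at W n K e D s2 (f i))"
      using p success_at_bounds(2)[OF code W s(2) f] by (intro mult_nonneg_nonneg) auto
    then show "p i + success_at W n K e D s2 (f i) - 1 \<le> p i * success_at W n K e D s2 (f i)"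
      by (simp add: algebra_simps)
  qed
  finally have "((\<Sum>i<L. success_at W n K e D s2 (f i)) - L * \<epsilon>) / L \<le> (\<Sum>i<L. p i * success_at W n K e D s2 (f i)) / L"
    by (intro divide_right_mono) auto
  with le show ?thesis using pre_L by (simp add: diff_divide_distrib)
qed

lemma kernel_prefix:
  assumes s: "s1 \<in> seqs l" and z: "z1 \<in> seqs l"
  shows "kernel V (l + n) (prefix_enc l n L c f e) (s1 @ s2) \<gamma> k (z1 @ z2)
    = (\<Sum>i<L. prodch V s1 (c i) z1 * kernel V n e s2 (f i) k z2) / L"
proof -
  have "prodch V (s1 @ s2) (c i @ x) (z1 @ z2) = prodch V s1 (c i) z1 * prodch V s2 x z2" if "i < L" for i x
    using s z pre_c[OF that] by (intro prodch_append) (auto simp: seqs_def)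
  then show ?thesis
    unfolding kernel_def sum_prefix_enc sum_distrib_left
    by (intro arg_cong2[of _ _ _ _ "(/)"] sum.cong refl) (auto simp: mult_ac)
qed

text \<open>Revealing the prefix index to the eavesdropper can only help her, and the index is
  independent of the message.\<close>

lemma leak_prefix:
  assumes s: "s1 \<in> seqs l" "s2 \<in> seqs n"
  shows "leak_at V (l + n) K (prefix_enc l n L c f e) (s1 @ s2) 0 \<le> (\<Sum>i<L. leak_at V n K e s2 (f i)) / L"
proof -
  define P where "P = (\<lambda>i z. prodch V s1 (c i) z)"
  define Q where "Q = (\<lambda>i k z. kernel V n e s2 (f i) k z / K)"
  define R where "R = (\<lambda>i z. \<Sum>k<K. Q i k z)"
  let ?e = "prefix_enc l n L c f e"
  have ss: "s1 @ s2 \<in> seqs (l + n)" using s by (rule append_in_seqs)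
  have P0: "0 \<le> P i z" for i z by (simp add: P_def prodch_nonneg[OF V])
  have Q0: "0 \<le> Q i k z" if "k < K" for i k z
    using kernel_nonneg[OF code V f that] by (simp add: Q_def)
  have R0: "0 \<le> R i z" for i z unfolding R_def using Q0 by (intro sum_nonneg) auto
  have P1: "(\<Sum>z\<in>seqs l. P i z) = 1" for i
    unfolding P_def using s by (intro sum_prodch V) (simp add: seqs_def)
  have rowQ: "(\<Sum>z\<in>seqs n. Q i k z) = 1 / K" if "k < K" for i k
    using sum_kernel[OF code V f that s(2)] by (simp add: Q_def flip: sum_divide_distrib)
  have row: "(\<Sum>z\<in>seqs (l + n). kernel V (l + n) ?e (s1 @ s2) 0 k z / K) = 1 / K" if "k < K" for k
    using sum_kernel[OF is_code_prefix V zero_less_one that ss] by (simp flip: sum_divide_distrib)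
  have ker: "kernel V (l + n) ?e (s1 @ s2) 0 k (z1 @ z2) / K = (\<Sum>i<L. P i z1 * Q i k z2 / L)"
    if "z1 \<in> seqs l" for k z1 z2
    unfolding kernel_prefix[OF s(1) that] P_def Q_def by (simp add: sum_divide_distrib mult.commute)
  \<comment> \<open>The joint law and the product of marginals are both mixtures over
    \<open>i\<close> with the same prefix probabilities, which is the form for the log-sum
    inequality.\<close>
  have "leak_at V (l + n) K ?e (s1 @ s2) 0 = (\<Sum>k<K. \<Sum>z1\<in>seqs l. \<Sum>z2\<in>seqs n.
      (\<Sum>i<L. P i z1 * Q i k z2 / L) * log 2 ((\<Sum>i<L. P i z1 * Q i k z2 / L) / (\<Sum>i<L. P i z1 * R i z2 / (L * K))))"
    unfolding leak_at_def mutual_info_eq sum_seqs_append[where g = "\<lambda>z. _ z * log 2 (_ z)"]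
  proof (intro sum.cong refl)
    fix k and z1 z2 :: "'z list" assume k: "k \<in> {..<K}" and z: "z1 \<in> seqs l" "z2 \<in> seqs n"
    have "(\<Sum>k<K. kernel V (l + n) ?e (s1 @ s2) 0 k (z1 @ z2) / K) = (\<Sum>i<L. P i z1 * R i z2 / L)"
      unfolding ker[OF z(1)] R_def by (subst sum.swap) (simp add: sum_distrib_left sum_divide_distrib)
    then have "(\<Sum>z\<in>seqs (l + n). kernel V (l + n) ?e (s1 @ s2) 0 k z / K) *
        (\<Sum>k<K. kernel V (l + n) ?e (s1 @ s2) 0 k (z1 @ z2) / K) = (\<Sum>i<L. P i z1 * R i z2 / (L * K))"
      using row k by (simp add: sum_divide_distrib mult.commute)
    then show "kernel V (l + n) ?e (s1 @ s2) 0 k (z1 @ z2) / K *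
        log 2 (kernel V (l + n) ?e (s1 @ s2) 0 k (z1 @ z2) / K /
          ((\<Sum>z\<in>seqs (l + n). kernel V (l + n) ?e (s1 @ s2) 0 k z / K) *
           (\<Sum>k<K. kernel V (l + n) ?e (s1 @ s2) 0 k (z1 @ z2) / K)))
      = (\<Sum>i<L. P i z1 * Q i k z2 / L) * log 2 ((\<Sum>i<L. P i z1 * Q i k z2 / L) / (\<Sum>i<L. P i z1 * R i z2 / (L * K)))"
      by (simp only: ker[OF z(1)])
  qed
  also have "\<dots> \<le> (\<Sum>k<K. \<Sum>z1\<in>seqs l. \<Sum>z2\<in>seqs n. \<Sum>i<L.
      P i z1 * Q i k z2 / L * log 2 (P i z1 * Q i k z2 / L / (P i z1 * R i z2 / (L * K))))"
  proof (intro sum_mono log_sum_inequality)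
    fix k z1 z2 i assume k: "k \<in> {..<K}"
    show "0 \<le> P i z1 * Q i k z2 / L" "0 \<le> P i z1 * R i z2 / (L * K)"
      using P0 Q0 R0 k by auto
    show "P i z1 * Q i k z2 / L = 0" if "P i z1 * R i z2 / (L * K) = 0"
    proof -
      have "Q i k z2 \<le> R i z2"
        unfolding R_def using k Q0 by (intro member_le_sum) auto
      then show ?thesis using that Q0[of k i z2] k pre_L K_pos by auto
    qed
  qed auto
  \<comment> \<open>For fixed \<open>i\<close> the prefix probability cancels from the ratio: given
    the index, the prefix carries no information about the message.\<close>
  also have "\<dots> = (\<Sum>k<K. \<Sum>z1\<in>seqs l. \<Sum>z2\<in>seqs n. \<Sum>i<L.
      P i z1 * (Q i k z2 * log 2 (Q i k z2 / (1 / K * R i z2)) / L))"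
  proof (intro sum.cong refl)
    fix k z1 z2 i
    show "P i z1 * Q i k z2 / L * log 2 (P i z1 * Q i k z2 / L / (P i z1 * R i z2 / (L * K)))
      = P i z1 * (Q i k z2 * log 2 (Q i k z2 / (1 / K * R i z2)) / L)"
      using pre_L K_pos by (cases "P i z1 = 0") (auto simp: field_simps)
  qed
  also have "\<dots> = (\<Sum>k<K. \<Sum>z2\<in>seqs n. \<Sum>i<L. (\<Sum>z1\<in>seqs l. P i z1) * (Q i k z2 * log 2 (Q i k z2 / (1 / K * R i z2)) / L))"
    unfolding sum_distrib_right
    by (rule sum.cong[OF refl], subst sum.swap, rule sum.cong[OF refl], rule sum.swap)
  also have "\<dots> = (\<Sum>i<L. \<Sum>k<K. \<Sum>z2\<in>seqs n. Q i k z2 * log 2 (Q i k z2 / (1 / K * R i z2)) / L)"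
    unfolding P1 mult_1_left by (simp only: sum.swap[where B = "{..<L}"])
  also have "\<dots> = (\<Sum>i<L. leak_at V n K e s2 (f i)) / L"
    unfolding leak_at_def mutual_info_eq sum_divide_distrib
    using rowQ by (intro sum.cong refl) (simp add: Q_def R_def flip: sum_divide_distrib)
  finally show ?thesis .
qed

end

lemma ex_uncorrelated_code:
  fixes W :: "'s::finite \<Rightarrow> 'x::finite \<Rightarrow> 'y::finite \<Rightarrow> real" and V :: "'s \<Rightarrow> 'x \<Rightarrow> 'z::finite \<Rightarrow> real"
    and \<delta> B :: real
  assumes W: "\<forall>s. channel (W s)" and V: "\<forall>s. channel (V s)"
    and code: "is_code n K \<Gamma> e D" and pre: "det_code W l L c dec \<epsilon>"
    and \<delta>: "0 < \<delta>" "\<delta> \<le> 1" and B: "B \<ge> 1" "log 2 K \<le> B"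
    and L: "2 * real CARD('s) ^ n * exp (- (L * \<delta>\<^sup>2 / 4)) < 1"
  shows "\<exists>e' D'. is_code (l + n) K 1 e' D' \<and>
    code_error W (l + n) K 1 e' D' \<le> code_error W n K \<Gamma> e D + \<epsilon> + \<delta> \<and>
    code_leak V (l + n) K 1 e' \<le> code_leak V n K \<Gamma> e + B * \<delta>"
proof -
  \<comment> \<open>\<open>sample_average\<close> bounds functions with values in [0, 1] from above,
    so success enters as failure and leakage is divided by its bound \<open>B\<close>. The Boolean
    doubles the family, whence the factor 2 in the hypothesis on \<open>L\<close>.\<close>
  define g where "g = (\<lambda>(s, b) \<gamma>. if b then 1 - success_at W n K e D s \<gamma> else leak_at V n K e s \<gamma> / B)"
  have \<Gamma>: "\<Gamma> \<ge> 1" using is_codeD(2)[OF code] .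
  have g: "0 \<le> g p \<gamma> \<and> g p \<gamma> \<le> 1" if "p \<in> seqs n \<times> UNIV" "\<gamma> < \<Gamma>" for p \<gamma>
  proof -
    obtain s b where "p = (s, b)" by (cases p)
    with that have p: "p = (s, b)" "s \<in> seqs n" by simp_all
    show ?thesis
      using success_at_bounds[OF code W p(2) that(2)] leak_at_bounds[OF code V p(2) that(2)] B
      by (cases b) (auto simp: g_def p(1))
  qed
  have "card ((seqs n :: 's list set) \<times> (UNIV :: bool set)) = CARD('s) ^ n * 2"
    by (simp add: card_cartesian_product card_seqs)
  then have L': "card ((seqs n :: 's list set) \<times> (UNIV :: bool set)) * exp (- (L * \<delta>\<^sup>2 / 4)) < 1"
    using L by (simp add: mult.commute)
  obtain f where f: "\<And>i. f i < \<Gamma>"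
    "\<And>p. p \<in> seqs n \<times> UNIV \<Longrightarrow> (\<Sum>i<L. g p (f i)) \<le> L * ((\<Sum>\<gamma><\<Gamma>. g p \<gamma>) / \<Gamma> + \<delta>)"
  proof (rule sample_average[where g = g and F = "seqs n \<times> UNIV", OF _ \<Gamma> _ \<delta> L'])
    show "finite ((seqs n :: 's list set) \<times> (UNIV :: bool set))" by simp
  qed (use g in blast)+
  have L0: "L > 0" using pre_L[OF W V code pre f(1)] .
  have suc: "code_success W n K \<Gamma> e D s - \<delta> \<le> (\<Sum>i<L. success_at W n K e D s (f i)) / L" if "s \<in> seqs n" for s
  proof -
    have "(\<Sum>\<gamma><\<Gamma>. g (s, True) \<gamma>) / \<Gamma> = 1 - code_success W n K \<Gamma> e D s"
      using \<Gamma> by (simp add: g_def sum_subtractf code_success_eq diff_divide_distrib)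
    moreover have "(\<Sum>i<L. g (s, True) (f i)) = L - (\<Sum>i<L. success_at W n K e D s (f i))"
      by (simp add: g_def sum_subtractf)
    ultimately have "L - (\<Sum>i<L. success_at W n K e D s (f i)) \<le> L * (1 - code_success W n K \<Gamma> e D s + \<delta>)"
      using f(2)[of "(s, True)"] that by simp
    then have "(code_success W n K \<Gamma> e D s - \<delta>) * L \<le> (\<Sum>i<L. success_at W n K e D s (f i))"
      by (simp add: algebra_simps)
    then show ?thesis using L0 by (simp add: pos_le_divide_eq)
  qed
  have leak: "(\<Sum>i<L. leak_at V n K e s (f i)) / L \<le> (\<Sum>\<gamma><\<Gamma>. leak_at V n K e s \<gamma>) / \<Gamma> + B * \<delta>" if "s \<in> seqs n" for s
  proof -
    have "(\<Sum>i<L. leak_at V n K e s (f i)) / B \<le> L * ((\<Sum>\<gamma><\<Gamma>. leak_at V n K e s \<gamma>) / B / \<Gamma> + \<delta>)"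
      using f(2)[of "(s, False)"] that by (simp add: g_def flip: sum_divide_distrib)
    then have "(\<Sum>i<L. leak_at V n K e s (f i)) / B / L \<le> (\<Sum>\<gamma><\<Gamma>. leak_at V n K e s \<gamma>) / B / \<Gamma> + \<delta>"
      using L0 by (subst pos_divide_le_eq) (auto simp: mult.commute)
    then have "B * ((\<Sum>i<L. leak_at V n K e s (f i)) / B / L) \<le> B * ((\<Sum>\<gamma><\<Gamma>. leak_at V n K e s \<gamma>) / B / \<Gamma> + \<delta>)"
      using B by (intro mult_left_mono) auto
    then show ?thesis using B by (simp add: distrib_left)
  qed
  let ?e = "prefix_enc l n L c f e" and ?D = "prefix_dec l n dec f D"
  have code': "is_code (l + n) K 1 ?e ?D" by (rule is_code_prefix[OF W V code pre f(1)])
  have "code_error W (l + n) K 1 ?e ?D \<le> code_error W n K \<Gamma> e D + \<epsilon> + \<delta>"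
  proof -
    have "code_success W (l + n) K 1 ?e ?D s \<ge> Min (code_success W n K \<Gamma> e D ` seqs n) - \<epsilon> - \<delta>"
      if "s \<in> seqs (l + n)" for s
    proof -
      obtain s1 s2 where s: "s = s1 @ s2" "s1 \<in> seqs l" "s2 \<in> seqs n"
        using \<open>s \<in> seqs (l + n)\<close> by (rule seqs_append_cases)
      have "Min (code_success W n K \<Gamma> e D ` seqs n) \<le> code_success W n K \<Gamma> e D s2"
        using s by simp
      with suc[OF s(3)] success_prefix[where f = f and \<gamma> = 0, OF W V code pre f(1) s(2,3)]
      show ?thesis by (simp add: code_success_eq s(1))
    qed
    then have "Min (code_success W (l + n) K 1 ?e ?D ` seqs (l + n)) \<ge> Min (code_success W n K \<Gamma> e D ` seqs n) - \<epsilon> - \<delta>"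
      by (intro Min.boundedI) auto
    then show ?thesis unfolding code_error_def by linarith
  qed
  moreover have "code_leak V (l + n) K 1 ?e \<le> code_leak V n K \<Gamma> e + B * \<delta>"
  proof -
    have "cond_mutual_info (code_joint V (l + n) K 1 ?e s) {..<1} {..<K} (seqs (l + n)) \<le> code_leak V n K \<Gamma> e + B * \<delta>"
      if ss: "s \<in> seqs (l + n)" for s
    proof -
      obtain s1 s2 where s: "s = s1 @ s2" "s1 \<in> seqs l" "s2 \<in> seqs n"
        using \<open>s \<in> seqs (l + n)\<close> by (rule seqs_append_cases)
      have "cond_mutual_info (code_joint V n K \<Gamma> e s2) {..<\<Gamma>} {..<K} (seqs n) \<le> code_leak V n K \<Gamma> e"
        unfolding code_leak_def using s by (intro Max_ge) auto
      with leak[OF s(3)] leak_prefix[where f = f, OF W V code pre f(1) s(2,3)]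
      show ?thesis
        unfolding cond_mutual_info_code[OF code' V ss] cond_mutual_info_code[OF code V s(3)]
        by (simp add: s(1))
    qed
    then show ?thesis unfolding code_leak_def by (intro Max.boundedI) auto
  qed
  ultimately show ?thesis using code' by blast
qed

section \<open>The symmetrizable case\<close>

text \<open>For \<open>k \<noteq> k'\<close>, sending \<open>k\<close> while imitating
  \<open>k'\<close> and the reverse produce the same output law, so disjoint decoding sets leave the
  two successes a sum of at most 1. Only the \<open>K\<close> diagonal pairs escape this, and the
  average success is at most \<open>1 / 2 + 1 / (2 * K)\<close>.\<close>

lemma symmetrizable_error:
  fixes W :: "'s::finite \<Rightarrow> 'x::finite \<Rightarrow> 'y::finite \<Rightarrow> real"
  assumes W: "\<forall>s. channel (W s)" and "symmetrizable W" and code: "is_code n K 1 e D" and K: "K \<ge> 2"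
  shows "code_error W n K 1 e D \<ge> 1 / 4"
proof -
  obtain U :: "'x \<Rightarrow> 's \<Rightarrow> real" where U: "channel U"
    "\<And>x x' y. (\<Sum>s\<in>UNIV. U x s * W s x' y) = (\<Sum>s\<in>UNIV. U x' s * W s x y)"
    using assms(2) unfolding symmetrizable_def by blast
  \<comment> \<open>Output law when \<open>x\<close> is sent and the state is drawn letter by letter
    from \<open>x'\<close> through \<open>U\<close>.\<close>
  define Q where "Q = (\<lambda>x x' y. \<Prod>i<n. \<Sum>s\<in>UNIV. U (x' ! i) s * W s (x ! i) (y ! i))"
  have Q_sym: "Q x x' y = Q x' x y" for x x' y
    unfolding Q_def by (intro prod.cong refl U(2))
  define u where "u = (\<lambda>x' s. \<Prod>i<n. U (x' ! i) (s ! i))"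
  have u: "0 \<le> u x' s" "(\<Sum>s\<in>seqs n. u x' s) = 1" for x' s
    using U(1) sum_seqs_prod[of "\<lambda>i. U (x' ! i)" n]
    by (auto simp: u_def channel_nonneg channel_sum intro!: prod_nonneg)
  have Q_eq: "(\<Sum>s\<in>seqs n. u x' s * prodch W s x y) = Q x x' y" for x x' y
  proof -
    have "(\<Sum>s\<in>seqs n. u x' s * prodch W s x y) = (\<Sum>s\<in>seqs n. \<Prod>i<n. U (x' ! i) (s ! i) * W (s ! i) (x ! i) (y ! i))"
      by (intro sum.cong) (auto simp: u_def prodch_def seqs_def prod.distrib)
    also have "\<dots> = Q x x' y"
      unfolding Q_def by (rule sum_seqs_prod)
    finally show ?thesis .
  qed
  have Q0: "0 \<le> Q x x' y" for x x' y
    unfolding Q_eq[symmetric] by (intro sum_nonneg mult_nonneg_nonneg u prodch_nonneg[OF W])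
  have Q1: "(\<Sum>y\<in>A. Q x x' y) \<le> 1" if "A \<subseteq> seqs n" for A x x'
  proof -
    have "(\<Sum>y\<in>A. Q x x' y) \<le> (\<Sum>y\<in>seqs n. Q x x' y)"
      using that Q0 by (intro sum_mono2) auto
    also have "\<dots> = (\<Sum>s\<in>seqs n. u x' s * (\<Sum>y\<in>seqs n. prodch W s x y))"
      unfolding Q_eq[symmetric] by (subst sum.swap) (simp add: sum_distrib_left)
    also have "\<dots> = (\<Sum>s\<in>seqs n. u x' s * 1)"
      by (intro sum.cong refl arg_cong2[of _ _ _ _ "(*)"] sum_prodch W) (simp add: seqs_def)
    finally show ?thesis using u(2) by simp
  qed
  let ?e = "e 0" and ?D = "D 0"
  have e: "0 \<le> ?e k x" "(\<Sum>x\<in>seqs n. ?e k x) = 1" if "k < K" for k x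
    using is_codeD(3,4)[OF code zero_less_one that] by auto
  \<comment> \<open>Success probability when \<open>k\<close> is sent and the jammer imitates
    \<open>k'\<close>.\<close>
  define S where "S = (\<lambda>k k'. \<Sum>x\<in>seqs n. \<Sum>x'\<in>seqs n. ?e k x * ?e k' x' * (\<Sum>y\<in>?D k. Q x x' y))"
  have S_swap: "S k k' = (\<Sum>x\<in>seqs n. \<Sum>x'\<in>seqs n. ?e k' x * ?e k x' * (\<Sum>y\<in>?D k. Q x x' y))" for k k'
    unfolding S_def by (subst sum.swap) (simp add: Q_sym mult.commute)
  have total: "(\<Sum>x\<in>seqs n. \<Sum>x'\<in>seqs n. ?e k x * ?e k' x') = 1" if "k < K" "k' < K" for k k'
    using e(2)[OF that(1)] e(2)[OF that(2)] by (simp flip: sum_product)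
  have S_pair: "S k k' + S k' k \<le> 1 + of_bool (k = k')" if k: "k < K" "k' < K" for k k'
  proof (cases "k = k'")
    case True
    have "S k k \<le> (\<Sum>x\<in>seqs n. \<Sum>x'\<in>seqs n. ?e k x * ?e k x' * 1)"
      unfolding S_def using e(1)[OF k(1)] is_codeD(5)[OF code zero_less_one k(1)]
      by (intro sum_mono mult_left_mono Q1 mult_nonneg_nonneg) auto
    then show ?thesis using True total[OF k(1) k(1)] by simp
  next
    case False
    have fin: "finite (?D k)" "finite (?D k')"
      using is_codeD(5)[OF code zero_less_one] k by (auto intro: finite_subset[OF _ finite_seqs])
    have "S k k' + S k' k = (\<Sum>x\<in>seqs n. \<Sum>x'\<in>seqs n. ?e k x * ?e k' x' * (\<Sum>y\<in>?D k \<union> ?D k'. Q x x' y))"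
      unfolding S_swap[of k' k] unfolding S_def sum.distrib[symmetric]
      using is_codeD(6)[OF code zero_less_one k False]
      by (intro sum.cong refl) (simp add: sum.union_disjoint[OF fin] distrib_left)
    also have "\<dots> \<le> (\<Sum>x\<in>seqs n. \<Sum>x'\<in>seqs n. ?e k x * ?e k' x' * 1)"
      using e(1)[OF k(1)] e(1)[OF k(2)] is_codeD(5)[OF code zero_less_one] k
      by (intro sum_mono mult_left_mono Q1 mult_nonneg_nonneg) auto
    finally show ?thesis using total[OF k] False by simp
  qed
  \<comment> \<open>The jammer's law of state words: a uniform message, the code's own stochastic
    encoder, then \<open>U\<close>. The worst state word is at least as harmful as the average under
    this law.\<close>
  define pr where "pr = (\<lambda>s. (\<Sum>k'<K. \<Sum>x'\<in>seqs n. ?e k' x' * u x' s) / K)"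
  have pr0: "0 \<le> pr s" for s
    unfolding pr_def using e(1) u(1) by (intro divide_nonneg_nonneg sum_nonneg mult_nonneg_nonneg) auto
  have pr1: "(\<Sum>s\<in>seqs n. pr s) = 1"
  proof -
    have "(\<Sum>s\<in>seqs n. pr s) = (\<Sum>k'<K. \<Sum>x'\<in>seqs n. \<Sum>s\<in>seqs n. ?e k' x' * u x' s) / K"
      unfolding pr_def sum_divide_distrib[symmetric]
      by (subst sum.swap, subst sum.swap[where A = "seqs n" and B = "seqs n"]) (rule refl)
    then show ?thesis using u(2) e(2) K by (simp flip: sum_distrib_left)
  qed
  let ?m = "Min (code_success W n K 1 e D ` seqs n)"
  have "?m = (\<Sum>s\<in>seqs n. pr s * ?m)"
    using pr1 by (simp flip: sum_distrib_right)
  also have "\<dots> \<le> (\<Sum>s\<in>seqs n. pr s * code_success W n K 1 e D s)"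
    using pr0 by (intro sum_mono mult_left_mono) auto
  also have "\<dots> = (\<Sum>k<K. \<Sum>k'<K. S k k') / K\<^sup>2"
  proof -
    \<comment> \<open>Message and word are merged into one index, so that the sum over states has
      only two sums to pass.\<close>
    have cp: "(\<Sum>p\<in>{..<K} \<times> seqs n. F (fst p) (snd p)) = (\<Sum>k<K. \<Sum>x\<in>seqs n. F k x)"
      for F :: "nat \<Rightarrow> 'x list \<Rightarrow> real"
      by (simp add: sum.cartesian_product case_prod_beta)
    have "(\<Sum>s\<in>seqs n. pr s * code_success W n K 1 e D s)
      = (\<Sum>s\<in>seqs n. (\<Sum>k'<K. \<Sum>x'\<in>seqs n. ?e k' x' * u x' s) *
           (\<Sum>k<K. \<Sum>x\<in>seqs n. ?e k x * (\<Sum>y\<in>?D k. prodch W s x y))) / K\<^sup>2"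
      unfolding pr_def code_success_def by (simp add: power2_eq_square flip: sum_divide_distrib)
    also have "(\<Sum>s\<in>seqs n. (\<Sum>k'<K. \<Sum>x'\<in>seqs n. ?e k' x' * u x' s) *
           (\<Sum>k<K. \<Sum>x\<in>seqs n. ?e k x * (\<Sum>y\<in>?D k. prodch W s x y)))
      = (\<Sum>s\<in>seqs n. \<Sum>p\<in>{..<K} \<times> seqs n. \<Sum>p'\<in>{..<K} \<times> seqs n.
           ?e (fst p) (snd p) * ?e (fst p') (snd p') * (\<Sum>y\<in>?D (fst p). u (snd p') s * prodch W s (snd p) y))"
    proof (rule sum.cong[OF refl])
      fix s
      show "(\<Sum>k'<K. \<Sum>x'\<in>seqs n. ?e k' x' * u x' s) *
           (\<Sum>k<K. \<Sum>x\<in>seqs n. ?e k x * (\<Sum>y\<in>?D k. prodch W s x y))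
        = (\<Sum>p\<in>{..<K} \<times> seqs n. \<Sum>p'\<in>{..<K} \<times> seqs n.
           ?e (fst p) (snd p) * ?e (fst p') (snd p') * (\<Sum>y\<in>?D (fst p). u (snd p') s * prodch W s (snd p) y))"
        unfolding cp[of "\<lambda>k' x'. ?e k' x' * u x' s", symmetric]
          cp[of "\<lambda>k x. ?e k x * (\<Sum>y\<in>?D k. prodch W s x y)", symmetric]
        by (subst mult.commute) (simp add: sum_product sum_distrib_left mult_ac)
    qed
    also have "\<dots> = (\<Sum>p\<in>{..<K} \<times> seqs n. \<Sum>p'\<in>{..<K} \<times> seqs n.
           \<Sum>s\<in>seqs n. ?e (fst p) (snd p) * ?e (fst p') (snd p') * (\<Sum>y\<in>?D (fst p). u (snd p') s * prodch W s (snd p) y))"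
      by (subst sum.swap, rule sum.cong[OF refl], rule sum.swap)
    also have "\<dots> = (\<Sum>p\<in>{..<K} \<times> seqs n. \<Sum>p'\<in>{..<K} \<times> seqs n.
           ?e (fst p) (snd p) * ?e (fst p') (snd p') * (\<Sum>y\<in>?D (fst p). Q (snd p) (snd p') y))"
    proof -
      have "(\<Sum>s\<in>seqs n. a * (\<Sum>y\<in>A. g s y)) = a * (\<Sum>y\<in>A. \<Sum>s\<in>seqs n. g s y)"
        for a :: real and A :: "'y list set" and g :: "'s list \<Rightarrow> 'y list \<Rightarrow> real"
        by (subst sum.swap) (rule sum_distrib_left[symmetric])
      then show ?thesis
        unfolding Q_eq[symmetric] by (intro sum.cong refl)
    qed
    also have "\<dots> = (\<Sum>k<K. \<Sum>x\<in>seqs n. \<Sum>k'<K. \<Sum>x'\<in>seqs n. ?e k x * ?e k' x' * (\<Sum>y\<in>?D k. Q x x' y))"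
      unfolding cp[of "\<lambda>k x. \<Sum>k'<K. \<Sum>x'\<in>seqs n. ?e k x * ?e k' x' * (\<Sum>y\<in>?D k. Q x x' y)", symmetric]
      by (intro sum.cong refl cp[of "\<lambda>k' x'. ?e (fst _) (snd _) * ?e k' x' * (\<Sum>y\<in>?D (fst _). Q (snd _) x' y)"])
    also have "\<dots> = (\<Sum>k<K. \<Sum>k'<K. S k k')"
      unfolding S_def by (rule sum.cong[OF refl], rule sum.swap)
    finally show ?thesis .
  qed
  also have "\<dots> \<le> ((real K)\<^sup>2 + K) / 2 / K\<^sup>2"
  proof -
    have "2 * (\<Sum>k<K. \<Sum>k'<K. S k k') = (\<Sum>k<K. \<Sum>k'<K. S k k' + S k' k)"
      using sum.swap[of "\<lambda>k k'. S k k'" "{..<K}" "{..<K}"] by (simp add: sum.distrib)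
    also have "\<dots> \<le> (\<Sum>k<K. \<Sum>k'<K. 1 + of_bool (k = k'))"
      by (intro sum_mono S_pair) auto
    also have "\<dots> = (real K)\<^sup>2 + K"
      by (simp add: sum.distrib of_bool_def power2_eq_square distrib_left)
    finally show ?thesis by (intro divide_right_mono) auto
  qed
  also have "\<dots> = 1 / 2 + 1 / (2 * K)"
    using K by (simp add: field_simps power2_eq_square)
  also have "\<dots> \<le> 3 / 4"
    using K by (simp add: field_simps)
  finally show ?thesis by (simp add: code_error_def)
qed

section \<open>Capacities\<close>

text \<open>A single message is always decoded and has nothing to leak. Besides rate 0 this supplies
  the blocklengths at which no derandomized code is guaranteed.\<close>

lemma ex_trivial_code:
  fixes W :: "'s::finite \<Rightarrow> 'x::finite \<Rightarrow> 'y::finite \<Rightarrow> real" and V :: "'s \<Rightarrow> 'x \<Rightarrow> 'z::finite \<Rightarrow> real"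
  assumes W: "\<forall>s. channel (W s)" and V: "\<forall>s. channel (V s)"
  shows "\<exists>e D. is_code n 1 1 e D \<and> code_error W n 1 1 e D = 0 \<and> code_leak V n 1 1 e = 0"
proof -
  define e :: "nat \<Rightarrow> nat \<Rightarrow> 'x list \<Rightarrow> real" where "e = (\<lambda>_ _ x. if x = replicate n undefined then 1 else 0)"
  define D :: "nat \<Rightarrow> nat \<Rightarrow> 'y list set" where "D = (\<lambda>_ _. seqs n)"
  have mem: "replicate n undefined \<in> (seqs n :: 'x list set)" by (simp add: seqs_def)
  have code: "is_code n 1 1 e D"
    using mem by (auto simp: is_code_def e_def D_def sum.delta)
  have "code_success W n 1 1 e D s = 1" if "s \<in> seqs n" for s
    using mem sum_prodch[OF W length_seqs[OF that]] by (simp add: code_success_def e_def D_def)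
  then have "code_success W n 1 1 e D ` seqs n = (\<lambda>_. 1) ` (seqs n :: 's list set)"
    by (intro image_cong) auto
  then have "code_error W n 1 1 e D = 0"
    by (simp add: code_error_def image_constant_conv)
  moreover have "cond_mutual_info (code_joint V n 1 1 e s) {..<1} {..<1} (seqs n) = 0" if "s \<in> seqs n" for s
    using leak_at_bounds[OF code V that, of 0] cond_mutual_info_code[OF code V that] by simp
  then have "(\<lambda>s. cond_mutual_info (code_joint V n 1 1 e s) {..<1} {..<1} (seqs n)) ` seqs n = (\<lambda>_. 0) ` (seqs n :: 's list set)"
    by (intro image_cong) auto
  then have "code_leak V n 1 1 e = 0"
    by (simp add: code_leak_def image_constant_conv)
  ultimately show ?thesis using code by blast
qed

lemma achievable_zero:
  fixes W :: "'s::finite \<Rightarrow> 'x::finite \<Rightarrow> 'y::finite \<Rightarrow> real" and V :: "'s \<Rightarrow> 'x \<Rightarrow> 'z::finite \<Rightarrow> real"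
  assumes W: "\<forall>s. channel (W s)" and V: "\<forall>s. channel (V s)"
  shows "achievable_mean_ran W V True 0"
proof -
  have "\<forall>n. \<exists>e D. is_code n 1 1 e D \<and> code_error W n 1 1 e D = 0 \<and> code_leak V n 1 1 e = 0"
    using ex_trivial_code[OF W V] by blast
  then obtain e D where eD: "\<And>n. is_code n 1 1 (e n) (D n) \<and> code_error W n 1 1 (e n) (D n) = 0 \<and> code_leak V n 1 1 (e n) = 0"
    by metis
  show ?thesis
    unfolding achievable_mean_ran_def
  proof (intro exI conjI allI impI)
    show "is_code n ((\<lambda>_. 1) n) ((\<lambda>_. 1) n) (e n) (D n)" for n using eD by simp
    show "liminf (\<lambda>n. ereal (log 2 (real ((\<lambda>_. 1) n)) / real n)) = ereal 0"
      by (simp add: Liminf_const zero_ereal_def[symmetric])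
    show "limsup (\<lambda>n. ereal (code_leak V n ((\<lambda>_. 1) n) ((\<lambda>_. 1) n) (e n))) = 0"
      using eD by (simp add: Limsup_const zero_ereal_def[symmetric])
  qed (use eD in auto)
qed

text \<open>The slack 1 absorbs the term \<open>1 / n\<close> of \<open>card_messages_le\<close>;
  the bound serves only to show that rates are finite and bounded.\<close>

lemma liminf_rate_le:
  fixes W :: "'s::finite \<Rightarrow> 'x::finite \<Rightarrow> 'y::finite \<Rightarrow> real"
  assumes W: "\<forall>s. channel (W s)" and code: "\<And>n. is_code n (K n) (\<Gamma> n) (e n) (D n)"
    and err: "(\<lambda>n. code_error W n (K n) (\<Gamma> n) (e n) (D n)) \<longlonglongrightarrow> 0"
  shows "liminf (\<lambda>n. ereal (log 2 (real (K n)) / real n)) \<le> ereal (1 + log 2 CARD('y))"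
proof -
  have "\<forall>\<^sub>F n in sequentially. code_error W n (K n) (\<Gamma> n) (e n) (D n) < 1 / 2"
    using order_tendstoD(2)[OF err, of "1 / 2"] by simp
  then have "\<forall>\<^sub>F n in sequentially. ereal (log 2 (K n) / n) \<le> ereal (1 + log 2 CARD('y))"
    using eventually_gt_at_top[of 0]
  proof eventually_elim
    case (elim n)
    have "log 2 (K n) \<le> 1 + n * log 2 CARD('y)"
      using elim by (intro card_messages_le[OF code W]) auto
    also have "\<dots> \<le> n + n * log 2 CARD('y)"
      using elim by simp
    finally show ?case using elim by (simp add: divide_le_eq distrib_left mult.commute)
  qed
  then have "limsup (\<lambda>n. ereal (log 2 (K n) / n)) \<le> ereal (1 + log 2 CARD('y))"
    by (rule Limsup_bounded)
  moreover have "liminf (\<lambda>n. ereal (log 2 (K n) / n)) \<le> limsup (\<lambda>n. ereal (log 2 (K n) / n))"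
    by (rule Liminf_le_Limsup) simp
  ultimately show ?thesis
    by (rule order_trans[rotated])
qed

lemma achievable_bounds:
  fixes W :: "'s::finite \<Rightarrow> 'x::finite \<Rightarrow> 'y::finite \<Rightarrow> real" and V :: "'s \<Rightarrow> 'x \<Rightarrow> 'z::finite \<Rightarrow> real"
  assumes W: "\<forall>s. channel (W s)" and "achievable_mean_ran W V b R"
  shows "0 \<le> R" "R \<le> 1 + log 2 CARD('y)"
proof -
  obtain K \<Gamma> e D where code: "\<And>n. is_code n (K n) (\<Gamma> n) (e n) (D n)"
    and err: "(\<lambda>n. code_error W n (K n) (\<Gamma> n) (e n) (D n)) \<longlonglongrightarrow> 0"
    and rate: "liminf (\<lambda>n. ereal (log 2 (real (K n)) / real n)) = ereal R"
    using assms(2) unfolding achievable_mean_ran_def by blast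
  have "0 \<le> ereal (log 2 (K n) / n)" for n
    using is_codeD(1)[OF code, of n] by simp
  then have "0 \<le> ereal R"
    unfolding rate[symmetric] by (intro Liminf_bounded always_eventually) auto
  then show "0 \<le> R" by simp
  show "R \<le> 1 + log 2 CARD('y)"
    using liminf_rate_le[OF W code err] rate by simp
qed

text \<open>A positive liminf forces at least two messages at all large blocklengths, where the
  error then stays above 1/4.\<close>

lemma symmetrizable_achievable:
  fixes W :: "'s::finite \<Rightarrow> 'x::finite \<Rightarrow> 'y::finite \<Rightarrow> real" and V :: "'s \<Rightarrow> 'x \<Rightarrow> 'z::finite \<Rightarrow> real"
  assumes W: "\<forall>s. channel (W s)" and sym: "symmetrizable W" and "achievable_mean_ran W V True R"
  shows "R = 0"
proof (rule ccontr)
  assume "R \<noteq> 0"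
  with achievable_bounds(1)[OF W assms(3)] have "R > 0" by simp
  obtain K \<Gamma> e D where code: "\<And>n. is_code n (K n) (\<Gamma> n) (e n) (D n)" and \<Gamma>: "\<And>n. \<Gamma> n = 1"
    and err: "(\<lambda>n. code_error W n (K n) (\<Gamma> n) (e n) (D n)) \<longlonglongrightarrow> 0"
    and rate: "liminf (\<lambda>n. ereal (log 2 (real (K n)) / real n)) = ereal R"
    using assms(3) unfolding achievable_mean_ran_def by blast
  have "\<forall>\<^sub>F n in sequentially. ereal 0 < ereal (log 2 (K n) / n)"
    using less_LiminfD[of "ereal 0" sequentially "\<lambda>n. ereal (log 2 (real (K n)) / real n)"] rate \<open>R > 0\<close> by simp
  moreover have "\<forall>\<^sub>F n in sequentially. code_error W n (K n) (\<Gamma> n) (e n) (D n) < 1 / 4"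
    using order_tendstoD(2)[OF err, of "1 / 4"] by simp
  ultimately have "\<forall>\<^sub>F n in sequentially. False"
  proof eventually_elim
    case (elim n)
    have "K n \<noteq> 1" using elim by auto
    with is_codeD(1)[OF code, of n] have "K n \<ge> 2" by simp
    from symmetrizable_error[OF W sym code[of n, unfolded \<Gamma>] this] elim \<Gamma>
    show False by simp
  qed
  then show False by simp
qed

lemma ex_prefix_family:
  fixes W :: "'s::finite \<Rightarrow> 'x::finite \<Rightarrow> 'y::finite \<Rightarrow> real"
  assumes W: "\<forall>s. channel (W s)" and nonsym: "\<not> symmetrizable W"
  obtains l L :: "nat \<Rightarrow> nat" and \<epsilon> :: "nat \<Rightarrow> real"
  where "\<epsilon> \<longlonglongrightarrow> 0" "(\<lambda>n. l n / n) \<longlonglongrightarrow> 0"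
    "\<forall>\<^sub>F n in sequentially. n ^ 6 \<le> L n \<and> (\<exists>c dec. det_code W (l n) (L n) c dec (\<epsilon> n))"
proof -
  obtain C where C: "C \<ge> 0" "\<And>N. N \<ge> 1 \<Longrightarrow> \<exists>c dec. det_code W (CARD('x) ^ N) N c dec (C / N)"
    using ex_det_code[OF W nonsym] by blast
  define q where "q = real CARD('x)"
  have q: "q \<ge> 2" using card_input_ge_2[OF nonsym] by (simp add: q_def)
  \<comment> \<open>Half of the logarithm gives
    \<open>q ^ (2 * N n) \<le> n \<le> q ^ (2 * (N n + 1))\<close> for large \<open>n\<close>: a
    block of length \<open>q ^ N n\<close> takes at most the square root of \<open>n\<close> letters
    and leaves room for many blocks.\<close>
  define N where "N = (\<lambda>n::nat. nat \<lfloor>log q n / 2\<rfloor>)"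
  \<comment> \<open>Enough blocks for \<open>N ^ b \<ge> q ^ (12 * (N + 1))\<close>. The 12 is 6
    times 2: as \<open>n \<le> q ^ (2 * (N + 1))\<close>, this reaches \<open>n ^ 6\<close>.\<close>
  define b where "b = (\<lambda>N. nat \<lceil>12 * (real N + 1) * ln q / ln N\<rceil>)"
  define l where "l = (\<lambda>n. b (N n) * CARD('x) ^ N n)"
  define L where "L = (\<lambda>n. N n ^ b (N n))"
  define \<epsilon> where "\<epsilon> = (\<lambda>n. b (N n) * (C / N n))"
  have N_top: "filterlim N at_top sequentially"
  proof -
    have "filterlim (\<lambda>n. log q (real n)) at_top sequentially"
    proof -
      have "filterlim (\<lambda>n. ln (real n)) at_top sequentially"
        by (rule filterlim_compose[OF ln_at_top filterlim_real_sequentially])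
      then have "filterlim (\<lambda>n. 1 / ln q * ln (real n)) at_top sequentially"
        by (rule filterlim_tendsto_pos_mult_at_top[OF tendsto_const, rotated]) (use q in auto)
      then show ?thesis by (simp add: log_def)
    qed
    then have "filterlim (\<lambda>n. 1 / 2 * log q (real n)) at_top sequentially"
      by (rule filterlim_tendsto_pos_mult_at_top[OF tendsto_const, rotated]) auto
    then have "filterlim (\<lambda>n. log q (real n) / 2) at_top sequentially"
      by simp
    then show ?thesis
      unfolding N_def
      by (intro filterlim_compose[OF filterlim_nat_sequentially] filterlim_compose[OF filterlim_floor_sequentially])
  qed
  \<comment> \<open>Used twice: for the accumulated error \<open>b * (C / N)\<close>, and, since
    \<open>N \<le> q ^ N\<close>, for the length ratio \<open>l n / n\<close>, which is at most
    \<open>b / q ^ N\<close>.\<close>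
  have ratio: "(\<lambda>N. real (b N) / N) \<longlonglongrightarrow> 0"
  proof (rule tendsto_sandwich[OF _ _ tendsto_const])
    show "(\<lambda>N. 24 * ln q / ln (real N) + 1 / real N) \<longlonglongrightarrow> 0"
    proof -
      have "(\<lambda>N. 24 * ln q / ln (real N)) \<longlonglongrightarrow> 0"
        by (intro tendsto_divide_0[OF tendsto_const] filterlim_at_top_imp_at_infinity
            filterlim_compose[OF ln_at_top filterlim_real_sequentially])
      from tendsto_add[OF this lim_1_over_n] show ?thesis by simp
    qed
    show "\<forall>\<^sub>F N in sequentially. real (b N) / N \<le> 24 * ln q / ln (real N) + 1 / real N"
      using eventually_ge_at_top[of 2]
    proof eventually_elim
      case (elim N)
      then have lnN: "ln N > 0" by simp
      have "real (b N) \<le> 12 * (real N + 1) * ln q / ln N + 1"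
        unfolding b_def using lnN q by (simp add: of_nat_nat ceiling_le_iff)
      also have "\<dots> \<le> 12 * (2 * real N) * ln q / ln N + 1"
        using lnN q elim by (intro add_right_mono divide_right_mono mult_right_mono mult_left_mono) auto
      also have "\<dots> = (24 * ln q / ln N + 1 / N) * N"
        using elim by (simp add: distrib_right)
      finally show ?case using elim by (simp add: divide_le_eq)
    qed
  qed auto
  have large: "\<forall>\<^sub>F n in sequentially. N n \<ge> 2 \<and> n \<ge> 1 \<and> q ^ (2 * N n) \<le> n \<and> n \<le> q ^ (2 * (N n + 1))"
  proof -
    have "\<forall>\<^sub>F n in sequentially. N n \<ge> 2"
      using N_top by (simp add: filterlim_at_top)
    then show ?thesis
      using eventually_ge_at_top[of 1]
    proof eventually_elim
      case (elim n)
      have "log q n / 2 \<ge> 0" using elim q by simp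
      then have "real (N n) = of_int \<lfloor>log q n / 2\<rfloor>"
        unfolding N_def by (simp add: of_nat_nat)
      then have NN: "real (N n) \<le> log q n / 2" "log q n / 2 < real (N n) + 1"
        using floor_correct[of "log q n / 2"] by auto
      have "q powr (2 * N n) \<le> n"
        using NN(1) elim q by (subst le_log_iff[symmetric]) auto
      moreover have "n \<le> q powr (2 * (N n + 1))"
        using NN(2) elim q by (subst log_le_iff[symmetric]) auto
      ultimately show ?case
        using elim q powr_realpow[of q "2 * N n"] powr_realpow[of q "2 * (N n + 1)"] by simp
    qed
  qed
  show thesis
  proof (rule that)
    have "(\<lambda>n. C * (real (b (N n)) / N n)) \<longlonglongrightarrow> C * 0"
      by (intro tendsto_mult tendsto_const filterlim_compose[OF ratio N_top])
    then show "\<epsilon> \<longlonglongrightarrow> 0" by (simp add: \<epsilon>_def mult_ac)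
    show "(\<lambda>n. l n / n) \<longlonglongrightarrow> 0"
    proof (rule tendsto_sandwich[OF _ _ tendsto_const filterlim_compose[OF ratio N_top]])
      show "\<forall>\<^sub>F n in sequentially. l n / n \<le> real (b (N n)) / N n"
        using large
      proof eventually_elim
        case (elim n)
        have "real (N n) < 2 ^ N n" by (rule of_nat_less_two_power)
        also have "\<dots> \<le> q ^ N n" using q by (intro power_mono) auto
        finally have Nq: "real (N n) \<le> q ^ N n" by simp
        have "l n / n \<le> l n / q ^ (2 * N n)"
          using elim q by (intro divide_left_mono) auto
        also have "\<dots> = b (N n) / q ^ N n"
          using q by (simp add: l_def q_def mult_2 power_add)
        also have "\<dots> \<le> b (N n) / N n"
          using Nq elim q by (intro divide_left_mono) auto
        finally show ?case .
      qed
    qed auto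
    show "\<forall>\<^sub>F n in sequentially. n ^ 6 \<le> L n \<and> (\<exists>c dec. det_code W (l n) (L n) c dec (\<epsilon> n))"
      using large
    proof eventually_elim
      case (elim n)
      have lnN: "ln (N n) > 0" using elim by simp
      have "real n ^ 6 \<le> (q ^ (2 * (N n + 1))) ^ 6"
        using elim by (intro power_mono) auto
      also have "\<dots> = exp (12 * (real (N n) + 1) * ln q)"
      proof -
        have "(q ^ (2 * (N n + 1))) ^ 6 = q ^ (2 * (N n + 1) * 6)"
          by (rule power_mult[symmetric])
        also have "2 * (N n + 1) * 6 = 12 * (N n + 1)" by simp
        also have "q ^ (12 * (N n + 1)) = exp (ln q) ^ (12 * (N n + 1))"
          using q by simp
        finally show ?thesis by (simp add: exp_of_nat_mult[symmetric] algebra_simps)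
      qed
      also have "\<dots> \<le> exp (b (N n) * ln (N n))"
      proof -
        have "12 * (real (N n) + 1) * ln q / ln (N n) \<le> b (N n)"
          unfolding b_def by (rule real_nat_ceiling_ge)
        then show ?thesis using lnN by (simp add: divide_le_eq)
      qed
      also have "\<dots> = real (L n)"
        using elim by (simp add: L_def exp_of_nat_mult)
      finally have "n ^ 6 \<le> L n" by (metis of_nat_le_iff of_nat_power)
      moreover have "\<exists>c dec. det_code W (l n) (L n) c dec (\<epsilon> n)"
      proof -
        obtain c dec where "det_code W (CARD('x) ^ N n) (N n) c dec (C / N n)"
          using C(2)[of "N n"] elim by auto
        from det_code_power[OF W this, of "b (N n)"] show ?thesis
          by (simp add: l_def L_def \<epsilon>_def)
      qed
      ultimately show ?case ..
    qed
  qed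
qed

section \<open>Transfer of achievable rates to uncorrelated codes\<close>

lemma tendsto_of_limsup_zero:
  fixes f :: "nat \<Rightarrow> real"
  assumes "\<And>n. 0 \<le> f n" "limsup (\<lambda>n. ereal (f n)) = 0"
  shows "f \<longlonglongrightarrow> 0"
proof -
  have "0 \<le> liminf (\<lambda>n. ereal (f n))"
    using assms(1) by (intro Liminf_bounded always_eventually) auto
  moreover have "liminf (\<lambda>n. ereal (f n)) \<le> limsup (\<lambda>n. ereal (f n))"
    by (rule Liminf_le_Limsup) simp
  ultimately have "(\<lambda>n. ereal (f n)) \<longlonglongrightarrow> 0"
    using assms(2) by (intro Liminf_eq_Limsup) auto
  then show ?thesis by (simp add: zero_ereal_def)
qed

text \<open>Blocklength \<open>n\<close> inherits the messages of length \<open>n - l n\<close>;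
  normalizing by \<open>n\<close> costs the factor \<open>1 - l n / n\<close>, which tends to 1.
  Only an inequality results, since the lengths \<open>n - l n\<close> may skip some blocklengths
  and so raise the liminf.\<close>

lemma rate_after_prefix:
  fixes K l :: "nat \<Rightarrow> nat"
  assumes K: "\<And>n. K n \<ge> 1" and l: "(\<lambda>n. l n / n) \<longlonglongrightarrow> 0" "\<forall>\<^sub>F n in sequentially. l n \<le> n"
    and top: "filterlim (\<lambda>n. n - l n) at_top sequentially"
    and K': "\<forall>\<^sub>F n in sequentially. K' n = K (n - l n)" "\<And>n. K' n \<ge> 1"
    and R: "liminf (\<lambda>n. ereal (log 2 (real (K n)) / real n)) = ereal R"
  shows "ereal R \<le> liminf (\<lambda>n. ereal (log 2 (real (K' n)) / real n))"
  unfolding le_Liminf_iff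
proof (intro allI impI)
  fix y assume y: "y < ereal R"
  show "\<forall>\<^sub>F n in sequentially. y < ereal (log 2 (real (K' n)) / real n)"
  proof (cases "y < 0")
    case True
    have "0 \<le> ereal (log 2 (real (K' n)) / real n)" for n
      using K'(2)[of n] by simp
    with True show ?thesis by (intro always_eventually allI) (rule less_le_trans)
  next
    case False
    then obtain y' where y': "y = ereal y'" "0 \<le> y'" "y' < R"
      using y by (cases y) auto
    obtain z where z: "y' < z" "z < R" using y'(3) dense by blast
    have "\<forall>\<^sub>F n in sequentially. ereal z < ereal (log 2 (real (K n)) / real n)"
      using less_LiminfD[of "ereal z" sequentially "\<lambda>n. ereal (log 2 (real (K n)) / real n)"] R z by simp
    then have "\<forall>\<^sub>F n in sequentially. ereal z < ereal (log 2 (real (K (n - l n))) / real (n - l n))"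
      using top unfolding filterlim_iff by blast
    moreover have "\<forall>\<^sub>F n in sequentially. y' < z * (1 - l n / n)"
    proof -
      have "(\<lambda>n. z * (1 - l n / n)) \<longlonglongrightarrow> z * (1 - 0)"
        by (intro tendsto_intros l)
      then show ?thesis using order_tendstoD(1)[of _ "z * (1 - 0)" sequentially y'] z by simp
    qed
    moreover have "\<forall>\<^sub>F n in sequentially. n - l n > 0"
      using top eventually_gt_at_top[of 0] unfolding filterlim_iff by blast
    ultimately show ?thesis
      using K'(1) l(2)
    proof eventually_elim
      case (elim n)
      have "z * (n - l n) < log 2 (K (n - l n))"
        using elim(1,3) by (simp add: less_divide_eq)
      then have "z * (real n - l n) / n < log 2 (K (n - l n)) / n"
        using elim(3,5) by (intro divide_strict_right_mono) (auto simp: of_nat_diff)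
      moreover have "z * (real n - l n) / n = z * (1 - l n / n)"
        using elim(3) by (simp add: field_simps)
      ultimately show ?case using elim(2,4) by (simp add: y'(1))
    qed
  qed
qed

text \<open>Achievability prescribes the liminf exactly, and passing to lengths
  \<open>n - l n\<close> may raise it. Hence some \<open>R' \<ge> R\<close> instead of
  \<open>R\<close> itself, which is enough for comparing suprema.\<close>

lemma achievable_uncorrelated:
  fixes W :: "'s::finite \<Rightarrow> 'x::finite \<Rightarrow> 'y::finite \<Rightarrow> real" and V :: "'s \<Rightarrow> 'x \<Rightarrow> 'z::finite \<Rightarrow> real"
  assumes W: "\<forall>s. channel (W s)" and V: "\<forall>s. channel (V s)" and nonsym: "\<not> symmetrizable W"
    and ach: "achievable_mean_ran W V False R"
  shows "\<exists>R'\<ge>R. achievable_mean_ran W V True R'"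
proof -
  obtain K \<Gamma> e D where code: "\<And>n. is_code n (K n) (\<Gamma> n) (e n) (D n)"
    and err: "(\<lambda>n. code_error W n (K n) (\<Gamma> n) (e n) (D n)) \<longlonglongrightarrow> 0"
    and rate: "liminf (\<lambda>n. ereal (log 2 (real (K n)) / real n)) = ereal R"
    and limsup: "limsup (\<lambda>n. ereal (code_leak V n (K n) (\<Gamma> n) (e n))) = 0"
    using ach unfolding achievable_mean_ran_def by blast
  have leak: "(\<lambda>n. code_leak V n (K n) (\<Gamma> n) (e n)) \<longlonglongrightarrow> 0"
    by (rule tendsto_of_limsup_zero[OF code_leak_nonneg[OF code V] limsup])
  have K: "K n \<ge> 1" for n using is_codeD(1)[OF code] .
  obtain l L \<epsilon> where \<epsilon>: "\<epsilon> \<longlonglongrightarrow> 0" and l: "(\<lambda>n. l n / n) \<longlonglongrightarrow> 0"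
    and pre: "\<forall>\<^sub>F n in sequentially. n ^ 6 \<le> L n \<and> (\<exists>c dec. det_code W (l n) (L n) c dec (\<epsilon> n))"
    using ex_prefix_family[OF W nonsym] by blast
  have half: "\<forall>\<^sub>F n in sequentially. 2 * l n \<le> n"
  proof -
    have "\<forall>\<^sub>F n in sequentially. l n / n < 1 / 2"
      using order_tendstoD(2)[OF l, of "1 / 2"] by simp
    then show ?thesis
      using eventually_gt_at_top[of 0]
    proof eventually_elim
      case (elim n)
      then have "real (2 * l n) < real n" by (simp add: divide_less_eq)
      then show ?case by linarith
    qed
  qed
  define m where "m = (\<lambda>n. n - l n)"
  have top: "filterlim m at_top sequentially"
    unfolding filterlim_at_top
  proof
    fix Z
    show "\<forall>\<^sub>F n in sequentially. Z \<le> m n"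
      using half eventually_ge_at_top[of "2 * Z"] by eventually_elim (simp add: m_def)
  qed
  \<comment> \<open>The sampling accuracy is \<open>1 / n ^ 2\<close>, so that the leakage,
    normalized by a bound of order \<open>n\<close>, still loses only a vanishing amount in
    \<open>leak'\<close>.\<close>
  define err' where "err' = (\<lambda>n. code_error W (m n) (K (m n)) (\<Gamma> (m n)) (e (m n)) (D (m n)) + \<epsilon> n + 1 / real n ^ 2)"
  define leak' where "leak' = (\<lambda>n. code_leak V (m n) (K (m n)) (\<Gamma> (m n)) (e (m n))
      + (1 + n * log 2 CARD('y)) * (1 / real n ^ 2))"
  define P where "P = (\<lambda>n (k, e', D'). k \<ge> 1 \<and> is_code n k 1 e' D' \<and> k = K (m n) \<and>
      code_error W n k 1 e' D' \<le> err' n \<and> code_leak V n k 1 e' \<le> leak' n)"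
  have ex: "\<forall>\<^sub>F n in sequentially. \<exists>c. P n c"
  proof -
    have "\<forall>\<^sub>F n in sequentially. code_error W (m n) (K (m n)) (\<Gamma> (m n)) (e (m n)) (D (m n)) < 1 / 2"
      using order_tendstoD(2)[OF filterlim_compose[OF err top], of "1 / 2"] by simp
    \<comment> \<open>Makes the exponent \<open>n ^ 2 / 4\<close> of the sampling bound exceed
      \<open>ln 2 + n * ln CARD('s)\<close>, the logarithm of the number of constraints at length at
      most \<open>n\<close>.\<close>
    moreover have "\<forall>\<^sub>F n in sequentially. real n \<ge> 4 * (1 + ln CARD('s))"
      using filterlim_real_sequentially by (simp add: filterlim_at_top)
    ultimately show ?thesis
      using pre half eventually_ge_at_top[of 1]
    proof eventually_elim
      case (elim n)
      have n: "l n + m n = n" using elim by (simp add: m_def)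
      obtain c dec where cd: "det_code W (l n) (L n) c dec (\<epsilon> n)" using elim by blast
      let ?\<delta> = "1 / real n ^ 2" and ?B = "1 + n * log 2 CARD('y)"
      have "log 2 CARD('y) \<ge> 0" by (simp add: Suc_le_eq)
      then have B: "?B \<ge> 1" by simp
      have "log 2 (K (m n)) \<le> 1 + m n * log 2 CARD('y)"
        using elim by (intro card_messages_le[OF code W]) auto
      also have "\<dots> \<le> ?B"
        using \<open>log 2 CARD('y) \<ge> 0\<close> by (intro add_left_mono mult_right_mono) (auto simp: m_def)
      finally have KB: "log 2 (K (m n)) \<le> ?B" .
      have big: "2 * real CARD('s) ^ m n * exp (- (L n * ?\<delta>\<^sup>2 / 4)) < 1"
      proof -
        have lnS: "ln (real CARD('s)) \<ge> 0" by (simp add: Suc_le_eq)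
        have "real n ^ 6 \<le> L n" using elim by (metis of_nat_le_iff of_nat_power)
        then have "real n ^ 6 * ?\<delta>\<^sup>2 \<le> L n * ?\<delta>\<^sup>2"
          by (intro mult_right_mono) auto
        moreover have "real n ^ 6 * ?\<delta>\<^sup>2 = real n ^ 2"
          using elim by (simp add: power_divide field_simps flip: power_add power_mult)
        ultimately have Ln: "real n ^ 2 / 4 \<le> L n * ?\<delta>\<^sup>2 / 4" by simp
        have "ln 2 + m n * ln (real CARD('s)) < 1 + n * ln (real CARD('s))"
        proof (rule add_less_le_mono)
          show "ln 2 < (1 :: real)" using ln_2_less_1 .
          show "m n * ln (real CARD('s)) \<le> n * ln (real CARD('s))"
            using lnS by (intro mult_right_mono) (auto simp: m_def)
        qed
        also have "\<dots> \<le> n * (1 + ln (real CARD('s)))"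
          using elim by (simp add: distrib_left)
        also have "\<dots> \<le> n * (n / 4)"
          using elim by (intro mult_left_mono) auto
        also have "\<dots> = real n ^ 2 / 4" by (simp add: power2_eq_square)
        also note Ln
        finally have lt: "ln 2 + m n * ln (real CARD('s)) < L n * ?\<delta>\<^sup>2 / 4" .
        have "2 * real CARD('s) ^ m n = exp (ln 2 + m n * ln (real CARD('s)))"
          by (simp add: exp_add exp_of_nat_mult)
        then have "2 * real CARD('s) ^ m n * exp (- (L n * ?\<delta>\<^sup>2 / 4))
            = exp (ln 2 + m n * ln (real CARD('s)) - L n * ?\<delta>\<^sup>2 / 4)"
          by (simp only: exp_add[symmetric]) simp
        also have "\<dots> < 1" using lt by simp
        finally show ?thesis .
      qed
      have "0 < ?\<delta>" "?\<delta> \<le> 1" using elim by (auto simp: divide_le_eq)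
      from ex_uncorrelated_code[OF W V code cd this B KB big]
      show ?case
        unfolding P_def err'_def leak'_def n using K by auto
    qed
  qed
  \<comment> \<open>\<open>P n\<close> can be met only for large \<open>n\<close>, as far as
    \<open>ex\<close> tells, while achievability asks for a code at every \<open>n\<close>;
    \<open>G\<close> falls back on any code elsewhere.\<close>
  define G where "G = (\<lambda>n c. (\<lambda>(k, e', D'). k \<ge> 1 \<and> is_code n k 1 e' D') c \<and> ((\<exists>c. P n c) \<longrightarrow> P n c))"
  have "\<exists>c. G n c" for n
  proof (cases "\<exists>c. P n c")
    case True
    then obtain c where "P n c" by blast
    moreover from this have "(\<lambda>(k, e', D'). k \<ge> 1 \<and> is_code n k 1 e' D') c"
      unfolding P_def by (cases c) simp
    ultimately show ?thesis unfolding G_def by blast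
  next
    case False
    obtain e0 D0 where "is_code n 1 1 (e0 :: nat \<Rightarrow> nat \<Rightarrow> 'x list \<Rightarrow> real) (D0 :: nat \<Rightarrow> nat \<Rightarrow> 'y list set)"
      using ex_trivial_code[OF W V, of n] by blast
    with False have "G n (1, e0, D0)"
      unfolding G_def by simp
    then show ?thesis by blast
  qed
  then obtain F where G: "\<And>n. G n (F n)"
    by metis
  have F1: "(\<lambda>(k, e', D'). k \<ge> 1 \<and> is_code n k 1 e' D') (F n)" for n
    using G[of n] unfolding G_def by (rule conjunct1)
  have F2: "P n (F n)" if "\<exists>c. P n c" for n
    using G[of n] that unfolding G_def by blast
  define K' where "K' = (\<lambda>n. fst (F n))"
  define e' where "e' = (\<lambda>n. fst (snd (F n)))"
  define D' where "D' = (\<lambda>n. snd (snd (F n)))"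
  have code': "is_code n (K' n) 1 (e' n) (D' n)" "K' n \<ge> 1" for n
    using F1[of n] by (auto simp: K'_def e'_def D'_def case_prod_beta)
  have good: "\<forall>\<^sub>F n in sequentially. K' n = K (m n) \<and>
      code_error W n (K' n) 1 (e' n) (D' n) \<le> err' n \<and> code_leak V n (K' n) 1 (e' n) \<le> leak' n"
    using ex
  proof eventually_elim
    case (elim n)
    from F2[OF this] show ?case by (auto simp: P_def K'_def e'_def D'_def case_prod_beta)
  qed
  have inv: "(\<lambda>n. 1 / real n ^ 2) \<longlonglongrightarrow> 0"
    using tendsto_mult[OF lim_1_over_n[where 'a = real] lim_1_over_n[where 'a = real]]
    by (simp add: power2_eq_square)
  have "(\<lambda>n. code_error W n (K' n) 1 (e' n) (D' n)) \<longlonglongrightarrow> 0"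
  proof (rule tendsto_sandwich[OF _ _ tendsto_const])
    have "err' \<longlonglongrightarrow> 0 + 0 + 0"
      unfolding err'_def by (intro tendsto_add filterlim_compose[OF err top] \<epsilon> inv)
    then show "err' \<longlonglongrightarrow> 0" by simp
    show "\<forall>\<^sub>F n in sequentially. code_error W n (K' n) 1 (e' n) (D' n) \<le> err' n"
      using good by eventually_elim blast
  qed (use code_error_nonneg[OF code'(1) W] in auto)
  moreover have "(\<lambda>n. code_leak V n (K' n) 1 (e' n)) \<longlonglongrightarrow> 0"
  proof (rule tendsto_sandwich[OF _ _ tendsto_const])
    have "(\<lambda>n. 1 / real n ^ 2 + log 2 CARD('y) * (1 / real n)) \<longlonglongrightarrow> 0 + log 2 CARD('y) * 0"
      by (intro tendsto_intros inv lim_1_over_n)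
    moreover have "1 / real n ^ 2 + log 2 CARD('y) * (1 / real n) = (1 + n * log 2 CARD('y)) * (1 / real n ^ 2)" for n
      by (cases "n = 0") (simp_all add: field_simps power2_eq_square)
    ultimately have "(\<lambda>n. (1 + n * log 2 CARD('y)) * (1 / real n ^ 2)) \<longlonglongrightarrow> 0"
      by simp
    then have "leak' \<longlonglongrightarrow> 0 + 0"
      unfolding leak'_def by (intro tendsto_add filterlim_compose[OF leak top])
    then show "leak' \<longlonglongrightarrow> 0" by simp
    show "\<forall>\<^sub>F n in sequentially. code_leak V n (K' n) 1 (e' n) \<le> leak' n"
      using good by eventually_elim blast
  qed (use code_leak_nonneg[OF code'(1) V] in auto)
  then have "limsup (\<lambda>n. ereal (code_leak V n (K' n) 1 (e' n))) = 0"
    by (intro lim_imp_Limsup) (auto simp: zero_ereal_def)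
  moreover have R': "ereal R \<le> liminf (\<lambda>n. ereal (log 2 (real (K' n)) / real n))"
  proof (rule rate_after_prefix[OF K l _ _ _ code'(2) rate])
    show "\<forall>\<^sub>F n in sequentially. l n \<le> n" using half by eventually_elim simp
    show "filterlim (\<lambda>n. n - l n) at_top sequentially" using top by (simp add: m_def)
    show "\<forall>\<^sub>F n in sequentially. K' n = K (n - l n)" using good by eventually_elim (simp add: m_def)
  qed
  \<comment> \<open>Achievability requires a real number as liminf; \<open>R\<close> from below and
    the crude converse from above exclude infinite values.\<close>
  moreover obtain R1 where R1: "liminf (\<lambda>n. ereal (log 2 (real (K' n)) / real n)) = ereal R1"
  proof -
    have "liminf (\<lambda>n. ereal (log 2 (real (K' n)) / real n)) \<le> ereal (1 + log 2 CARD('y))"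
      using liminf_rate_le[OF W code'(1) calculation(1)] .
    with R' that show thesis
      by (cases "liminf (\<lambda>n. ereal (log 2 (real (K' n)) / real n))") auto
  qed
  ultimately have "R \<le> R1" "achievable_mean_ran W V True R1"
    unfolding achievable_mean_ran_def
    by (simp, intro exI[of _ K'] exI[of _ "\<lambda>_. 1"] exI[of _ e'] exI[of _ D'] conjI allI impI)
       (use code'(1) in auto)
  then show ?thesis by blast
qed

theorem theorem2:
  fixes W :: "'s::finite \<Rightarrow> 'x::finite \<Rightarrow> 'y::finite \<Rightarrow> real"
    and V :: "'s \<Rightarrow> 'x \<Rightarrow> 'z::finite \<Rightarrow> real"
  assumes "\<forall>s. channel (W s)" and "\<forall>s. channel (V s)"
  shows "(symmetrizable W \<longrightarrow> C_S W V = 0) \<and>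
         (\<not> symmetrizable W \<longrightarrow> C_S W V = C_S_ran_mean W V)"
proof (intro conjI impI)
  assume "symmetrizable W"
  \<comment> \<open>The exact set is needed: \<open>Sup\<close> of an empty set of reals is
    unspecified, so rate 0 must be shown to be achieved.\<close>
  then have "{R. achievable_mean_ran W V True R} = {0}"
    using symmetrizable_achievable[OF assms(1)] achievable_zero[OF assms] by blast
  then show "C_S W V = 0" by (simp add: C_S_def)
next
  assume nonsym: "\<not> symmetrizable W"
  let ?T = "{R. achievable_mean_ran W V True R}" and ?F = "{R. achievable_mean_ran W V False R}"
  \<comment> \<open>An uncorrelated code is a correlated one with \<open>\<Gamma> n = 1\<close>, and
    both capacities use the same \<open>code_leak\<close>.\<close>
  have sub: "?T \<subseteq> ?F" unfolding achievable_mean_ran_def by blast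
  have bdd: "bdd_above ?F" using achievable_bounds(2)[OF assms(1)] by (intro bdd_aboveI) blast
  have ne: "?T \<noteq> {}" using achievable_zero[OF assms] by blast
  have "Sup ?T \<le> Sup ?F" by (rule cSup_subset_mono[OF ne bdd sub])
  moreover have "Sup ?F \<le> Sup ?T"
  proof (rule cSup_mono)
    show "?F \<noteq> {}" using ne sub by blast
    show "bdd_above ?T" using bdd sub by (rule bdd_above_mono)
    show "\<exists>a\<in>?T. b \<le> a" if "b \<in> ?F" for b
      using achievable_uncorrelated[OF assms nonsym] that by blast
  qed
  ultimately show "C_S W V = C_S_ran_mean W V"
    by (simp add: C_S_def C_S_ran_mean_def)
qed

end
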